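(* Let $k$ be an algebraically closed field of characteristic zero and $\mathcal{Q}uad=\mathcal{D}end\,\blacksquare\,\mathcal{D}end$ over $k$. (a) There are bases, indexed by pairs in $\{1,\dots,l\}^2$, of the spaces $\mathcal{Q}uad^!(l)^\vee$ for $l\ge2$, inducing a basis of $\tilde{\mathcal{E}}_n$ consisting of labelled trees, such that for every $n\ge2$ there is a map of complexes from $\mathcal{QA}_n$ to the augmented dual bar complex $\mathcal{E}_n$ of $\mathcal{Q}uad$ identifying $\mathcal{QA}_n$ with a direct summand, and such that each basis element of $\tilde{\mathcal{E}}_n$ appears with non-zero coefficient in the image of exactly one basis element of $\mathcal{QA}_n$, where the coefficient is $1$. (b) The dimension of $\mathcal{Q}uad^!(n)$ is $n^2$ for every $n\ge1$.
   Context: Conventions. All operads are non-symmetric operads over $k$. "Tree" means a planar rooted tree in which each vertex $v$ has $|v|\ge2$ incoming edges; an internal edge is an edge between two vertices. For a finite-dimensional vector space $\Omega$ and $\Lambda\subset\Omega^{\otimes 2}\oplus\Omega^{\otimes 2}$, $\mathcal{P}(\Omega,\Lambda)$ is the operad generated by binary operations $\Omega$ with relations $u=v$ for $(u,v)\in\Lambda$, where $\circ_1\otimes\circ_2$ in the first summand stands for $(x\circ_1 y)\circ_2 z$ and $\circ_3\otimes\circ_4$ in the second stands for $x\circ_3(y\circ_4 z)$. Its quadratic dual is $\mathcal{P}(\Omega,\Lambda)^!=\mathcal{P}(\Omega^\vee,\Lambda^\perp)$, $\Lambda^\perp=\{(f,g): f(u)=g(v)\ \forall (u,v)\in\Lambda\}$.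 $\mathcal{D}end$ is generated by $\prec,\succ$ with relations, where $*=\prec+\succ$: $(x\prec y)\prec z=x\prec(y*z)$; $(x\succ y)\prec z=x\succ(y\prec z)$; $(x*y)\succ z=x\succ(y\succ z)$. Black square product: $\mathcal{P}(\Omega_1,\Lambda_1)\,\blacksquare\,\mathcal{P}(\Omega_2,\Lambda_2)=\mathcal{P}(\Omega_1\otimes\Omega_2,\,S_{23}(\Lambda_1\otimes\Lambda_2))$, where $S_{23}(\Lambda_1\otimes\Lambda_2)$ is the span of the elements $(S_{23}(u\otimes u'),S_{23}(v\otimes v'))$ for $(u,v)\in\Lambda_1$, $(u',v')\in\Lambda_2$, and $S_{23}:\Omega_1^{\otimes2}\otimes\Omega_2^{\otimes2}\to(\Omega_1\otimes\Omega_2)^{\otimes2}$ switches the second and third tensor factors. Associahedron. $\mathcal{CA}_n$ is the augmented cellular chain complex of the $(n-2)$-dimensional associahedron, graded by minus the dimension of cells: $\mathcal{CA}_n^j$ ($-n+2\le j\le0$) has as basis the trees with $n$ leaves and $n+j-1$ vertices, and $\mathcal{CA}_n^1=k$. The differential raises degree by one; the coefficient $\varepsilon(T,T')$ of $T'$ in the differential of $T$ is $\pm1$ if $T$ is obtained from $T'$ by contracting an internal edge and $0$ otherwise, the signs being determined by a fixed choice of orientations of the cells in which each $1$-cell is oriented from the tree containing the local shape $(xy)z$ to the one containing $x(yz)$; each binary tree is sent to $1\in\mathcal{CA}_n^1$. Labelled copies. For a tree $T$ with $n$ leaves and $1\le i\le n$, the $i$-th labelling of $T$ assigns to each vertex on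 the path from the $i$-th leaf (from the left) to the root the number $r$ such that this path enters the vertex through its $r$-th incoming edge from the left, and assigns $*$ to every other vertex. $\mathcal{QA}_n$ is the direct sum of $n^2$ copies of $\mathcal{CA}_n$, indexed by $(i,j)\in\{1,\dots,n\}^2$; in degrees $\le0$ the basis of the $(i,j)$-th copy consists of the trees in which each vertex carries the pair formed by its label in the $i$-th labelling and its label in the $j$-th labelling, with differential coefficients the same $\varepsilon(T,T')$ as in $\mathcal{CA}_n$. Dual bar complex. $\tilde{\mathcal{E}}_n$ is the arity $n$ part of the bar complex of $\mathcal{Q}uad^!$: $\tilde{\mathcal{E}}_n^j=\mathcal{E}_n^j=\bigoplus_T\bigotimes_v\mathcal{Q}uad^!(|v|)^\vee$ ($-n+2\le j\le0$), over trees $T$ with $n$ leaves and $n+j-1$ vertices. The differential raises degree by one; its component from $T$ to $T'$ is zero unless $T$ is obtained from $T'$ by contracting an internal edge, in which case it is $\varepsilon(T,T')$ times the dual of the corresponding partial composition of $\mathcal{Q}uad^!$. Its homology in degree $0$ is $\mathcal{Q}uad(n)$. The augmented complex $\mathcal{E}_n$ equals $\tilde{\mathcal{E}}_n$ in degrees $\le0$ and has $\mathcal{E}_n^1=\mathcal{Q}uad(n)$, with the canonical quotient map $\mathcal{E}_n^0\to\mathcal{Q}uad(n)$. Given bases of $\mathcal{Q}uad^!(l)^\vee$ indexed by $\{1,\dots,l\}^2$, the induced basis of $\tilde{\mathcal{E}}_n$ consists of trees with each vertex $v$ labelled by a pair in $\{1,\dots,|v|\}^2$. *)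

theory Defs
  imports
    "HOL-Computational_Algebra.Polynomial"
    "HOL-Library.Function_Algebras"
    "HOL-Library.Product_Plus"
begin

section \<open>Linear algebra\<close>

text \<open>
  Vector spaces whose elements are functions into the ground field are subspaces of a
  function type, with pointwise operations. The free vector space on a finite set \<open>S\<close> is
  \<open>supported_on S\<close>.
\<close>

definition fscale :: "'k::field \<Rightarrow> ('a \<Rightarrow> 'k) \<Rightarrow> 'a \<Rightarrow> 'k" where
  "fscale c x = (\<lambda>a. c * x a)"

interpretation fun_vs: vector_space "fscale :: 'k::field \<Rightarrow> ('a \<Rightarrow> 'k) \<Rightarrow> 'a \<Rightarrow> 'k"
  by unfold_locales (simp_all add: fscale_def fun_eq_iff algebra_simps)

definition pair_scale :: "'k::field \<Rightarrow> ('a \<Rightarrow> 'k) \<times> ('b \<Rightarrow> 'k) \<Rightarrow> ('a \<Rightarrow> 'k) \<times> ('b \<Rightarrow> 'k)" where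
  "pair_scale c p = (fscale c (fst p), fscale c (snd p))"

interpretation pair_vs:
  vector_space "pair_scale :: 'k::field \<Rightarrow> ('a \<Rightarrow> 'k) \<times> ('b \<Rightarrow> 'k) \<Rightarrow> ('a \<Rightarrow> 'k) \<times> ('b \<Rightarrow> 'k)"
  by unfold_locales
    (simp_all add: pair_scale_def fscale_def fun_eq_iff prod_eq_iff algebra_simps)

definition supported_on :: "'a set \<Rightarrow> ('a \<Rightarrow> 'k::field) set" where
  "supported_on S = {x. \<forall>a. a \<notin> S \<longrightarrow> x a = 0}"

definition delta :: "'a \<Rightarrow> 'a \<Rightarrow> 'k::field" where
  "delta a = (\<lambda>b. if b = a then 1 else 0)"

definition is_basis :: "('a \<Rightarrow> 'k::field) set \<Rightarrow> 'i set \<Rightarrow> ('i \<Rightarrow> 'a \<Rightarrow> 'k) \<Rightarrow> bool" where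
  "is_basis V J e \<longleftrightarrow> inj_on e J \<and> fun_vs.independent (e ` J) \<and> fun_vs.span (e ` J) = V"

text \<open>
  Quotients of such spaces are not subspaces of a type carrying an addition, so vector spaces
  with explicit carrier and operations are used where quotients occur.
\<close>

record ('k, 'v) vspace =
  car :: "'v set"
  vadd :: "'v \<Rightarrow> 'v \<Rightarrow> 'v"
  vscale :: "'k \<Rightarrow> 'v \<Rightarrow> 'v"

definition fun_space :: "('a \<Rightarrow> 'k::field) set \<Rightarrow> ('k, 'a \<Rightarrow> 'k) vspace" where
  "fun_space V = \<lparr>car = V, vadd = (+), vscale = fscale\<rparr>"

definition scalars :: "('k::field, 'k) vspace" where
  "scalars = \<lparr>car = UNIV, vadd = (+), vscale = (*)\<rparr>"

definition cls :: "('a \<Rightarrow> 'k::field) set \<Rightarrow> ('a \<Rightarrow> 'k) \<Rightarrow> ('a \<Rightarrow> 'k) set" where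
  "cls I x = {y. y - x \<in> I}"

definition quotient_space ::
  "('a \<Rightarrow> 'k::field) set \<Rightarrow> ('a \<Rightarrow> 'k) set \<Rightarrow> ('k, ('a \<Rightarrow> 'k) set) vspace" where
  "quotient_space V I =
    \<lparr>car = cls I ` V,
     vadd = (\<lambda>A B. \<Union>x\<in>A. \<Union>y\<in>B. cls I (x + y)),
     vscale = (\<lambda>c A. \<Union>x\<in>A. cls I (fscale c x))\<rparr>"

definition linear_map :: "('k::field, 'v) vspace \<Rightarrow> ('k, 'w) vspace \<Rightarrow> ('v \<Rightarrow> 'w) \<Rightarrow> bool" where
  "linear_map V W f \<longleftrightarrow>
    (\<forall>x\<in>car V. f x \<in> car W) \<and>
    (\<forall>x\<in>car V. \<forall>y\<in>car V. f (vadd V x y) = vadd W (f x) (f y)) \<and>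
    (\<forall>c. \<forall>x\<in>car V. f (vscale V c x) = vscale W c (f x))"

text \<open>Functionals are extended by zero outside the carrier, so that equal functionals are equal
  as functions.\<close>

definition dual :: "('k::field, 'v) vspace \<Rightarrow> ('v \<Rightarrow> 'k) set" where
  "dual V = {\<phi> \<in> supported_on (car V). linear_map V scalars \<phi>}"

definition has_dim :: "('k::field, 'v) vspace \<Rightarrow> nat \<Rightarrow> bool" where
  "has_dim V d \<longleftrightarrow>
    (\<exists>f. linear_map (fun_space (supported_on {..<d})) V f \<and>
         bij_betw f (supported_on {..<d} :: (nat \<Rightarrow> 'k) set) (car V))"

definition vsubspace :: "('k::field, 'v) vspace \<Rightarrow> 'v set \<Rightarrow> bool" where
  "vsubspace V S \<longleftrightarrow>
    S \<subseteq> car V \<and> S \<noteq> {} \<and>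
    (\<forall>x\<in>S. \<forall>y\<in>S. vadd V x y \<in> S) \<and> (\<forall>c. \<forall>x\<in>S. vscale V c x \<in> S)"

definition direct_sum :: "('k::field, 'v) vspace \<Rightarrow> 'v set \<Rightarrow> 'v set \<Rightarrow> bool" where
  "direct_sum V A B \<longleftrightarrow>
    vsubspace V A \<and> vsubspace V B \<and>
    (\<forall>x\<in>car V. \<exists>!p. p \<in> A \<times> B \<and> x = vadd V (fst p) (snd p))"


section \<open>Augmented complexes\<close>

text \<open>
  \<open>spc X j\<close> is the term in degree \<open>j \<le> 0\<close>, \<open>df X j\<close> is the differential from degree \<open>j\<close> to
  degree \<open>j + 1\<close> for \<open>j < 0\<close>, \<open>aspc X\<close> is the term in degree 1 and \<open>aug X\<close> is the differential
  from degree 0 to degree 1. The values for \<open>j > 0\<close> play no role.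
\<close>

record ('k, 'v, 'w) aug_complex =
  spc :: "int \<Rightarrow> ('k, 'v) vspace"
  df :: "int \<Rightarrow> 'v \<Rightarrow> 'v"
  aspc :: "('k, 'w) vspace"
  aug :: "'v \<Rightarrow> 'w"

definition chain_map ::
  "('k::field, 'v, 'w) aug_complex \<Rightarrow> ('k, 'a, 'b) aug_complex \<Rightarrow>
   (int \<Rightarrow> 'v \<Rightarrow> 'a) \<Rightarrow> ('w \<Rightarrow> 'b) \<Rightarrow> bool" where
  "chain_map X Y f g \<longleftrightarrow>
    (\<forall>j\<le>0. linear_map (spc X j) (spc Y j) (f j)) \<and>
    linear_map (aspc X) (aspc Y) g \<and>
    (\<forall>j<0. \<forall>x\<in>car (spc X j). f (j + 1) (df X j x) = df Y j (f j x)) \<and>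
    (\<forall>x\<in>car (spc X 0). g (aug X x) = aug Y (f 0 x))"

definition embeds_as_direct_summand ::
  "('k::field, 'v, 'w) aug_complex \<Rightarrow> ('k, 'a, 'b) aug_complex \<Rightarrow>
   (int \<Rightarrow> 'v \<Rightarrow> 'a) \<Rightarrow> ('w \<Rightarrow> 'b) \<Rightarrow> bool" where
  "embeds_as_direct_summand X Y f g \<longleftrightarrow>
    (\<forall>j\<le>0. inj_on (f j) (car (spc X j))) \<and> inj_on g (car (aspc X)) \<and>
    (\<exists>C D.
      (\<forall>j\<le>0. direct_sum (spc Y j) (f j ` car (spc X j)) (C j)) \<and>
      direct_sum (aspc Y) (g ` car (aspc X)) D \<and>
      (\<forall>j<0. df Y j ` C j \<subseteq> C (j + 1)) \<and>
      aug Y ` C 0 \<subseteq> D)"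


section \<open>Planar rooted trees\<close>

text \<open>
  Vertices carry labels of type \<open>'a\<close>; the list gives the subtrees at the incoming edges from
  left to right. Unlabelled trees are elements of \<open>unit ptree\<close>.
\<close>

datatype 'a ptree = Leaf | Node 'a "'a ptree list"

fun leaves :: "'a ptree \<Rightarrow> nat" where
  "leaves Leaf = 1"
| "leaves (Node a ts) = sum_list (map leaves ts)"

fun vertices :: "'a ptree \<Rightarrow> nat" where
  "vertices Leaf = 0"
| "vertices (Node a ts) = Suc (sum_list (map vertices ts))"

definition deg :: "'a ptree \<Rightarrow> int" where
  "deg t = int (vertices t) + 1 - int (leaves t)"

definition shape :: "'a ptree \<Rightarrow> unit ptree" where
  "shape = map_ptree (\<lambda>_. ())"

fun labelled_in :: "(nat \<Rightarrow> 'a set) \<Rightarrow> 'a ptree \<Rightarrow> bool" where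
  "labelled_in L Leaf \<longleftrightarrow> True"
| "labelled_in L (Node a ts) \<longleftrightarrow>
    length ts \<ge> 2 \<and> a \<in> L (length ts) \<and> (\<forall>t\<in>set ts. labelled_in L t)"

text \<open>The trees with \<open>n\<close> leaves, all vertices \<open>v\<close> with \<open>\<bar>v\<bar> \<ge> 2\<close>, and the label of \<open>v\<close> in
  \<open>L \<bar>v\<bar>\<close>.\<close>

definition ltrees :: "(nat \<Rightarrow> 'a set) \<Rightarrow> nat \<Rightarrow> 'a ptree set" where
  "ltrees L n = {t. leaves t = n \<and> labelled_in L t}"

definition trees :: "nat \<Rightarrow> unit ptree set" where
  "trees n = ltrees (\<lambda>_. UNIV) n"

definition binary_trees :: "nat \<Rightarrow> 'a ptree set" where
  "binary_trees n = ltrees (\<lambda>l. if l = 2 then UNIV else {}) n"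

text \<open>
  A vertex is given by the path (of child indices, counted from 0) leading to it from the root,
  an internal edge by the path to its upper vertex.
\<close>

fun vertex_at :: "'a ptree \<Rightarrow> nat list \<Rightarrow> bool" where
  "vertex_at Leaf p \<longleftrightarrow> False"
| "vertex_at (Node a ts) [] \<longleftrightarrow> True"
| "vertex_at (Node a ts) (i # p) \<longleftrightarrow> i < length ts \<and> vertex_at (ts ! i) p"

definition internal_edges :: "'a ptree \<Rightarrow> nat list set" where
  "internal_edges t = {p. p \<noteq> [] \<and> vertex_at t p}"

text \<open>
  Contracting an internal edge. If the lower vertex has label \<open>a\<close> and arity \<open>m\<close>, the upper one
  has label \<open>b\<close> and arity \<open>n\<close>, and the edge is the one with index \<open>i\<close> at the lower vertex, then
  the new vertex has label \<open>h m i n a b\<close>.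
\<close>

fun contract :: "(nat \<Rightarrow> nat \<Rightarrow> nat \<Rightarrow> 'a \<Rightarrow> 'a \<Rightarrow> 'a) \<Rightarrow> 'a ptree \<Rightarrow> nat list \<Rightarrow> 'a ptree" where
  "contract h (Node a ts) [i] =
    (case ts ! i of
       Leaf \<Rightarrow> Node a ts
     | Node b us \<Rightarrow>
         Node (h (length ts) i (length us) a b) (take i ts @ us @ drop (Suc i) ts))"
| "contract h (Node a ts) (i # j # p) = Node a (ts[i := contract h (ts ! i) (j # p)])"
| "contract h t p = t"

definition contract_shape :: "unit ptree \<Rightarrow> nat list \<Rightarrow> unit ptree" where
  "contract_shape = contract (\<lambda>_ _ _ _ _. ())"

text \<open>\<open>graft t i s\<close> grafts \<open>s\<close> on the leaf of \<open>t\<close> with index \<open>i\<close>, counted from 0.\<close>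

fun graft :: "'a ptree \<Rightarrow> nat \<Rightarrow> 'a ptree \<Rightarrow> 'a ptree"
  and graft_list :: "'a ptree list \<Rightarrow> nat \<Rightarrow> 'a ptree \<Rightarrow> 'a ptree list" where
  "graft Leaf i s = s"
| "graft (Node a ts) i s = Node a (graft_list ts i s)"
| "graft_list [] i s = []"
| "graft_list (t # ts) i s =
    (if i < leaves t then graft t i s # ts else t # graft_list ts (i - leaves t) s)"


section \<open>Operads generated by binary operations\<close>

text \<open>
  The space of generators is \<open>'g \<Rightarrow> 'k\<close> for a finite type \<open>'g\<close>, that is, it has the basis \<open>'g\<close>;
  its tensor square is \<open>'g \<times> 'g \<Rightarrow> 'k\<close>, and the dual space is identified with \<open>'g \<Rightarrow> 'k\<close>
  through the dual basis. In arity \<open>n\<close> the free operad has as basis the binary trees with \<open>n\<close>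
  leaves and vertices labelled by \<open>'g\<close>. The \<open>i\<close>-th partial composition has index \<open>i - 1\<close>.
\<close>

type_synonym ('g, 'k) relations = "(('g \<times> 'g \<Rightarrow> 'k) \<times> ('g \<times> 'g \<Rightarrow> 'k)) set"
type_synonym ('g, 'k) op_class = "('g ptree \<Rightarrow> 'k) set"

abbreviation free_operad :: "nat \<Rightarrow> ('g ptree \<Rightarrow> 'k::field) set" where
  "free_operad n \<equiv> supported_on (binary_trees n)"

definition free_comp ::
  "nat \<Rightarrow> ('g ptree \<Rightarrow> 'k::field) \<Rightarrow> ('g ptree \<Rightarrow> 'k) \<Rightarrow> 'g ptree \<Rightarrow> 'k" where
  "free_comp i x y =
    (\<Sum>t | x t \<noteq> 0. \<Sum>s | y s \<noteq> 0. fscale (x t * y s) (delta (graft t i s)))"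

definition left_tree :: "'g \<times> 'g \<Rightarrow> 'g ptree" where
  "left_tree = (\<lambda>(a, b). Node b [Node a [Leaf, Leaf], Leaf])"

definition right_tree :: "'g \<times> 'g \<Rightarrow> 'g ptree" where
  "right_tree = (\<lambda>(a, b). Node a [Leaf, Node b [Leaf, Leaf]])"

definition relator ::
  "('g::finite \<times> 'g \<Rightarrow> 'k::field) \<Rightarrow> ('g \<times> 'g \<Rightarrow> 'k) \<Rightarrow> 'g ptree \<Rightarrow> 'k" where
  "relator u v =
    (\<Sum>p\<in>UNIV. fscale (u p) (delta (left_tree p))) -
    (\<Sum>p\<in>UNIV. fscale (v p) (delta (right_tree p)))"

text \<open>The operadic ideal generated by the relations, arity by arity.\<close>

inductive in_ideal :: "('g::finite, 'k::field) relations \<Rightarrow> nat \<Rightarrow> ('g ptree \<Rightarrow> 'k) \<Rightarrow> bool"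
  for \<Lambda> where
  rel: "(u, v) \<in> \<Lambda> \<Longrightarrow> in_ideal \<Lambda> 3 (relator u v)"
| zero: "in_ideal \<Lambda> n 0"
| add: "in_ideal \<Lambda> n x \<Longrightarrow> in_ideal \<Lambda> n y \<Longrightarrow> in_ideal \<Lambda> n (x + y)"
| scale: "in_ideal \<Lambda> n x \<Longrightarrow> in_ideal \<Lambda> n (fscale c x)"
| comp_left: "in_ideal \<Lambda> m x \<Longrightarrow> y \<in> free_operad n \<Longrightarrow> i < m \<Longrightarrow>
    in_ideal \<Lambda> (m + n - 1) (free_comp i x y)"
| comp_right: "x \<in> free_operad m \<Longrightarrow> in_ideal \<Lambda> n y \<Longrightarrow> i < m \<Longrightarrow>
    in_ideal \<Lambda> (m + n - 1) (free_comp i x y)"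

definition op_ideal :: "('g::finite, 'k::field) relations \<Rightarrow> nat \<Rightarrow> ('g ptree \<Rightarrow> 'k) set" where
  "op_ideal \<Lambda> n = {x. in_ideal \<Lambda> n x}"

definition operad ::
  "('g::finite, 'k::field) relations \<Rightarrow> nat \<Rightarrow> ('k, ('g, 'k) op_class) vspace" where
  "operad \<Lambda> n = quotient_space (free_operad n) (op_ideal \<Lambda> n)"

text \<open>The partial composition \<open>P(m) \<times> P(n) \<rightarrow> P(m + n - 1)\<close> with index \<open>i\<close>.\<close>

definition op_comp ::
  "('g::finite, 'k::field) relations \<Rightarrow> nat \<Rightarrow> nat \<Rightarrow> nat \<Rightarrow>
   ('g, 'k) op_class \<Rightarrow> ('g, 'k) op_class \<Rightarrow> ('g, 'k) op_class" where
  "op_comp \<Lambda> m i n A B = (\<Union>x\<in>A. \<Union>y\<in>B. cls (op_ideal \<Lambda> (m + n - 1)) (free_comp i x y))"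

definition op_generator :: "('g::finite, 'k::field) relations \<Rightarrow> 'g \<Rightarrow> ('g, 'k) op_class" where
  "op_generator \<Lambda> g = cls (op_ideal \<Lambda> 2) (delta (Node g [Leaf, Leaf]))"

text \<open>The relations of the quadratic dual of \<open>operad \<Lambda>\<close>.\<close>

definition orth :: "('g::finite, 'k::field) relations \<Rightarrow> ('g, 'k) relations" where
  "orth \<Lambda> = {(f, g). \<forall>(u, v)\<in>\<Lambda>. (\<Sum>p\<in>UNIV. f p * u p) = (\<Sum>p\<in>UNIV. g p * v p)}"

definition s23 ::
  "('g \<times> 'g \<Rightarrow> 'k::field) \<Rightarrow> ('h \<times> 'h \<Rightarrow> 'k) \<Rightarrow> ('g \<times> 'h) \<times> ('g \<times> 'h) \<Rightarrow> 'k" where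
  "s23 u u' = (\<lambda>((a, a'), (b, b')). u (a, b) * u' (a', b'))"

definition black_square ::
  "('g, 'k::field) relations \<Rightarrow> ('h, 'k) relations \<Rightarrow> ('g \<times> 'h, 'k) relations" where
  "black_square \<Lambda>\<^sub>1 \<Lambda>\<^sub>2 =
    pair_vs.span {(s23 u u', s23 v v') | u v u' v'. (u, v) \<in> \<Lambda>\<^sub>1 \<and> (u', v') \<in> \<Lambda>\<^sub>2}"

datatype dend_op = Prec | Succ

instance dend_op :: finite
proof
  have "(UNIV :: dend_op set) = {Prec, Succ}"
    using dend_op.exhaust by blast
  then show "finite (UNIV :: dend_op set)"
    by (metis finite.emptyI finite_insert)
qed

definition dend :: "(dend_op, 'k::field) relations" where
  "dend =
    {(delta (Prec, Prec), delta (Prec, Prec) + delta (Prec, Succ)),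
     (delta (Succ, Prec), delta (Succ, Prec)),
     (delta (Prec, Succ) + delta (Succ, Succ), delta (Succ, Succ))}"


section \<open>Cells of the associahedron\<close>

text \<open>
  The cells of the associahedra are the trees. A choice of orientations of the cells amounts to
  its incidence numbers \<open>\<epsilon> T T'\<close>; these are the functions that are \<open>\<plusminus>1\<close> on the pairs of a cell
  and a codimension one face and 0 elsewhere, give a differential of square zero, and for a
  1-cell are 1 at its end point and -1 at its starting point (this is the compatibility with
  the augmentation). An internal edge of a binary tree \<open>T'\<close> with last path index 0 is a local
  shape \<open>(xy)z\<close>, one with last path index 1 is a local shape \<open>x(yz)\<close>. As the associahedron is a
  regular cell complex, any two functions with these properties differ only by changes of
  orientation of cells of dimension at least 2.
\<close>

definition incidence :: "(unit ptree \<Rightarrow> unit ptree \<Rightarrow> int) \<Rightarrow> bool" where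
  "incidence \<epsilon> \<longleftrightarrow>
    (\<forall>n. \<forall>T\<in>trees n. \<forall>T'\<in>trees n.
      (if \<exists>e\<in>internal_edges T'. T = contract_shape T' e
       then \<epsilon> T T' \<in> {1, -1} else \<epsilon> T T' = 0)) \<and>
    (\<forall>n. \<forall>T\<in>trees n. \<forall>T''\<in>trees n. (\<Sum>T'\<in>trees n. \<epsilon> T T' * \<epsilon> T' T'') = 0) \<and>
    (\<forall>n. \<forall>T'\<in>binary_trees n. \<forall>e\<in>internal_edges T'.
      \<epsilon> (contract_shape T' e) T' = (if last e = 0 then -1 else 1))"


section \<open>Labelled copies of the cellular complex\<close>

text \<open>
  \<open>labelling i t\<close> adds to each vertex of \<open>t\<close> its label in the \<open>i\<close>-th labelling, where \<open>None\<close>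
  stands for the label \<open>*\<close>. Leaves and incoming edges are counted from 1 here; in a subtree
  not containing the leaf in question the counter is 0 or exceeds the number of leaves.
\<close>

fun incoming_edge :: "nat \<Rightarrow> 'a ptree list \<Rightarrow> nat" where
  "incoming_edge i [] = 0"
| "incoming_edge i (t # ts) = (if i \<le> leaves t then 1 else Suc (incoming_edge (i - leaves t) ts))"

fun labelling :: "nat \<Rightarrow> 'a ptree \<Rightarrow> (nat option \<times> 'a) ptree"
  and labelling_list :: "nat \<Rightarrow> 'a ptree list \<Rightarrow> (nat option \<times> 'a) ptree list" where
  "labelling i Leaf = Leaf"
| "labelling i (Node a ts) =
    Node (if 1 \<le> i \<and> i \<le> leaves (Node a ts) then Some (incoming_edge i ts) else None, a)
      (labelling_list i ts)"
| "labelling_list i [] = []"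
| "labelling_list i (t # ts) = labelling i t # labelling_list (i - leaves t) ts"

definition pair_labelling :: "nat \<Rightarrow> nat \<Rightarrow> 'a ptree \<Rightarrow> (nat option \<times> nat option) ptree" where
  "pair_labelling i j t = map_ptree (\<lambda>(r, s, _). (r, s)) (labelling i (labelling j t))"

text \<open>\<open>((i, j), X)\<close> is the basis element \<open>X\<close> of the copy with index \<open>(i, j)\<close>.\<close>

type_synonym qa_cell = "(nat \<times> nat) \<times> (nat option \<times> nat option) ptree"

definition qa_basis :: "nat \<Rightarrow> qa_cell set" where
  "qa_basis n = {((i, j), X). (i, j) \<in> {1..n} \<times> {1..n} \<and> X \<in> pair_labelling i j ` trees n}"

definition qa_diff ::
  "(unit ptree \<Rightarrow> unit ptree \<Rightarrow> int) \<Rightarrow> nat \<Rightarrow> int \<Rightarrow> (qa_cell \<Rightarrow> 'k::field) \<Rightarrow> qa_cell \<Rightarrow> 'k" where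
  "qa_diff \<epsilon> n d F = (\<lambda>(ij, X').
    if (ij, X') \<in> qa_basis n \<and> deg X' = d + 1
    then \<Sum>X | (ij, X) \<in> qa_basis n \<and> deg X = d.
           of_int (\<epsilon> (shape X) (shape X')) * F (ij, X)
    else 0)"

definition QA ::
  "(unit ptree \<Rightarrow> unit ptree \<Rightarrow> int) \<Rightarrow> nat \<Rightarrow>
   ('k::field, qa_cell \<Rightarrow> 'k, nat \<times> nat \<Rightarrow> 'k) aug_complex" where
  "QA \<epsilon> n =
    \<lparr>spc = (\<lambda>d. fun_space (supported_on {x \<in> qa_basis n. deg (snd x) = d})),
     df = qa_diff \<epsilon> n,
     aspc = fun_space (supported_on ({1..n} \<times> {1..n})),
     aug = (\<lambda>F ij. \<Sum>X | (ij, X) \<in> qa_basis n \<and> deg X = 0. F (ij, X))\<rparr>"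


section \<open>The augmented dual bar complex\<close>

text \<open>
  For a tree with functionals \<open>\<phi>\<^sub>v\<close> at the vertices, their tensor product is realised as the
  function taking a tree with vertices labelled by vectors \<open>x\<^sub>v\<close> to \<open>\<Prod>\<^sub>v \<phi>\<^sub>v x\<^sub>v\<close> if it has the same
  shape, and to 0 otherwise. The span of these functions is the direct sum over the trees of the
  tensor products over the vertices.
\<close>

fun tree_tensor :: "('x \<Rightarrow> 'k::field) ptree \<Rightarrow> 'x ptree \<Rightarrow> 'k"
  and tree_tensor_list :: "('x \<Rightarrow> 'k::field) ptree list \<Rightarrow> 'x ptree list \<Rightarrow> 'k" where
  "tree_tensor Leaf Leaf = 1"
| "tree_tensor (Node \<phi> ts) (Node x us) = \<phi> x * tree_tensor_list ts us"
| "tree_tensor _ _ = 0"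
| "tree_tensor_list [] [] = 1"
| "tree_tensor_list (t # ts) (u # us) = tree_tensor t u * tree_tensor_list ts us"
| "tree_tensor_list _ _ = 0"

text \<open>In the next two definitions \<open>\<Lambda>\<close> are the relations of the operad whose bar complex
  is formed.\<close>

definition bar_space ::
  "('g::finite, 'k::field) relations \<Rightarrow> nat \<Rightarrow> int \<Rightarrow> (('g, 'k) op_class ptree \<Rightarrow> 'k) set" where
  "bar_space \<Lambda> n d =
    fun_vs.span (tree_tensor ` {\<Phi> \<in> ltrees (\<lambda>l. dual (operad \<Lambda> l)) n. deg \<Phi> = d})"

text \<open>
  The dual of a partial composition is precomposition with it: the component of the differential
  at a tree \<open>T'\<close>, evaluated at vectors at the vertices of \<open>T'\<close>, is the signed sum over the
  internal edges of \<open>T'\<close> of the values after composing along the edge.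
\<close>

definition bar_diff ::
  "(unit ptree \<Rightarrow> unit ptree \<Rightarrow> int) \<Rightarrow> ('g::finite, 'k::field) relations \<Rightarrow> nat \<Rightarrow> int \<Rightarrow>
   (('g, 'k) op_class ptree \<Rightarrow> 'k) \<Rightarrow> ('g, 'k) op_class ptree \<Rightarrow> 'k" where
  "bar_diff \<epsilon> \<Lambda> n d F = (\<lambda>D.
    if D \<in> ltrees (\<lambda>l. car (operad \<Lambda> l)) n \<and> deg D = d + 1
    then \<Sum>e\<in>internal_edges D.
           of_int (\<epsilon> (shape (contract (op_comp \<Lambda>) D e)) (shape D)) * F (contract (op_comp \<Lambda>) D e)
    else 0)"

text \<open>
  In degree 0 a vertex carries a functional \<open>\<phi>\<close> on the arity 2 part of the quadratic dual, which
  is the dual of the space of generators; it corresponds to the generator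
  \<open>\<Sum>g. \<phi> (op_generator (orth \<Lambda>) g) g\<close>. The augmentation is therefore the quotient map after
  the identification of the term in degree 0 with the free operad in arity \<open>n\<close>.
\<close>

definition dual_bar_complex ::
  "(unit ptree \<Rightarrow> unit ptree \<Rightarrow> int) \<Rightarrow> ('g::finite, 'k::field) relations \<Rightarrow> nat \<Rightarrow>
   ('k, ('g, 'k) op_class ptree \<Rightarrow> 'k, ('g, 'k) op_class) aug_complex" where
  "dual_bar_complex \<epsilon> \<Lambda> n =
    \<lparr>spc = (\<lambda>d. fun_space (bar_space (orth \<Lambda>) n d)),
     df = bar_diff \<epsilon> (orth \<Lambda>) n,
     aspc = operad \<Lambda> n,
     aug = (\<lambda>F. cls (op_ideal \<Lambda> n) (\<lambda>t. F (map_ptree (op_generator (orth \<Lambda>)) t)))\<rparr>"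

fun map_arity :: "(nat \<Rightarrow> 'a \<Rightarrow> 'b) \<Rightarrow> 'a ptree \<Rightarrow> 'b ptree" where
  "map_arity h Leaf = Leaf"
| "map_arity h (Node a ts) = Node (h (length ts) a) (map (map_arity h) ts)"

text \<open>The trees whose vertices \<open>v\<close> are labelled by pairs in \<open>{1..\<bar>v\<bar>}\<^sup>2\<close>, and the tensor products
  of the corresponding elements of families \<open>b l\<close>.\<close>

definition pair_trees :: "nat \<Rightarrow> (nat \<times> nat) ptree set" where
  "pair_trees n = ltrees (\<lambda>l. {1..l} \<times> {1..l}) n"

definition induced_basis ::
  "(nat \<Rightarrow> 'i \<Rightarrow> ('g, 'k::field) op_class \<Rightarrow> 'k) \<Rightarrow> 'i ptree \<Rightarrow> ('g, 'k) op_class ptree \<Rightarrow> 'k" where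
  "induced_basis b T = tree_tensor (map_arity b T)"

text \<open>The coefficient of the basis element with index \<open>T\<close> in the image of the basis element
  \<open>x\<close> under \<open>f\<close>.\<close>

definition image_coeff ::
  "(nat \<Rightarrow> nat \<times> nat \<Rightarrow> ('g, 'k::field) op_class \<Rightarrow> 'k) \<Rightarrow> nat \<Rightarrow>
   (int \<Rightarrow> (qa_cell \<Rightarrow> 'k) \<Rightarrow> ('g, 'k) op_class ptree \<Rightarrow> 'k) \<Rightarrow> qa_cell \<Rightarrow> (nat \<times> nat) ptree \<Rightarrow> 'k" where
  "image_coeff b n f x T =
    fun_vs.representation (induced_basis b ` pair_trees n)
      (f (deg (snd x)) (delta x)) (induced_basis b T)"

end

theory Submission
  imports Defs
begin

text \<open>
  The quadratic dual of the dendriform operad is the diassociative operad. It is a set operad: its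
  arity \<open>n\<close> part has a basis \<open>e\<^sub>1, \<dots>, e\<^sub>n\<close> of operations that "point to" one of their arguments,
  and pointers are composed by following them. The relations of the black square product of two
  copies of \<open>dend\<close> are indexed by pairs of pointers in arity 3, so the quadratic dual of \<open>quad\<close> is
  the square of this set operad. Concretely, a binary tree labelled by pairs of \<open>Prec\<close> and \<open>Succ\<close>
  points in each of its two coordinates to a leaf (turn left at \<open>Prec\<close>, right at \<open>Succ\<close>), and
  \<open>op_ideal_orth_quad\<close> says that an element of the free operad lies in the ideal exactly if for each
  pair of leaves the coefficients of the trees pointing to it add up to zero. The point is that
  any two trees with the same pointers are congruent: rotations make each tree a right comb, and
  labels that the pointer never reaches can be changed at will. This gives the dimension \<open>n\<^sup>2\<close>, and
  the functionals \<open>coord\<close>, which read off the sum of the coefficients with given pointers, form the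
  bases of the dual spaces.

  In these bases the dual bar complex is combinatorial (\<open>bar_diff_bar_element\<close>): a basis element is a
  tree with a pair of pointers at each vertex, and the coefficient of \<open>T'\<close> in the differential of
  \<open>T\<close> is the incidence number if contracting an edge of \<open>T'\<close>, and composing the pointers there,
  gives \<open>T\<close>. Following the pointers from the root, such a tree points to a pair of leaves
  \<open>(i, j)\<close>, and contraction does not change this pair (\<open>pointer_contract\<close>). So a tree can be sent to
  the cell in the \<open>(i, j)\<close>-th copy of the associahedron given by its shape. The embedding is the
  transpose of this map: a cell goes to the sum of all labelled trees belonging to it. Each
  labelled tree belongs to exactly one cell, and the embedding is a chain map because different
  edges of a tree have different contractions.

  Among the trees belonging to a cell there is a standard one, whose labels off the path from the
  root to the leaf pointed to are all 1. Contractions of standard trees are standard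
  (\<open>standard_contract\<close>), so restricting coefficients to the standard trees is a retraction of
  complexes, whose kernel is the complement. In degree 1 two facts about \<open>quad\<close> itself are
  needed. The sum of the trees of a given binary shape with given pointers does not depend on
  the shape modulo the ideal: for trees with three leaves these are the defining relations, and
  rotations connect all binary shapes (\<open>shape_equiv_comb\<close>). This makes the embedding commute with the
  augmentation. And the sum of the coefficients of the standard trees with given pointers
  vanishes on the ideal, as standardness is compatible with grafting
  (\<open>standard_weight_ideal\<close>). This extends the retraction to degree 1.
\<close>

section \<open>Planar trees and contraction of edges\<close>

lemma sum_apply: "sum f A x = (\<Sum>i\<in>A. f i x)" for f :: "'i \<Rightarrow> 'a \<Rightarrow> 'b::comm_monoid_add"
  by (induction A rule: infinite_finite_induct) auto

lemma leaves_pos: "labelled_in L t \<Longrightarrow> leaves t \<ge> 1"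
proof (induction t)
  case (Node a ts)
  then obtain t us where ts: "ts = t # us" by (cases ts) auto
  then show ?case using Node by fastforce
qed simp

lemma labelled_in_mono: "labelled_in L t \<Longrightarrow> (\<And>l. L l \<subseteq> M l) \<Longrightarrow> labelled_in M t"
  by (induction t) auto

lemma vertices_shape [simp]: "vertices (shape t) = vertices t"
  by (induction t) (auto simp: shape_def comp_def cong: map_cong)

lemma leaves_map [simp]: "leaves (map_ptree f t) = leaves t"
  by (induction t) (auto simp: comp_def cong: map_cong)

lemma vertices_map [simp]: "vertices (map_ptree f t) = vertices t"
  by (induction t) (auto simp: comp_def cong: map_cong)

lemma leaves_shape [simp]: "leaves (shape t) = leaves t"
  by (simp add: shape_def)

lemma shape_Node [simp]: "shape (Node a ts) = Node () (map shape ts)"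
  by (simp add: shape_def)

lemma shape_Leaf [simp]: "shape Leaf = Leaf"
  by (simp add: shape_def)

lemma deg_shape [simp]: "deg (shape t) = deg t"
  by (simp add: deg_def)

lemma deg_map [simp]: "deg (map_ptree f t) = deg t"
  by (simp add: deg_def)

lemma shape_map [simp]: "shape (map_ptree f t) = shape t"
  by (simp add: shape_def ptree.map_comp comp_def)

lemma labelled_in_map:
  "labelled_in L (map_ptree f t) \<longleftrightarrow> labelled_in (\<lambda>l. {a. f a \<in> L l}) t"
  by (induction t) auto

lemma labelled_in_shape: "labelled_in (\<lambda>_. UNIV) (shape t) \<longleftrightarrow> labelled_in (\<lambda>_. UNIV) t"
  by (simp add: shape_def labelled_in_map)

text \<open>All arities being at least 2, the arity of the root is bounded by the number of leaves, and the
  subtrees at the root have fewer leaves; this allows induction on the number of leaves.\<close>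

lemma finite_ltrees:
  assumes "\<And>l. finite (L l)"
  shows "finite (ltrees L n)"
proof (induction n rule: less_induct)
  case (less n)
  define U where "U = (\<Union>m<n. ltrees L m)"
  have "finite U" using less by (simp add: U_def)
  then have "finite (insert Leaf (\<Union>l\<le>n. \<Union>a\<in>L l. Node a ` {ts. set ts \<subseteq> U \<and> length ts = l}))"
    using assms by (auto intro!: finite_lists_length_eq)
  moreover have "t \<in> insert Leaf (\<Union>l\<le>n. \<Union>a\<in>L l. Node a ` {ts. set ts \<subseteq> U \<and> length ts = l})"
    if "t \<in> ltrees L n" for t
  proof (cases t)
    case (Node a ts)
    with that have *: "sum_list (map leaves ts) = n" "length ts \<ge> 2" "a \<in> L (length ts)"
      "\<And>t. t \<in> set ts \<Longrightarrow> labelled_in L t"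
      by (auto simp: ltrees_def)
    have len: "length us \<le> sum_list (map leaves us)" if "set us \<subseteq> set ts" for us
      using that
    proof (induction us)
      case (Cons u us)
      then have "leaves u \<ge> 1" using *(4) leaves_pos by fastforce
      with Cons show ?case by simp
    qed simp
    have "leaves u < n" if u: "u \<in> set ts" for u
    proof -
      obtain xs ys where ts: "ts = xs @ u # ys" using u by (auto simp: in_set_conv_decomp)
      have "length xs \<le> sum_list (map leaves xs)" "length ys \<le> sum_list (map leaves ys)"
        using len[of xs] len[of ys] ts by auto
      moreover have "length xs + length ys \<ge> 1" using *(2) ts by simp
      ultimately show ?thesis using *(1) ts by simp
    qed
    then have "set ts \<subseteq> U" using *(4) by (auto simp: U_def ltrees_def)
    moreover have "length ts \<le> n" using len[of ts] *(1) by simp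
    ultimately show ?thesis using * Node by auto
  qed simp
  ultimately show ?case by (meson finite_subset subsetI)
qed

abbreviation binary :: "'a ptree \<Rightarrow> bool" where
  "binary \<equiv> labelled_in (\<lambda>l. if l = 2 then UNIV else {})"

lemma binary_trees_iff: "t \<in> binary_trees n \<longleftrightarrow> binary t \<and> leaves t = n"
  by (auto simp: binary_trees_def ltrees_def)

lemma finite_binary_trees [simp]: "finite (binary_trees n :: 'a::finite ptree set)"
  unfolding binary_trees_def by (rule finite_ltrees) auto

lemma finite_trees [simp]: "finite (trees n)"
  unfolding trees_def by (rule finite_ltrees) auto

lemma finite_pair_trees [simp]: "finite (pair_trees n)"
  unfolding pair_trees_def by (rule finite_ltrees) auto

lemma length_two: "length ts = 2 \<longleftrightarrow> (\<exists>l r. ts = [l, r])"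
  by (auto simp: numeral_2_eq_2 length_Suc_conv)

lemma binary_Node: "binary (Node c ts) \<longleftrightarrow> (\<exists>l r. ts = [l, r] \<and> binary l \<and> binary r)"
  using length_two[of ts] by (auto split: if_splits)

lemma binary_induct [consumes 1, case_names Leaf Node]:
  assumes "binary t" "P Leaf"
    "\<And>c l r. binary l \<Longrightarrow> binary r \<Longrightarrow> P l \<Longrightarrow> P r \<Longrightarrow> P (Node c [l, r])"
  shows "P t"
  using assms(1)
proof (induction t)
  case (Node a ts)
  from Node.prems obtain l r where "ts = [l, r]" "binary l" "binary r"
    unfolding binary_Node by (elim exE conjE)
  with Node.IH assms(3) show ?case by simp
qed (rule assms(2))

text \<open>Each vertex of arity \<open>l\<close> contributes \<open>l - 2\<close> to the difference of the two sides. So the trees of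
  degree 0 are the binary ones.\<close>

lemma vertices_le_leaves:
  assumes "labelled_in (\<lambda>_. UNIV) t"
  shows "vertices t + 1 \<le> leaves t \<and> (vertices t + 1 = leaves t \<longleftrightarrow> binary t)"
  using assms
proof (induction t)
  case (Node a ts)
  have *: "sum_list (map vertices us) + length us \<le> sum_list (map leaves us) \<and>
      (sum_list (map vertices us) + length us = sum_list (map leaves us) \<longleftrightarrow> (\<forall>u\<in>set us. binary u))"
    if "set us \<subseteq> set ts" for us
    using that
  proof (induction us)
    case (Cons u us)
    have "vertices u + 1 \<le> leaves u \<and> (vertices u + 1 = leaves u \<longleftrightarrow> binary u)"
      using Node.IH[of u] Node.prems Cons.prems by auto
    with Cons show ?case by auto
  qed simp
  show ?case using *[OF subset_refl] Node.prems by auto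
qed simp

lemma deg_0_iff: "labelled_in (\<lambda>_. UNIV) t \<Longrightarrow> deg t = 0 \<longleftrightarrow> binary t"
  using vertices_le_leaves[of t] by (auto simp: deg_def)

subsection \<open>Contraction\<close>

lemma contract_root:
  "contract h (Node a (xs @ Node b us # ys)) [length xs] =
    Node (h (length xs + length ys + 1) (length xs) (length us) a b) (xs @ us @ ys)"
  by (simp add: nth_append)

lemma contract_deeper:
  assumes "q \<noteq> []"
  shows "contract h (Node a (xs @ t # ys)) (length xs # q) = Node a (xs @ contract h t q # ys)"
  using assms by (cases q) (simp_all add: nth_append)

lemma internal_edges_Leaf [simp]: "internal_edges Leaf = {}"
  by (simp add: internal_edges_def)

lemma internal_edges_root:
  "[i] \<in> internal_edges (Node a ts) \<longleftrightarrow> i < length ts \<and> (\<exists>b us. ts ! i = Node b us)"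
  by (cases "ts ! i") (auto simp: internal_edges_def)

lemma internal_edges_deeper:
  "q \<noteq> [] \<Longrightarrow> i # q \<in> internal_edges (Node a ts) \<longleftrightarrow> i < length ts \<and> q \<in> internal_edges (ts ! i)"
  by (auto simp: internal_edges_def)

lemma split_at_index:
  assumes "i < length ts"
  obtains xs u ys where "ts = xs @ u # ys" "i = length xs"
  using assms by (metis id_take_nth_drop length_take min.absorb4)

text \<open>Splitting the list of subtrees at the child through which the path runs spares computations with
  indices when contractions are evaluated.\<close>

lemma edge_induct [consumes 1, case_names root deeper]:
  assumes "e \<in> internal_edges t"
    and root: "\<And>a xs b us ys. P (Node a (xs @ Node b us # ys)) [length xs]"
    and deeper: "\<And>a xs t ys q. q \<in> internal_edges t \<Longrightarrow> q \<noteq> [] \<Longrightarrow> P t q \<Longrightarrow>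
      P (Node a (xs @ t # ys)) (length xs # q)"
  shows "P t e"
  using assms(1)
proof (induction e arbitrary: t)
  case Nil
  then show ?case by (simp add: internal_edges_def)
next
  case (Cons i q)
  then obtain a ts where t: "t = Node a ts" by (cases t) auto
  have i: "i < length ts" using Cons.prems t by (simp add: internal_edges_def)
  obtain xs u ys where ts: "ts = xs @ u # ys" and len: "i = length xs"
    using split_at_index[OF i] .
  show ?case
  proof (cases "q = []")
    case True
    then obtain b us where "u = Node b us"
      using Cons.prems t internal_edges_root[of i a ts] by (auto simp: ts len)
    then show ?thesis using root[of a xs b us ys] by (simp add: t ts len True)
  next
    case False
    then have q: "q \<in> internal_edges u"
      using Cons.prems internal_edges_deeper[of q i a ts] by (simp add: t ts len)
    show ?thesis using deeper[OF q False Cons.IH[OF q], of a xs ys] by (simp add: t ts len)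
  qed
qed

lemma vertex_at_map: "vertex_at (map_ptree f t) p \<longleftrightarrow> vertex_at t p"
proof (induction p arbitrary: t)
  case Nil
  then show ?case by (cases t) auto
next
  case (Cons i p)
  show ?case by (cases t) (simp_all add: Cons.IH cong: conj_cong)
qed

lemma internal_edges_map [simp]: "internal_edges (map_ptree f t) = internal_edges t"
  by (simp add: internal_edges_def vertex_at_map)

lemma internal_edges_shape [simp]: "internal_edges (shape t) = internal_edges t"
  by (simp add: shape_def)

lemma shape_contract:
  "e \<in> internal_edges t \<Longrightarrow> shape (contract h t e) = contract_shape (shape t) e"
proof (induction rule: edge_induct)
  case (root a xs b us ys)
  then show ?case
    using contract_root[of "\<lambda>_ _ _ _ _. ()" "()" "map shape xs" "()" "map shape us" "map shape ys"]
    by (simp add: contract_root contract_shape_def del: contract.simps)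
next
  case (deeper a xs t ys q)
  then show ?case
    using contract_deeper[of q "\<lambda>_ _ _ _ _. ()" "()" "map shape xs" "shape t" "map shape ys"]
    by (simp add: contract_deeper contract_shape_def del: contract.simps)
qed

lemma leaves_contract [simp]: "e \<in> internal_edges t \<Longrightarrow> leaves (contract h t e) = leaves t"
  by (induction rule: edge_induct) (simp_all add: contract_root contract_deeper del: contract.simps)

lemma vertices_contract: "e \<in> internal_edges t \<Longrightarrow> vertices t = Suc (vertices (contract h t e))"
  by (induction rule: edge_induct) (simp_all add: contract_root contract_deeper del: contract.simps)

lemma deg_contract: "e \<in> internal_edges t \<Longrightarrow> deg (contract h t e) = deg t - 1"
  using vertices_contract[of e t h] by (simp add: deg_def)

lemma labelled_in_contract:
  assumes "e \<in> internal_edges t" "labelled_in L t"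
    and "\<And>m i n a b. i < m \<Longrightarrow> n \<ge> 2 \<Longrightarrow> a \<in> L m \<Longrightarrow> b \<in> L n \<Longrightarrow> h m i n a b \<in> L (m + n - 1)"
  shows "labelled_in L (contract h t e)"
  using assms(1,2)
proof (induction rule: edge_induct)
  case (root a xs b us ys)
  then show ?case using assms(3)[of "length xs" "length xs + length ys + 1" "length us" a b]
    by (auto simp: contract_root algebra_simps simp del: contract.simps)
next
  case (deeper a xs t ys q)
  then show ?case by (auto simp: contract_deeper simp del: contract.simps)
qed

text \<open>
  Contracting an edge at the root raises the arity of the root, contracting another one does not.
  Contractions of edges of the same kind that lie above different children of the root differ at
  the first child affected: there one of them still has the whole subtree, and this has more
  leaves than its first child and more vertices than any of its contractions.
\<close>

lemma contract_shape_inj: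
  assumes "labelled_in L t" "e \<in> internal_edges t" "e' \<in> internal_edges t"
    "contract h t e = contract h t e'"
  shows "e = e'"
  using assms(2,1,3,4)
proof (induction arbitrary: e' rule: edge_induct)
  case (root a xs b us ys e')
  obtain j q where e': "e' = j # q" using root.prems(2) by (cases e') (auto simp: internal_edges_def)
  let ?ts = "xs @ Node b us # ys"
  have us: "length us \<ge> 2" using root.prems(1) by simp
  show ?case
  proof (cases "q = []")
    case False
    with root.prems(2) e' have "j < length ?ts"
      using internal_edges_deeper by metis
    then obtain zs t ws where d: "?ts = zs @ t # ws" "j = length zs"
      by (rule split_at_index)
    have "length (xs @ us @ ys) = length (zs @ contract h t q # ws)"
      using root.prems(3) contract_deeper[OF False, of h a zs t ws]
      unfolding e' d(2) d(1)[symmetric] contract_root by simp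
    moreover have "length ?ts = length (zs @ t # ws)" using d(1) by simp
    ultimately show ?thesis using us by simp
  next
    case True
    then obtain c vs where j: "j < length ?ts" "?ts ! j = Node c vs"
      using root.prems(2) e' internal_edges_root by metis
    obtain zs t ws where "?ts = zs @ t # ws" "j = length zs"
      using j(1) by (rule split_at_index)
    then have d: "?ts = zs @ Node c vs # ws" "j = length zs"
      using j(2) by simp_all
    have vs: "length vs \<ge> 2" and val: "\<forall>t\<in>set ?ts. labelled_in L t"
      using root.prems(1) d(1) by (auto simp: d(1) simp del: append.simps)
    have eq: "xs @ us @ ys = zs @ vs @ ws"
      using root.prems(3) unfolding e' True d(2) contract_root
      unfolding d(1) contract_root by simp
    have lt: "leaves (hd us) < leaves (Node b us)"
    proof -
      obtain u v us' where u: "us = u # v # us'" using us by (cases us; cases "tl us") auto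
      have "labelled_in L v" using val u by auto
      then show ?thesis using leaves_pos[of L v] u by simp
    qed
    have lt': "leaves (hd vs) < leaves (Node c vs)"
    proof -
      obtain u v us' where u: "vs = u # v # us'" using vs by (cases vs; cases "tl vs") auto
      have "labelled_in L v" using val u unfolding d(1) by auto
      then show ?thesis using leaves_pos[of L v] u by simp
    qed
    have "length xs = length zs"
    proof (rule linorder_cases[of "length xs" "length zs"])
      assume l: "length xs < length zs"
      have "(xs @ us @ ys) ! length xs = hd us" using us by (cases us) (auto simp: nth_append)
      moreover have "(zs @ vs @ ws) ! length xs = ?ts ! length xs"
        using l unfolding d(1) by (simp add: nth_append)
      ultimately show ?thesis using eq lt by simp
    next
      assume l: "length zs < length xs"
      have "(zs @ vs @ ws) ! length zs = hd vs" using vs by (cases vs) (auto simp: nth_append)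
      moreover have "(xs @ us @ ys) ! length zs = ?ts ! length zs"
        using l by (simp add: nth_append)
      moreover have "?ts ! length zs = Node c vs" unfolding d(1) by simp
      ultimately show ?thesis using eq lt' by simp
    qed simp
    then show ?thesis using e' True d(2) by simp
  qed
next
  case (deeper a xs t ys q e')
  obtain j r where e': "e' = j # r" using deeper.prems(2) by (cases e') (auto simp: internal_edges_def)
  let ?ts = "xs @ t # ys"
  have val: "\<forall>t\<in>set ?ts. labelled_in L t" using deeper.prems(1) by simp
  have "j < length ?ts" using deeper.prems(2) e' by (simp add: internal_edges_def)
  then obtain zs s ws where d: "?ts = zs @ s # ws" "j = length zs"
    by (rule split_at_index)
  show ?case
  proof (cases "r = []")
    case True
    then obtain c vs where s: "s = Node c vs"
      using deeper.prems(2) e' internal_edges_root[of j a ?ts] d by auto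
    have "length vs \<ge> 2" using deeper.prems(1) d s by (auto simp del: append.simps)
    moreover have "length (xs @ contract h t q # ys) = length (zs @ vs @ ws)"
      using deeper.prems(3) unfolding e' True d(2) contract_deeper[OF deeper.hyps(2)]
      unfolding d(1) s contract_root by simp
    moreover have "length ?ts = length (zs @ s # ws)" using d(1) by simp
    ultimately show ?thesis by simp
  next
    case False
    have r: "r \<in> internal_edges s"
      using deeper.prems(2) e' internal_edges_deeper[OF False, of j a ?ts] d by simp
    have eq: "xs @ contract h t q # ys = zs @ contract h s r # ws"
      using deeper.prems(3) unfolding e' d(2) contract_deeper[OF deeper.hyps(2)]
      unfolding d(1) contract_deeper[OF False] by simp
    have "length xs = length zs"
    proof (rule linorder_cases[of "length xs" "length zs"])
      assume l: "length xs < length zs"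
      have "(xs @ contract h t q # ys) ! length xs = contract h t q" by simp
      moreover have "(zs @ contract h s r # ws) ! length xs = ?ts ! length xs"
        using l unfolding d(1) by (simp add: nth_append)
      ultimately show ?thesis using eq vertices_contract[OF deeper.hyps(1), of h] by simp
    next
      assume l: "length zs < length xs"
      have "(zs @ contract h s r # ws) ! length zs = contract h s r" by simp
      moreover have "(xs @ contract h t q # ys) ! length zs = ?ts ! length zs"
        using l by (simp add: nth_append)
      moreover have "?ts ! length zs = s" unfolding d(1) by simp
      ultimately show ?thesis using eq vertices_contract[OF r, of h] by simp
    qed simp
    then have "xs = zs" "t = s" "ys = ws" "contract h t q = contract h s r"
      using d(1) eq by auto
    then have "q = r" using deeper.IH[of r] r val by simp
    then show ?thesis using e' d(2) \<open>xs = zs\<close> by simp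
  qed
qed

section \<open>Pointers and standard labellings\<close>

text \<open>The label \<open>a\<close> of a vertex selects the incoming edge with number \<open>s a\<close>. Following the selected
  edges from the root leads to a leaf; the leaves are counted from 1 as well.\<close>

fun pointer :: "('a \<Rightarrow> nat) \<Rightarrow> 'a ptree \<Rightarrow> nat" where
  "pointer s Leaf = 1"
| "pointer s (Node a ts) =
    sum_list (map leaves (take (s a - 1) ts)) + map (pointer s) ts ! (s a - 1)"

text \<open>The partial composition with index \<open>i\<close> of the diassociative operad on its basis of pointers: the
  operation pointing to its argument \<open>a\<close>, with one pointing to the argument \<open>b\<close> out of \<open>n\<close>
  inserted in its argument \<open>i + 1\<close>.\<close>

definition dias_comp :: "nat \<Rightarrow> nat \<Rightarrow> nat \<Rightarrow> nat \<Rightarrow> nat" where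
  "dias_comp i n a b = (if a \<le> i then a else if a = Suc i then i + b else a + n - 1)"

lemma dias_comp_range:
  "i < m \<Longrightarrow> a \<in> {1..m} \<Longrightarrow> b \<in> {1..n} \<Longrightarrow> dias_comp i n a b \<in> {1..m + n - 1}"
  by (auto simp: dias_comp_def)

abbreviation pointed :: "('a \<Rightarrow> nat) \<Rightarrow> 'a ptree \<Rightarrow> bool" where
  "pointed s \<equiv> labelled_in (\<lambda>l. {a. s a \<in> {1..l}})"

definition list_pointer :: "('a \<Rightarrow> nat) \<Rightarrow> 'a ptree list \<Rightarrow> nat \<Rightarrow> nat" where
  "list_pointer s ts r = sum_list (map leaves (take r ts)) + map (pointer s) ts ! r"

lemma pointer_Node: "pointer s (Node a ts) = list_pointer s ts (s a - 1)"
  by (simp add: list_pointer_def)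

lemma list_pointer_append:
  "list_pointer s (xs @ ys) r =
    (if r < length xs then list_pointer s xs r
     else sum_list (map leaves xs) + list_pointer s ys (r - length xs))"
  by (simp add: list_pointer_def nth_append)

lemma list_pointer_Cons:
  "list_pointer s (t # ts) r = (if r = 0 then pointer s t else leaves t + list_pointer s ts (r - 1))"
  by (cases r) (simp_all add: list_pointer_def)

lemma pointer_range: "pointed s t \<Longrightarrow> pointer s t \<in> {1..leaves t}"
proof (induction t)
  case (Node a ts)
  then have "s a - 1 < length ts" by auto
  then obtain xs t ys where ts: "ts = xs @ t # ys" "s a - 1 = length xs"
    by (rule split_at_index)
  then have "pointer s t \<in> {1..leaves t}" using Node by simp
  then show ?case unfolding pointer_Node ts(2) by (simp add: ts(1) list_pointer_append list_pointer_Cons)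
qed simp

text \<open>
  The label which \<open>dias_comp\<close> gives to the merged vertex selects the edge through which the two
  labels lead. There are three cases: the label of the lower vertex selects an edge to the left of
  the contracted one, the contracted one, or one to the right of it.
\<close>

lemma pointer_contract:
  assumes "e \<in> internal_edges t" "pointed s t"
    and h: "\<And>m i n a b. s (h m i n a b) = dias_comp i n (s a) (s b)"
  shows "pointer s (contract h t e) = pointer s t"
  using assms(1,2)
proof (induction rule: edge_induct)
  case (root a xs b us ys)
  then obtain r q where rq: "s a = Suc r" "s b = Suc q" "q < length us"
    by (cases "s a"; cases "s b") auto
  consider "r < length xs" | "r = length xs" | k where "r = Suc (length xs + k)"
    by (metis less_imp_Suc_add linorder_cases)
  then show ?case
    unfolding contract_root pointer_Node h using rq
    by cases (simp_all add: list_pointer_append list_pointer_Cons pointer_Node dias_comp_def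
        del: pointer.simps)
next
  case (deeper a xs t ys q)
  then show ?case unfolding contract_deeper[OF deeper.hyps(2)] pointer_Node
    by (simp add: list_pointer_append list_pointer_Cons)
qed

subsection \<open>Standard labellings\<close>

text \<open>The labels on the path from the root to the leaf \<open>k\<close> are those pointing to this leaf, all others
  are 1. If \<open>k\<close> is 0 or exceeds the number of leaves, all labels are 1; this is what happens in the
  subtrees to the right and to the left of the path, as the subtraction is truncated.\<close>

fun standard :: "('a \<Rightarrow> nat) \<Rightarrow> nat \<Rightarrow> 'a ptree \<Rightarrow> bool"
  and standard_list :: "('a \<Rightarrow> nat) \<Rightarrow> nat \<Rightarrow> 'a ptree list \<Rightarrow> bool" where
  "standard s k Leaf \<longleftrightarrow> True"
| "standard s k (Node a ts) \<longleftrightarrow>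
    s a = (if 1 \<le> k \<and> k \<le> leaves (Node a ts) then incoming_edge k ts else 1) \<and>
    standard_list s k ts"
| "standard_list s k [] \<longleftrightarrow> True"
| "standard_list s k (t # ts) \<longleftrightarrow> standard s k t \<and> standard_list s (k - leaves t) ts"

lemma standard_list_append [simp]:
  "standard_list s k (xs @ ys) \<longleftrightarrow>
    standard_list s k xs \<and> standard_list s (k - sum_list (map leaves xs)) ys"
  by (induction xs arbitrary: k) auto

lemma incoming_edge_append:
  "1 \<le> k \<Longrightarrow> incoming_edge k (xs @ ys) =
    (if k \<le> sum_list (map leaves xs) then incoming_edge k xs
     else length xs + incoming_edge (k - sum_list (map leaves xs)) ys)"
  by (induction xs arbitrary: k) auto

lemma incoming_edge_range:
  "1 \<le> k \<Longrightarrow> k \<le> sum_list (map leaves ts) \<Longrightarrow> incoming_edge k ts \<in> {1..length ts}"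
  by (induction ts arbitrary: k) auto

lemma incoming_edge_split:
  assumes "1 \<le> k" "k \<le> sum_list (map leaves ts)"
  obtains xs t ys where "ts = xs @ t # ys" "incoming_edge k ts = Suc (length xs)"
    "sum_list (map leaves xs) < k" "k \<le> sum_list (map leaves xs) + leaves t"
  using assms
proof (induction ts arbitrary: k thesis)
  case (Cons t ts)
  show ?case
  proof (cases "k \<le> leaves t")
    case True
    then show ?thesis using Cons.prems(1)[of "[]" t ts] Cons.prems by simp
  next
    case False
    obtain xs u ys where "ts = xs @ u # ys" "incoming_edge (k - leaves t) ts = Suc (length xs)"
      "sum_list (map leaves xs) < k - leaves t"
      "k - leaves t \<le> sum_list (map leaves xs) + leaves u"
      by (rule Cons.IH[of "k - leaves t"]) (use False Cons.prems in auto)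
    then show ?thesis using False Cons.prems(1)[of "t # xs" u ys] by auto
  qed
qed simp

lemma standard_pointer: "standard s k t \<Longrightarrow> 1 \<le> k \<Longrightarrow> k \<le> leaves t \<Longrightarrow> pointer s t = k"
proof (induction t arbitrary: k)
  case (Node a ts)
  obtain xs t ys where *: "ts = xs @ t # ys" "incoming_edge k ts = Suc (length xs)"
    "sum_list (map leaves xs) < k" "k \<le> sum_list (map leaves xs) + leaves t"
    by (rule incoming_edge_split[of k ts]) (use Node.prems in auto)
  have "s a = Suc (length xs)" using Node.prems *(2) by simp
  moreover have "pointer s t = k - sum_list (map leaves xs)"
    using Node.IH[of t "k - sum_list (map leaves xs)"] * Node.prems by simp
  ultimately show ?case
    using *(1,3) by (simp add: pointer_Node list_pointer_append list_pointer_Cons del: pointer.simps)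
qed simp

lemma standard_pointed:
  "labelled_in (\<lambda>_. UNIV) t \<Longrightarrow> standard s k t \<Longrightarrow> pointed s t"
proof (induction t arbitrary: k)
  case (Node a ts)
  have "s a \<in> {1..length ts}"
    using Node.prems incoming_edge_range[of k ts] by (cases "1 \<le> k \<and> k \<le> leaves (Node a ts)") auto
  moreover have "pointed s t" if t: "t \<in> set ts" for t
  proof -
    obtain xs ys where "ts = xs @ t # ys" using split_list[OF t] by blast
    then show ?thesis using Node.IH[OF t, of "k - sum_list (map leaves xs)"] Node.prems t
      by simp
  qed
  ultimately show ?case using Node.prems by simp
qed simp

text \<open>Two vertices off the path have the label 1 and merge to a vertex off the path, with the label 1
  by \<open>dias_comp\<close>; in the other cases the merged vertex lies on the path, where the label is forced
  by the leaf.\<close>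

lemma standard_contract:
  assumes "e \<in> internal_edges t" "standard s k t"
    and h: "\<And>m i n a b. s (h m i n a b) = dias_comp i n (s a) (s b)"
  shows "standard s k (contract h t e)"
  using assms(1,2)
proof (induction arbitrary: k rule: edge_induct)
  case (root a xs b us ys)
  let ?x = "sum_list (map leaves xs)" and ?u = "sum_list (map leaves us)"
  let ?n = "leaves (Node a (xs @ Node b us # ys))"
  have a: "s a = (if 1 \<le> k \<and> k \<le> ?n then incoming_edge k (xs @ Node b us # ys) else 1)"
    and b: "s b = (if 1 \<le> k - ?x \<and> k - ?x \<le> ?u then incoming_edge (k - ?x) us else 1)"
    using root by (simp_all del: incoming_edge.simps)
  have "dias_comp (length xs) (length us) (s a) (s b) =
      (if 1 \<le> k \<and> k \<le> ?n then incoming_edge k (xs @ us @ ys) else 1)"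
  proof (cases "1 \<le> k \<and> k \<le> ?n")
    case False
    then have "s a = 1" "s b = 1" using a b by auto
    with False show ?thesis by (cases xs) (auto simp: dias_comp_def)
  next
    case True
    \<comment> \<open>The leaf \<open>k\<close> lies in front of, in, or behind the subtree above the contracted edge.\<close>
    then consider "k \<le> ?x" | "?x < k" "k \<le> ?x + ?u" | "?x + ?u < k" by linarith
    then show ?thesis
    proof cases
      case 1
      then show ?thesis using True a incoming_edge_range[of k xs]
        by (auto simp: incoming_edge_append dias_comp_def)
    next
      case 2
      then show ?thesis using True a b by (auto simp: incoming_edge_append dias_comp_def)
    next
      case 3
      then have "1 \<le> incoming_edge (k - ?x - ?u) ys"
        using True incoming_edge_range[of "k - ?x - ?u" ys] by auto
      with 3 show ?thesis using True a by (auto simp: incoming_edge_append dias_comp_def)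
    qed
  qed
  then show ?case using root h
    by (simp add: contract_root diff_diff_left del: contract.simps incoming_edge.simps)
next
  case (deeper a xs t ys q)
  have "incoming_edge k (xs @ contract h t q # ys) = incoming_edge k (xs @ t # ys)"
    using deeper.hyps(1) by (cases "1 \<le> k") (simp_all add: incoming_edge_append, cases xs, simp_all)
  then show ?case using deeper by (simp add: contract_deeper del: contract.simps)
qed

subsection \<open>Labelled copies and standard labellings\<close>

lemma leaves_labelling [simp]: "leaves (labelling i t) = leaves t"
  and map_leaves_labelling [simp]: "map leaves (labelling_list i ts) = map leaves ts"
  for t :: "'a ptree" and ts :: "'a ptree list"
  by (induction i t and i ts rule: labelling_labelling_list.induct) auto

lemma shape_labelling [simp]: "shape (labelling i t) = shape t"
  and map_shape_labelling [simp]: "map shape (labelling_list i ts) = map shape ts"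
  for t :: "'a ptree" and ts :: "'a ptree list"
  by (induction i t and i ts rule: labelling_labelling_list.induct) auto

lemma shape_unit [simp]: "shape (t :: unit ptree) = t"
  by (induction t) (auto simp: map_idI)

lemma shape_pair_labelling [simp]: "shape (pair_labelling i j t) = shape t"
  by (simp add: pair_labelling_def)

lemma deg_pair_labelling [simp]: "deg (pair_labelling i j t) = deg t"
  using deg_shape[of "pair_labelling i j t"] by simp

lemma incoming_edge_cong: "map leaves ts = map leaves us \<Longrightarrow> incoming_edge k ts = incoming_edge k us"
proof (induction ts arbitrary: us k)
  case (Cons t ts)
  then show ?case by (cases us) auto
qed simp

text \<open>The label \<open>*\<close>, represented by \<open>None\<close>, is filled by 1 in standard trees.\<close>

definition label_number :: "nat option \<Rightarrow> nat" where
  "label_number r = (case r of None \<Rightarrow> 1 | Some r \<Rightarrow> r)"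

definition standard_tree :: "nat \<Rightarrow> nat \<Rightarrow> 'a ptree \<Rightarrow> (nat \<times> nat) ptree" where
  "standard_tree i j t =
    map_ptree (\<lambda>(r, s, _). (label_number r, label_number s)) (labelling i (labelling j t))"

definition standard_trees :: "nat \<Rightarrow> nat \<Rightarrow> 'a ptree list \<Rightarrow> (nat \<times> nat) ptree list" where
  "standard_trees i j ts = map (map_ptree (\<lambda>(r, s, _). (label_number r, label_number s)))
    (labelling_list i (labelling_list j ts))"

lemma standard_tree_Leaf [simp]: "standard_tree i j Leaf = Leaf"
  by (simp add: standard_tree_def)

lemma standard_tree_Node [simp]:
  "standard_tree i j (Node a ts) =
    Node (if 1 \<le> i \<and> i \<le> leaves (Node a ts) then incoming_edge i ts else 1,
          if 1 \<le> j \<and> j \<le> leaves (Node a ts) then incoming_edge j ts else 1)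
      (standard_trees i j ts)"
  by (simp add: standard_tree_def standard_trees_def label_number_def
      incoming_edge_cong[of "labelling_list j ts" ts])

lemma standard_trees_simps [simp]:
  "standard_trees i j [] = []"
  "standard_trees i j (t # ts) = standard_tree i j t # standard_trees (i - leaves t) (j - leaves t) ts"
  by (simp_all add: standard_trees_def standard_tree_def)

lemma shape_standard_tree [simp]: "shape (standard_tree i j t) = shape t"
  by (simp add: standard_tree_def)

lemma leaves_standard_tree [simp]: "leaves (standard_tree i j t) = leaves t"
  by (simp add: standard_tree_def)

lemma map_leaves_standard_trees [simp]: "map leaves (standard_trees i j ts) = map leaves ts"
  by (induction ts arbitrary: i j) auto

lemma standard_standard_tree:
  "standard fst i (standard_tree i j t) \<and> standard snd j (standard_tree i j t)"
proof (induction t arbitrary: i j)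
  case (Node a ts)
  have "standard_list fst i (standard_trees i j us) \<and> standard_list snd j (standard_trees i j us)"
    if "set us \<subseteq> set ts" for us
    using that
  proof (induction us arbitrary: i j)
    case (Cons u us)
    then show ?case using Node.IH[of u] by auto
  qed simp
  from this[OF subset_refl] show ?case
    by (simp add: incoming_edge_cong[of "standard_trees i j ts" ts])
qed simp

lemma standard_tree_unique:
  "standard fst i T \<Longrightarrow> standard snd j T \<Longrightarrow> T = standard_tree i j (shape T)"
proof (induction T arbitrary: i j)
  case (Node a ts)
  have "us = standard_trees i j (map shape us)"
    if "set us \<subseteq> set ts" "standard_list fst i us" "standard_list snd j us" for us
    using that
  proof (induction us arbitrary: i j)
    case (Cons u us)
    then show ?case using Node.IH[of u] by auto
  qed simp
  from this[OF subset_refl] Node.prems show ?case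
    by (cases a) (auto simp: incoming_edge_cong[of "map shape ts" ts] comp_def)
qed simp

subsection \<open>Grafting of binary trees\<close>

lemma binary_graft: "binary t \<Longrightarrow> binary s \<Longrightarrow> binary (graft t i s)"
  by (induction arbitrary: i rule: binary_induct) (auto simp: binary_Node)

lemma leaves_graft:
  "binary t \<Longrightarrow> i < leaves t \<Longrightarrow> leaves (graft t i s) + 1 = leaves t + leaves s"
proof (induction arbitrary: i rule: binary_induct)
  case (Node c l r)
  show ?case
  proof (cases "i < leaves l")
    case True
    then show ?thesis using Node.IH(1)[of i] by simp
  next
    case False
    then have "i - leaves l < leaves r" using Node.prems by simp
    then show ?thesis using Node.IH(2)[of "i - leaves l"] False by simp
  qed
qed simp

lemma binary_trees_graft:
  "t \<in> binary_trees m \<Longrightarrow> s \<in> binary_trees n \<Longrightarrow> i < m \<Longrightarrow> graft t i s \<in> binary_trees (m + n - 1)"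
  using leaves_graft[of t i s] by (auto simp: binary_trees_iff binary_graft)

lemma binary_pointed:
  assumes "binary t" "\<And>c. s c \<in> {1, 2}"
  shows "pointed s t"
proof (rule labelled_in_mono[OF assms(1)])
  have "1 \<le> s c \<and> s c \<le> 2" for c using assms(2)[of c] by auto
  then show "(if l = 2 then UNIV else {}) \<subseteq> {c. s c \<in> {1..l}}" for l by auto
qed

lemma pointer_binary:
  assumes "\<And>c. s c \<in> {1, 2::nat}"
  shows "pointer s (Node c [l, r]) = (if s c = 1 then pointer s l else leaves l + pointer s r)"
  using assms[of c] by auto

lemma pointer_graft:
  assumes s: "\<And>c. s c \<in> {1, 2::nat}"
  shows "binary t \<Longrightarrow> binary u \<Longrightarrow> i < leaves t \<Longrightarrow>
    pointer s (graft t i u) = dias_comp i (leaves u) (pointer s t) (pointer s u)"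
proof (induction arbitrary: i rule: binary_induct)
  case (Node c l r)
  have l: "pointer s l \<in> {1..leaves l}" and r: "pointer s r \<in> {1..leaves r}"
    using Node.hyps binary_pointed[of _ s] s pointer_range[of s] by blast+
  have u: "leaves u \<ge> 1" using Node.prems leaves_pos by blast
  show ?case
  proof (cases "i < leaves l")
    case True
    then show ?thesis using Node.IH(1)[of i] Node.prems l r u leaves_graft[OF Node.hyps(1) True, of u]
      by (auto simp: pointer_binary[of s, OF s] dias_comp_def simp del: pointer.simps)
  next
    case False
    then have "i - leaves l < leaves r" using Node.prems by simp
    then show ?thesis using Node.IH(2)[of "i - leaves l"] Node.prems False l r
      by (auto simp: pointer_binary[of s, OF s] dias_comp_def simp del: pointer.simps)
  qed
qed (simp add: dias_comp_def)

lemma standard_binary: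
  "standard s k (Node c [l, r]) \<longleftrightarrow>
    s c = (if leaves l < k \<and> k \<le> leaves l + leaves r then 2 else 1) \<and>
    standard s k l \<and> standard s (k - leaves l) r"
  by auto

lemma standard_outside:
  "binary t \<Longrightarrow> k > leaves t \<Longrightarrow> k' > leaves t \<Longrightarrow> standard s k t \<longleftrightarrow> standard s k' t"
proof (induction arbitrary: k k' rule: binary_induct)
  case (Node c l r)
  have "standard s k l \<longleftrightarrow> standard s k' l"
    "standard s (k - leaves l) r \<longleftrightarrow> standard s (k' - leaves l) r"
    using Node.prems by (auto intro!: Node.IH)
  moreover have "\<not> k \<le> leaves l + leaves r" "\<not> k' \<le> leaves l + leaves r"
    using Node.prems by simp_all
  ultimately show ?case unfolding standard_binary by simp
qed simp

text \<open>
  If \<open>k\<close> is one of the leaves of the grafted tree, the path in the lower tree leads to the leaf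
  with index \<open>i\<close>. Otherwise the grafted tree lies off the path and must have all labels 1, which is
  expressed by \<open>k - i\<close> being 0 or too large.
\<close>

lemma standard_graft:
  "binary t \<Longrightarrow> binary u \<Longrightarrow> i < leaves t \<Longrightarrow>
    standard s k (graft t i u) \<longleftrightarrow>
      standard s (if k \<le> i then k else if k \<le> i + leaves u then Suc i else k + 1 - leaves u) t \<and>
      standard s (k - i) u"
proof (induction arbitrary: i k rule: binary_induct)
  case (Node c l r)
  have u: "leaves u \<ge> 1" and l: "leaves l \<ge> 1" and r: "leaves r \<ge> 1"
    using Node leaves_pos by blast+
  show ?case
  proof (cases "i < leaves l")
    case True
    have g: "leaves (graft l i u) = leaves l + leaves u - 1"
      using leaves_graft[OF Node.hyps(1) True, of u] by simp
    have gr: "graft (Node c [l, r]) i u = Node c [graft l i u, r]" using True by simp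
    consider "k \<le> i" | "i < k" "k \<le> i + leaves u" | "i + leaves u < k" by linarith
    then show ?thesis
    proof cases
      case 1
      then show ?thesis unfolding gr standard_binary g Node.IH(1)[OF Node.prems(1) True]
        using True u by auto
    next
      case 2
      then show ?thesis unfolding gr standard_binary g Node.IH(1)[OF Node.prems(1) True]
        using True u by auto
    next
      case 3
      then have "k + 1 - leaves u - leaves l = k - (leaves l + leaves u - 1)" using u by simp
      moreover have "leaves l < k + 1 - leaves u \<longleftrightarrow> leaves l + leaves u - 1 < k"
        "k + 1 - leaves u \<le> leaves l + leaves r \<longleftrightarrow> k \<le> leaves l + leaves u - 1 + leaves r"
        using 3 u by auto
      ultimately show ?thesis unfolding gr standard_binary g Node.IH(1)[OF Node.prems(1) True]
        using 3 by auto
    qed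
  next
    case False
    have ir: "i - leaves l < leaves r" using False Node.prems by simp
    have g: "leaves (graft r (i - leaves l) u) = leaves r + leaves u - 1"
      using leaves_graft[OF Node.hyps(2) ir, of u] by simp
    have gr: "graft (Node c [l, r]) i u = Node c [l, graft r (i - leaves l) u]" using False ir by simp
    have d: "k - leaves l - (i - leaves l) = k - i" using False by simp
    consider "k \<le> leaves l" | "leaves l < k" "k \<le> i" | "i < k" "k \<le> i + leaves u" | "i + leaves u < k"
      by linarith
    then show ?thesis
    proof cases
      case 1
      then show ?thesis unfolding gr standard_binary g Node.IH(2)[OF Node.prems(1) ir] d
        using False u by auto
    next
      case 2
      then show ?thesis unfolding gr standard_binary g Node.IH(2)[OF Node.prems(1) ir] d
        using False ir u by (auto simp: le_diff_conv)
    next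
      case 3
      then have "Suc i - leaves l = Suc (i - leaves l)" "\<not> k - leaves l \<le> i - leaves l"
        "k - leaves l \<le> i - leaves l + leaves u" using False by auto
      moreover have "standard s (Suc i) l \<longleftrightarrow> standard s k l"
        using 3 False by (intro standard_outside Node.hyps) auto
      ultimately show ?thesis unfolding gr standard_binary g Node.IH(2)[OF Node.prems(1) ir] d
        using 3 False ir u by auto
    next
      case 4
      have "standard s (k + 1 - leaves u) l \<longleftrightarrow> standard s k l"
        using 4 False u by (intro standard_outside Node.hyps) auto
      moreover have "k + 1 - leaves u - leaves l = k - leaves l + 1 - leaves u"
        "\<not> k - leaves l \<le> i - leaves l" "\<not> k - leaves l \<le> i - leaves l + leaves u"
        using 4 False by auto
      ultimately show ?thesis unfolding gr standard_binary g Node.IH(2)[OF Node.prems(1) ir] d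
        using 4 False ir u by auto
    qed
  qed
qed auto

section \<open>Quotients of free operads\<close>

lemma fscale_apply [simp]: "fscale c x a = c * x a"
  by (simp add: fscale_def)

lemma delta_apply: "delta a b = (if b = a then 1 else 0)"
  by (simp add: delta_def)

lemma subspace_supported_on: "fun_vs.subspace (supported_on S)"
  by (rule fun_vs.subspaceI) (auto simp: supported_on_def)

lemma supported_on_add: "x \<in> supported_on S \<Longrightarrow> y \<in> supported_on S \<Longrightarrow> x + y \<in> supported_on S"
  by (simp add: supported_on_def)

lemma supported_on_diff: "x \<in> supported_on S \<Longrightarrow> y \<in> supported_on S \<Longrightarrow> x - y \<in> supported_on S"
  by (simp add: supported_on_def)

lemma supported_on_scale: "x \<in> supported_on S \<Longrightarrow> fscale c x \<in> supported_on S"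
  by (simp add: supported_on_def)

lemma delta_supported_on: "a \<in> S \<Longrightarrow> delta a \<in> supported_on S"
  by (auto simp: supported_on_def delta_def)

lemma supported_on_sum: "(\<And>i. i \<in> A \<Longrightarrow> f i \<in> supported_on S) \<Longrightarrow> sum f A \<in> supported_on S"
  by (rule fun_vs.subspace_sum[OF subspace_supported_on])

lemma sum_delta_expansion:
  assumes "x \<in> supported_on S" "finite S"
  shows "x = (\<Sum>a\<in>S. fscale (x a) (delta a))"
proof
  fix b
  have "(\<Sum>a\<in>S. x a * delta a b) = (\<Sum>a\<in>S. if a = b then x b else 0)"
    by (rule sum.cong) (auto simp: delta_def)
  then show "x b = (\<Sum>a\<in>S. fscale (x a) (delta a)) b"
    using assms by (auto simp: sum_apply supported_on_def)
qed

subsection \<open>Partial composition in the free operad\<close>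

lemma free_comp_sum:
  fixes x y :: "'g::finite ptree \<Rightarrow> 'k::field"
  assumes "x \<in> free_operad m" "y \<in> free_operad n"
  shows "free_comp i x y =
    (\<Sum>t\<in>binary_trees m. \<Sum>s\<in>binary_trees n. fscale (x t * y s) (delta (graft t i s)))"
proof -
  have "(\<Sum>s | y s \<noteq> 0. fscale (x t * y s) (delta (graft t i s))) =
      (\<Sum>s\<in>binary_trees n. fscale (x t * y s) (delta (graft t i s)))" for t
    by (rule sum.mono_neutral_left) (use assms in \<open>auto simp: supported_on_def fun_eq_iff\<close>)
  then show ?thesis unfolding free_comp_def
    by (simp only:) (rule sum.mono_neutral_left,
        use assms in \<open>auto simp: supported_on_def fun_eq_iff sum_apply\<close>)
qed

lemma free_comp_delta: "free_comp i (delta t) (delta s) = (delta (graft t i s) :: _ \<Rightarrow> 'k::field)"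
proof -
  have "{u. (delta t u :: 'k) \<noteq> 0} = {t}" for t :: "'a ptree" by (auto simp: delta_def)
  then show ?thesis by (simp add: free_comp_def fun_eq_iff delta_apply)
qed

context
  fixes m n i :: nat
begin

lemma free_comp_add_left:
  fixes x :: "'g::finite ptree \<Rightarrow> 'k::field"
  assumes "x \<in> free_operad m" "x' \<in> free_operad m" "y \<in> free_operad n"
  shows "free_comp i (x + x') y = free_comp i x y + free_comp i x' y"
  using assms by (simp add: free_comp_sum[of _ m _ n] supported_on_add fun_eq_iff sum_apply
      algebra_simps sum.distrib)

lemma free_comp_add_right:
  fixes x :: "'g::finite ptree \<Rightarrow> 'k::field"
  assumes "x \<in> free_operad m" "y \<in> free_operad n" "y' \<in> free_operad n"
  shows "free_comp i x (y + y') = free_comp i x y + free_comp i x y'"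
  using assms by (simp add: free_comp_sum[of _ m _ n] supported_on_add fun_eq_iff sum_apply
      algebra_simps sum.distrib)

lemma free_comp_diff_left:
  fixes x :: "'g::finite ptree \<Rightarrow> 'k::field"
  assumes "x \<in> free_operad m" "x' \<in> free_operad m" "y \<in> free_operad n"
  shows "free_comp i (x - x') y = free_comp i x y - free_comp i x' y"
  using assms by (simp add: free_comp_sum[of _ m _ n] supported_on_diff fun_eq_iff sum_apply
      algebra_simps sum_subtractf)

lemma free_comp_diff_right:
  fixes x :: "'g::finite ptree \<Rightarrow> 'k::field"
  assumes "x \<in> free_operad m" "y \<in> free_operad n" "y' \<in> free_operad n"
  shows "free_comp i x (y - y') = free_comp i x y - free_comp i x y'"
  using assms by (simp add: free_comp_sum[of _ m _ n] supported_on_diff fun_eq_iff sum_apply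
      algebra_simps sum_subtractf)

lemma free_comp_scale_left:
  fixes x :: "'g::finite ptree \<Rightarrow> 'k::field"
  assumes "x \<in> free_operad m" "y \<in> free_operad n"
  shows "free_comp i (fscale c x) y = fscale c (free_comp i x y)"
  using assms by (simp add: free_comp_sum[of _ m _ n] supported_on_scale fun_eq_iff sum_apply
      sum_distrib_left mult.assoc)

lemma free_comp_sum_left:
  fixes x :: "'i \<Rightarrow> 'g::finite ptree \<Rightarrow> 'k::field"
  assumes "\<And>a. a \<in> A \<Longrightarrow> x a \<in> free_operad m" "y \<in> free_operad n"
  shows "free_comp i (\<Sum>a\<in>A. x a) y = (\<Sum>a\<in>A. free_comp i (x a) y)"
  using assms(1)
proof (induction A rule: infinite_finite_induct)
  case (insert a A)
  then have "free_comp i (x a + sum x A) y = free_comp i (x a) y + (\<Sum>a\<in>A. free_comp i (x a) y)"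
    by (subst free_comp_add_left[OF _ _ assms(2)]) (auto intro: supported_on_sum)
  then show ?case unfolding sum.insert[OF insert.hyps(1,2)] .
qed (simp_all add: free_comp_def)

lemma free_comp_scale_right:
  fixes x :: "'g::finite ptree \<Rightarrow> 'k::field"
  assumes "x \<in> free_operad m" "y \<in> free_operad n"
  shows "free_comp i x (fscale c y) = fscale c (free_comp i x y)"
  using assms by (simp add: free_comp_sum[of _ m _ n] supported_on_scale fun_eq_iff sum_apply
      sum_distrib_left mult_ac)

lemma free_comp_sum_right:
  fixes x :: "'g::finite ptree \<Rightarrow> 'k::field"
  assumes "x \<in> free_operad m" "\<And>a. a \<in> A \<Longrightarrow> y a \<in> free_operad n"
  shows "free_comp i x (\<Sum>a\<in>A. y a) = (\<Sum>a\<in>A. free_comp i x (y a))"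
  using assms(2)
proof (induction A rule: infinite_finite_induct)
  case (insert a A)
  then have "free_comp i x (y a + sum y A) = free_comp i x (y a) + (\<Sum>a\<in>A. free_comp i x (y a))"
    by (subst free_comp_add_right[OF assms(1)]) (auto intro: supported_on_sum)
  then show ?case unfolding sum.insert[OF insert.hyps(1,2)] .
qed (simp_all add: free_comp_def)

lemma free_comp_in_free_operad:
  fixes x :: "'g::finite ptree \<Rightarrow> 'k::field"
  assumes "x \<in> free_operad m" "y \<in> free_operad n" "i < m"
  shows "free_comp i x y \<in> free_operad (m + n - 1)"
  unfolding free_comp_sum[OF assms(1,2)]
  by (intro supported_on_sum supported_on_scale delta_supported_on binary_trees_graft assms(3))

end

text \<open>Linear functionals on the free operad are given by their values on trees. The ideals are
  studied through the functionals that vanish on them.\<close>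

definition weight :: "nat \<Rightarrow> ('g::finite ptree \<Rightarrow> 'k) \<Rightarrow> ('g ptree \<Rightarrow> 'k::field) \<Rightarrow> 'k" where
  "weight n \<phi> x = (\<Sum>t\<in>binary_trees n. \<phi> t * x t)"

lemma weight_add: "weight n \<phi> (x + y) = weight n \<phi> x + weight n \<phi> y"
  by (simp add: weight_def algebra_simps sum.distrib)

lemma weight_diff: "weight n \<phi> (x - y) = weight n \<phi> x - weight n \<phi> y"
  by (simp add: weight_def algebra_simps sum_subtractf)

lemma weight_scale: "weight n \<phi> (fscale c x) = c * weight n \<phi> x"
  by (simp add: weight_def sum_distrib_left algebra_simps)

lemma weight_zero [simp]: "weight n \<phi> 0 = 0"
  by (simp add: weight_def)

lemma weight_sum: "weight n \<phi> (sum x A) = (\<Sum>a\<in>A. weight n \<phi> (x a))"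
  by (simp add: weight_def sum_apply sum_distrib_left sum.swap[of _ A])

lemma weight_delta: "t \<in> binary_trees n \<Longrightarrow> weight n \<phi> (delta t) = \<phi> t"
  by (simp add: weight_def delta_def if_distrib[of "\<lambda>x. _ * x"] cong: if_cong)

lemma weight_free_comp:
  fixes x y :: "'g::finite ptree \<Rightarrow> 'k::field"
  assumes "x \<in> free_operad m" "y \<in> free_operad n" "i < m"
  shows "weight (m + n - 1) \<phi> (free_comp i x y) =
    (\<Sum>t\<in>binary_trees m. \<Sum>s\<in>binary_trees n. x t * y s * \<phi> (graft t i s))"
  unfolding free_comp_sum[OF assms(1,2)] weight_sum weight_scale
  by (intro sum.cong refl) (simp only: weight_delta[OF binary_trees_graft[OF _ _ assms(3)]])

subsection \<open>Ideals and quotients\<close>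

lemma left_tree_binary: "left_tree p \<in> binary_trees 3"
  by (cases p) (simp add: left_tree_def binary_trees_iff)

lemma right_tree_binary: "right_tree p \<in> binary_trees 3"
  by (cases p) (simp add: right_tree_def binary_trees_iff)

lemma relator_in_free_operad: "relator u v \<in> free_operad 3"
  unfolding relator_def
  by (intro supported_on_diff supported_on_sum supported_on_scale delta_supported_on
      left_tree_binary right_tree_binary)

lemma weight_relator:
  "weight 3 \<phi> (relator u v) =
    (\<Sum>p\<in>UNIV. u p * \<phi> (left_tree p)) - (\<Sum>p\<in>UNIV. v p * \<phi> (right_tree p))"
  by (simp add: relator_def weight_diff weight_sum weight_scale weight_delta
      left_tree_binary right_tree_binary)

lemma in_ideal_free: "in_ideal \<Lambda> n x \<Longrightarrow> x \<in> free_operad n"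
proof (induction rule: in_ideal.induct)
  case (zero n)
  show ?case by (simp add: supported_on_def)
qed (rule relator_in_free_operad supported_on_add supported_on_scale free_comp_in_free_operad;
    assumption)+

lemma subspace_op_ideal: "fun_vs.subspace (op_ideal \<Lambda> n)"
  by (rule fun_vs.subspaceI) (auto simp: op_ideal_def intro: in_ideal.intros)

lemma op_ideal_free: "x \<in> op_ideal \<Lambda> n \<Longrightarrow> x \<in> free_operad n"
  by (simp add: op_ideal_def in_ideal_free)

lemma op_ideal_comp_left:
  "x \<in> op_ideal \<Lambda> m \<Longrightarrow> y \<in> free_operad n \<Longrightarrow> i < m \<Longrightarrow>
    free_comp i x y \<in> op_ideal \<Lambda> (m + n - 1)"
  unfolding op_ideal_def mem_Collect_eq by (rule in_ideal.comp_left)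

lemma op_ideal_comp_right:
  "x \<in> free_operad m \<Longrightarrow> y \<in> op_ideal \<Lambda> n \<Longrightarrow> i < m \<Longrightarrow>
    free_comp i x y \<in> op_ideal \<Lambda> (m + n - 1)"
  unfolding op_ideal_def mem_Collect_eq by (rule in_ideal.comp_right)

lemma cls_eq_iff:
  assumes "fun_vs.subspace I"
  shows "cls I x = cls I y \<longleftrightarrow> x - y \<in> I"
proof
  assume "cls I x = cls I y"
  moreover have "x \<in> cls I x" using fun_vs.subspace_0[OF assms] by (simp add: cls_def)
  ultimately show "x - y \<in> I" by (auto simp: cls_def)
next
  assume *: "x - y \<in> I"
  have "z - x \<in> I \<longleftrightarrow> z - y \<in> I" for z
  proof
    assume "z - x \<in> I"
    with fun_vs.subspace_add[OF assms this *] show "z - y \<in> I" by simp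
  next
    assume "z - y \<in> I"
    with fun_vs.subspace_diff[OF assms this *] show "z - x \<in> I" by simp
  qed
  then show "cls I x = cls I y" by (auto simp: cls_def)
qed

lemma cls_self: "fun_vs.subspace I \<Longrightarrow> x \<in> cls I x"
  using fun_vs.subspace_0 by (simp add: cls_def)

lemma car_operad: "car (operad \<Lambda> n) = cls (op_ideal \<Lambda> n) ` free_operad n"
  by (simp add: operad_def quotient_space_def)

lemma vadd_operad:
  "vadd (operad \<Lambda> n) (cls (op_ideal \<Lambda> n) x) (cls (op_ideal \<Lambda> n) y) = cls (op_ideal \<Lambda> n) (x + y)"
proof -
  let ?I = "op_ideal \<Lambda> n"
  have "cls ?I (x' + y') = cls ?I (x + y)" if "x' \<in> cls ?I x" "y' \<in> cls ?I y" for x' y'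
    using fun_vs.subspace_add[OF subspace_op_ideal, of "x' - x" \<Lambda> n "y' - y"] that
    by (simp add: cls_eq_iff[OF subspace_op_ideal] algebra_simps) (simp add: cls_def algebra_simps)
  then show ?thesis using cls_self[OF subspace_op_ideal]
    by (simp add: operad_def quotient_space_def) blast
qed

lemma vscale_operad:
  "vscale (operad \<Lambda> n) c (cls (op_ideal \<Lambda> n) x) = cls (op_ideal \<Lambda> n) (fscale c x)"
proof -
  let ?I = "op_ideal \<Lambda> n"
  have "cls ?I (fscale c x') = cls ?I (fscale c x)" if "x' \<in> cls ?I x" for x'
    using fun_vs.subspace_scale[OF subspace_op_ideal, of "x' - x" \<Lambda> n c] that
    by (simp add: cls_eq_iff[OF subspace_op_ideal] fun_vs.scale_right_diff_distrib)
      (simp add: cls_def)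
  then show ?thesis using cls_self[OF subspace_op_ideal]
    by (simp add: operad_def quotient_space_def) blast
qed

text \<open>The definition by representatives is independent of their choice, since changing them changes
  the composite by elements of the ideal.\<close>

lemma op_comp_cls:
  assumes "x \<in> free_operad m" "y \<in> free_operad n" "i < m"
  shows "op_comp \<Lambda> m i n (cls (op_ideal \<Lambda> m) x) (cls (op_ideal \<Lambda> n) y) =
    cls (op_ideal \<Lambda> (m + n - 1)) (free_comp i x y)"
proof -
  let ?I = "op_ideal \<Lambda>"
  have "cls (?I (m + n - 1)) (free_comp i x' y') = cls (?I (m + n - 1)) (free_comp i x y)"
    if "x' \<in> cls (?I m) x" "y' \<in> cls (?I n) y" for x' y'
  proof -
    have d: "x' - x \<in> ?I m" "y' - y \<in> ?I n" using that by (simp_all add: cls_def)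
    have "x + (x' - x) \<in> free_operad m" "y + (y' - y) \<in> free_operad n"
      using assms d op_ideal_free supported_on_add by blast+
    then have f: "x' \<in> free_operad m" "y' \<in> free_operad n" by simp_all
    have "free_comp i x' y' - free_comp i x y =
        free_comp i (x' - x) y' + free_comp i x (y' - y)"
      using assms f by (simp add: free_comp_diff_left free_comp_diff_right)
    also have "\<dots> \<in> ?I (m + n - 1)"
      by (intro fun_vs.subspace_add[OF subspace_op_ideal] op_ideal_comp_left op_ideal_comp_right
          d f assms)
    finally show ?thesis by (simp add: cls_eq_iff[OF subspace_op_ideal])
  qed
  moreover have "x \<in> cls (?I m) x" "y \<in> cls (?I n) y"
    by (simp_all add: cls_self[OF subspace_op_ideal])
  ultimately show ?thesis unfolding op_comp_def by blast
qed

section \<open>The relations of the quadri-operad and of its dual\<close>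

type_synonym quad_op = "dend_op \<times> dend_op"
type_synonym 'k quad_relations = "(quad_op, 'k) relations"
type_synonym 'k quad_class = "(quad_op, 'k) op_class"

primrec side :: "dend_op \<Rightarrow> nat" where
  "side Prec = 1"
| "side Succ = 2"

definition ptr :: "quad_op ptree \<Rightarrow> nat \<times> nat" where
  "ptr t = (pointer (\<lambda>g. side (fst g)) t, pointer (\<lambda>g. side (snd g)) t)"

definition quad_comp :: "nat \<Rightarrow> nat \<Rightarrow> nat \<times> nat \<Rightarrow> nat \<times> nat \<Rightarrow> nat \<times> nat" where
  "quad_comp i n p q = (dias_comp i n (fst p) (fst q), dias_comp i n (snd p) (snd q))"

lemma side_range: "side c \<in> {1, 2}"
  by (cases c) auto

lemma dend_op_pair_eqI:
  "f (Prec, Prec) = g (Prec, Prec) \<Longrightarrow> f (Prec, Succ) = g (Prec, Succ) \<Longrightarrow>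
    f (Succ, Prec) = g (Succ, Prec) \<Longrightarrow> f (Succ, Succ) = g (Succ, Succ) \<Longrightarrow> f = g"
  by (rule ext) (metis (full_types) dend_op.exhaust surj_pair)

lemma ptr_Leaf [simp]: "ptr Leaf = (1, 1)"
  by (simp add: ptr_def)

lemma ptr_Node:
  "ptr (Node c [l, r]) =
    (if fst c = Prec then fst (ptr l) else leaves l + fst (ptr r),
     if snd c = Prec then snd (ptr l) else leaves l + snd (ptr r))"
  by (cases c; cases "fst c"; cases "snd c") (simp_all add: ptr_def)

lemma ptr_range: "t \<in> binary_trees n \<Longrightarrow> ptr t \<in> {1..n} \<times> {1..n}"
  using pointer_range[OF binary_pointed[of t]] side_range by (auto simp: binary_trees_iff ptr_def)

lemma ptr_graft:
  "t \<in> binary_trees m \<Longrightarrow> u \<in> binary_trees n \<Longrightarrow> i < m \<Longrightarrow>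
    ptr (graft t i u) = quad_comp i n (ptr t) (ptr u)"
  unfolding ptr_def quad_comp_def fst_conv snd_conv
  by (subst (1 2) pointer_graft) (use side_range in \<open>auto simp: binary_trees_iff\<close>)

definition left_ptr :: "dend_op \<times> dend_op \<Rightarrow> nat" where
  "left_ptr q = pointer side (left_tree q)"

definition right_ptr :: "dend_op \<times> dend_op \<Rightarrow> nat" where
  "right_ptr q = pointer side (right_tree q)"

lemma left_ptr_simps:
  "left_ptr (Prec, Prec) = 1" "left_ptr (Succ, Prec) = 2" "left_ptr (a, Succ) = 3"
  by (simp_all add: left_ptr_def left_tree_def)

lemma right_ptr_simps:
  "right_ptr (Prec, b) = 1" "right_ptr (Succ, Prec) = 2" "right_ptr (Succ, Succ) = 3"
  by (simp_all add: right_ptr_def right_tree_def)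

text \<open>This is the link between \<open>dend\<close> and pointers: each relation equates the sum of all labellings of
  \<open>(xy)z\<close> and the sum of all labellings of \<open>x(yz)\<close> that point to the same leaf.\<close>

lemma dend_eq:
  "(dend :: (dend_op, 'k::field) relations) =
    (\<lambda>r. (\<lambda>q. of_bool (left_ptr q = r), \<lambda>q. of_bool (right_ptr q = r))) ` {1..3}"
proof -
  have "{1..3} = {1, 2, 3::nat}" by auto
  moreover have
    "(\<lambda>q. of_bool (left_ptr q = 1)) = (delta (Prec, Prec) :: _ \<Rightarrow> 'k)"
    "(\<lambda>q. of_bool (right_ptr q = 1)) = (delta (Prec, Prec) + delta (Prec, Succ) :: _ \<Rightarrow> 'k)"
    "(\<lambda>q. of_bool (left_ptr q = 2)) = (delta (Succ, Prec) :: _ \<Rightarrow> 'k)"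
    "(\<lambda>q. of_bool (right_ptr q = 2)) = (delta (Succ, Prec) :: _ \<Rightarrow> 'k)"
    "(\<lambda>q. of_bool (left_ptr q = 3)) = (delta (Prec, Succ) + delta (Succ, Succ) :: _ \<Rightarrow> 'k)"
    "(\<lambda>q. of_bool (right_ptr q = 3)) = (delta (Succ, Succ) :: _ \<Rightarrow> 'k)"
    by (rule dend_op_pair_eqI; simp add: left_ptr_simps right_ptr_simps delta_def)+
  ultimately show ?thesis unfolding dend_def by (simp only: image_insert image_empty)
qed

lemma ptr_left_tree: "ptr (left_tree ((a, a'), (b, b'))) = (left_ptr (a, b), left_ptr (a', b'))"
  by (cases a; cases b; cases a'; cases b') (simp_all add: ptr_Node left_tree_def left_ptr_def)

lemma ptr_right_tree: "ptr (right_tree ((a, a'), (b, b'))) = (right_ptr (a, b), right_ptr (a', b'))"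
  by (cases a; cases b; cases a'; cases b') (simp_all add: ptr_Node right_tree_def right_ptr_def)

abbreviation quad :: "('k::field) quad_relations" where
  "quad \<equiv> black_square dend dend"

abbreviation "quad_ideal \<equiv> op_ideal quad"

abbreviation "dual_ideal \<equiv> op_ideal (orth quad)"

abbreviation "dual_operad \<equiv> operad (orth quad)"

definition quad_relation :: "nat \<times> nat \<Rightarrow> (quad_op \<times> quad_op \<Rightarrow> 'k::field) \<times> (quad_op \<times> quad_op \<Rightarrow> 'k)" where
  "quad_relation p = (\<lambda>q. of_bool (ptr (left_tree q) = p), \<lambda>q. of_bool (ptr (right_tree q) = p))"

lemma quad_eq: "(quad :: ('k::field) quad_relations) = pair_vs.span (quad_relation ` ({1..3} \<times> {1..3}))"
proof -
  have *: "(s23 (\<lambda>q. of_bool (left_ptr q = r)) (\<lambda>q. of_bool (left_ptr q = r')),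
      s23 (\<lambda>q. of_bool (right_ptr q = r)) (\<lambda>q. of_bool (right_ptr q = r'))) =
      (quad_relation (r, r') :: (_ \<Rightarrow> 'k) \<times> _)" for r r'
    by (auto simp: s23_def quad_relation_def fun_eq_iff ptr_left_tree ptr_right_tree)
  have "{(s23 u u', s23 v v') | u v u' v'. (u, v) \<in> dend \<and> (u', v') \<in> dend} =
      (quad_relation ` ({1..3} \<times> {1..3}) :: ((_ \<Rightarrow> 'k) \<times> _) set)"
  proof (intro equalityI subsetI)
    fix x :: "(_ \<Rightarrow> 'k) \<times> _"
    assume "x \<in> {(s23 u u', s23 v v') | u v u' v'. (u, v) \<in> dend \<and> (u', v') \<in> dend}"
    then obtain r r' where "r \<in> {1..3}" "r' \<in> {1..3}" "x = quad_relation (r, r')"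
      unfolding dend_eq *[symmetric] by blast
    then show "x \<in> quad_relation ` ({1..3} \<times> {1..3})" by blast
  next
    fix x :: "(_ \<Rightarrow> 'k) \<times> _"
    assume "x \<in> quad_relation ` ({1..3} \<times> {1..3})"
    then obtain r r' where "r \<in> {1..3}" "r' \<in> {1..3}" "x = quad_relation (r, r')" by blast
    then show "x \<in> {(s23 u u', s23 v v') | u v u' v'. (u, v) \<in> dend \<and> (u', v') \<in> dend}"
      unfolding dend_eq *[symmetric] by blast
  qed
  then show ?thesis by (simp only: black_square_def)
qed

text \<open>Summing the relations with arbitrary weights of the pointers gives a form in which no pointers
  have to be singled out. It is used with weights that come from the context into which the
  trees with three leaves are grafted.\<close>

lemma quad_relation_weighted:
  "(\<lambda>q. w (ptr (left_tree q)), \<lambda>q. w (ptr (right_tree q))) \<in> (quad :: ('k::field) quad_relations)"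
proof -
  have r: "ptr (left_tree q) \<in> {1..3} \<times> {1..3}" "ptr (right_tree q) \<in> {1..3} \<times> {1..3}" for q
    using ptr_range left_tree_binary right_tree_binary by blast+
  have *: "w (ptr u) = (\<Sum>p\<in>{1..3}\<times>{1..3}. w p * of_bool (ptr u = p))" if "ptr u \<in> {1..3} \<times> {1..3}" for u
    using that by (simp add: of_bool_def if_distrib[of "\<lambda>x. _ * x"] cong: if_cong)
  have fst_sum: "fst (sum f A) = (\<Sum>a\<in>A. fst (f a))" and snd_sum: "snd (sum f A) = (\<Sum>a\<in>A. snd (f a))"
    for f :: "nat \<times> nat \<Rightarrow> (quad_op \<times> quad_op \<Rightarrow> 'k) \<times> (quad_op \<times> quad_op \<Rightarrow> 'k)" and A
    by (induction A rule: infinite_finite_induct) auto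
  have "(\<lambda>q. w (ptr (left_tree q)), \<lambda>q. w (ptr (right_tree q))) =
      (\<Sum>p\<in>{1..3}\<times>{1..3}. pair_scale (w p) (quad_relation p))"
    by (rule prod_eqI)
      (simp_all only: fst_sum snd_sum fst_conv snd_conv pair_scale_def quad_relation_def
        fun_eq_iff sum_apply fscale_apply *[OF r(1)] *[OF r(2)] simp_thms)
  also have "\<dots> \<in> quad"
    unfolding quad_eq by (intro pair_vs.span_sum pair_vs.span_scale pair_vs.span_base) blast
  finally show ?thesis .
qed

text \<open>The orthogonal complement of the sums over trees with equal pointers consists of the relators
  whose coefficients add up to zero for each pointer, that is, for any weights of the pointers.\<close>

lemma orth_quad_iff:
  "(f, g) \<in> orth (quad :: ('k::field) quad_relations) \<longleftrightarrow>
    (\<forall>w. (\<Sum>q\<in>UNIV. f q * w (ptr (left_tree q))) = (\<Sum>q\<in>UNIV. g q * w (ptr (right_tree q))))"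
  (is "_ \<longleftrightarrow> (\<forall>w. ?P w)")
proof -
  let ?S = "{x. (\<Sum>q\<in>UNIV. f q * fst x q) = (\<Sum>q\<in>UNIV. g q * snd x q)}"
  have orth: "(f, g) \<in> orth quad \<longleftrightarrow> quad \<subseteq> ?S"
    unfolding orth_def by fastforce
  have "?P w" if "quad \<subseteq> ?S" for w
    using subsetD[OF that quad_relation_weighted[of w]] by simp
  moreover have "quad \<subseteq> ?S" if w: "\<forall>w. ?P w"
    unfolding quad_eq
  proof (rule pair_vs.span_minimal)
    have "quad_relation p \<in> ?S" for p
      using w[rule_format, of "\<lambda>p'. of_bool (p' = p)"] by (simp add: quad_relation_def)
    then show "quad_relation ` ({1..3} \<times> {1..3}) \<subseteq> ?S" by blast
    show "pair_vs.subspace ?S"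
      by (rule pair_vs.subspaceI)
        (simp_all add: pair_scale_def mult.left_commute[of _ "_ :: 'k"] sum_distrib_left[symmetric]
          distrib_left sum.distrib)
  qed
  ultimately show ?thesis using orth by blast
qed

section \<open>The quadratic dual is the square of the diassociative operad\<close>

text \<open>The pointers of a grafted tree depend only on the pointers of its two parts. So a weight of
  the pointers of a composite is, for one part fixed, a weight of the pointers of the other.\<close>

lemma ptr_weight_vanishes:
  "in_ideal (orth quad) n (x :: quad_op ptree \<Rightarrow> 'k::field) \<Longrightarrow> weight n (\<lambda>t. w (ptr t)) x = 0"
proof (induction arbitrary: w rule: in_ideal.induct)
  case (rel u v)
  then show ?case unfolding weight_relator using orth_quad_iff[of u v] by (simp add: mult.commute)
next
  case (comp_left m x y n i)
  have "weight (m + n - 1) (\<lambda>t. w (ptr t)) (free_comp i x y) =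
      (\<Sum>t\<in>binary_trees m. \<Sum>s\<in>binary_trees n. y s * (w (quad_comp i n (ptr t) (ptr s)) * x t))"
    unfolding weight_free_comp[OF in_ideal_free[OF comp_left.hyps(1)] comp_left.hyps(2,3)]
    by (intro sum.cong refl) (simp add: ptr_graft comp_left.hyps)
  also have "\<dots> = (\<Sum>s\<in>binary_trees n. y s * weight m (\<lambda>t. w (quad_comp i n (ptr t) (ptr s))) x)"
    by (subst sum.swap) (simp add: weight_def sum_distrib_left)
  also have "\<dots> = 0"
    using comp_left.IH[of "\<lambda>p. w (quad_comp i n p (ptr s))" for s] by simp
  finally show ?case .
next
  case (comp_right x m n y i)
  have "weight (m + n - 1) (\<lambda>t. w (ptr t)) (free_comp i x y) =
      (\<Sum>t\<in>binary_trees m. \<Sum>s\<in>binary_trees n. x t * (w (quad_comp i n (ptr t) (ptr s)) * y s))"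
    unfolding weight_free_comp[OF comp_right.hyps(1) in_ideal_free[OF comp_right.hyps(2)] comp_right.hyps(3)]
    by (intro sum.cong refl) (simp add: ptr_graft comp_right.hyps)
  also have "\<dots> = (\<Sum>t\<in>binary_trees m. x t * weight n (\<lambda>s. w (quad_comp i n (ptr t) (ptr s))) y)"
    by (simp add: weight_def sum_distrib_left)
  also have "\<dots> = 0"
    using comp_right.IH[of "\<lambda>p. w (quad_comp i n (ptr t) p)" for t] by simp
  finally show ?case .
qed (simp_all add: weight_add weight_scale)

subsection \<open>Connectedness of the trees with the same pointers\<close>

text \<open>The first argument only serves to fix the ground field, which does not occur in the type of trees.\<close>

definition tree_equiv :: "'k::field itself \<Rightarrow> nat \<Rightarrow> quad_op ptree \<Rightarrow> quad_op ptree \<Rightarrow> bool" where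
  "tree_equiv k n t u \<longleftrightarrow> t \<in> binary_trees n \<and> u \<in> binary_trees n \<and>
    (delta t - delta u :: _ \<Rightarrow> 'k) \<in> dual_ideal n"

lemma tree_equiv_refl: "t \<in> binary_trees n \<Longrightarrow> tree_equiv k n t t"
  using fun_vs.subspace_0[OF subspace_op_ideal] by (simp add: tree_equiv_def)

lemma tree_equiv_trans: "tree_equiv k n t u \<Longrightarrow> tree_equiv k n u v \<Longrightarrow> tree_equiv k n t v"
  using fun_vs.subspace_add[OF subspace_op_ideal, of "delta t - delta u" _ _ "delta u - delta v"]
  by (auto simp: tree_equiv_def)

lemma tree_equiv_sym: "tree_equiv k n t u \<Longrightarrow> tree_equiv k n u t"
  using fun_vs.subspace_neg[OF subspace_op_ideal, of "delta t - delta u"]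
  by (auto simp: tree_equiv_def)

lemma tree_equiv_ptr:
  assumes "tree_equiv (k :: 'k::field itself) n t u"
  shows "ptr t = ptr u"
proof -
  have "in_ideal (orth quad) n (delta t - delta u :: _ \<Rightarrow> 'k)"
    using assms by (simp add: tree_equiv_def op_ideal_def)
  from ptr_weight_vanishes[OF this, of "\<lambda>p. of_bool (p = ptr u)"] assms show ?thesis
    by (auto simp: tree_equiv_def weight_diff weight_delta)
qed

lemma tree_equiv_graft_left:
  assumes "tree_equiv (k :: 'k::field itself) m t t'" "u \<in> binary_trees n" "i < m"
  shows "tree_equiv k (m + n - 1) (graft t i u) (graft t' i u)"
proof -
  have t: "t \<in> binary_trees m" "t' \<in> binary_trees m"
    and I: "(delta t - delta t' :: _ \<Rightarrow> 'k) \<in> dual_ideal m"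
    using assms(1) by (auto simp: tree_equiv_def)
  have "free_comp i (delta t - delta t') (delta u) \<in> op_ideal (orth (quad :: 'k quad_relations)) (m + n - 1)"
    by (rule op_ideal_comp_left[OF I delta_supported_on[OF assms(2)] assms(3)])
  then show ?thesis unfolding tree_equiv_def
    using t assms(2,3) binary_trees_graft
    by (auto simp: free_comp_diff_left[of _ m _ _ n] delta_supported_on free_comp_delta)
qed

lemma tree_equiv_graft_right:
  assumes "t \<in> binary_trees m" "tree_equiv (k :: 'k::field itself) n u u'" "i < m"
  shows "tree_equiv k (m + n - 1) (graft t i u) (graft t i u')"
proof -
  have u: "u \<in> binary_trees n" "u' \<in> binary_trees n"
    and I: "(delta u - delta u' :: _ \<Rightarrow> 'k) \<in> dual_ideal n"
    using assms(2) by (auto simp: tree_equiv_def)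
  have "free_comp i (delta t) (delta u - delta u') \<in> op_ideal (orth (quad :: 'k quad_relations)) (m + n - 1)"
    by (rule op_ideal_comp_right[OF delta_supported_on[OF assms(1)] I assms(3)])
  then show ?thesis unfolding tree_equiv_def
    using u assms(1,3) binary_trees_graft
    by (auto simp: free_comp_diff_right[of _ m _ n] delta_supported_on free_comp_delta)
qed

lemma tree_equiv_Node_left:
  assumes "tree_equiv k m l l'" "r \<in> binary_trees n"
  shows "tree_equiv k (m + n) (Node c [l, r]) (Node c [l', r])"
proof -
  have "Node c [Leaf, r] \<in> binary_trees (Suc n)" using assms(2) by (auto simp: binary_trees_iff)
  from tree_equiv_graft_right[OF this assms(1), of 0] show ?thesis by (simp add: add.commute)
qed

lemma tree_equiv_Node_right:
  assumes "tree_equiv k n r r'" "l \<in> binary_trees m"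
  shows "tree_equiv k (m + n) (Node c [l, r]) (Node c [l, r'])"
proof -
  have "Node c [l, Leaf] \<in> binary_trees (Suc m)" "leaves l = m"
    using assms(2) by (auto simp: binary_trees_iff)
  from tree_equiv_graft_right[OF this(1) assms(1), of m] this(2) show ?thesis by simp
qed

lemma tree_equiv_graft_three:
  assumes "tree_equiv k 3 t u" "A \<in> binary_trees a" "B \<in> binary_trees b" "C \<in> binary_trees c"
  shows "tree_equiv k (a + b + c) (graft (graft (graft t 2 C) 1 B) 0 A) (graft (graft (graft u 2 C) 1 B) 0 A)"
proof -
  have pos: "a \<ge> 1" "b \<ge> 1" "c \<ge> 1" using assms leaves_pos by (auto simp: binary_trees_iff)
  have "tree_equiv k (c + 2) (graft t 2 C) (graft u 2 C)"
    using tree_equiv_graft_left[OF assms(1,4), of 2] by (simp add: add.commute)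
  from tree_equiv_graft_left[OF this assms(3), of 1]
  have "tree_equiv k (b + c + 1) (graft (graft t 2 C) 1 B) (graft (graft u 2 C) 1 B)"
    using pos by (simp add: algebra_simps)
  from tree_equiv_graft_left[OF this assms(2), of 0] show ?thesis
    using pos by (simp add: algebra_simps)
qed

lemma tree_equiv_left_right:
  assumes "ptr (left_tree q) = ptr (right_tree q')"
  shows "tree_equiv (k :: 'k::field itself) 3 (left_tree q) (right_tree q')"
proof -
  have "(delta q, delta q') \<in> orth (quad :: 'k quad_relations)"
    unfolding orth_quad_iff using assms
    by (simp add: delta_def if_distrib[of "\<lambda>x. x * _"] cong: if_cong)
  then have "relator (delta q) (delta q') \<in> op_ideal (orth (quad :: 'k quad_relations)) 3"
    by (simp add: op_ideal_def in_ideal.rel)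
  moreover have "relator (delta q) (delta q') = (delta (left_tree q) - delta (right_tree q') :: _ \<Rightarrow> 'k)"
    by (simp add: relator_def fun_eq_iff sum_apply delta_def if_distrib[of "\<lambda>x. x * _"] cong: if_cong)
  ultimately show ?thesis by (simp add: tree_equiv_def left_tree_binary right_tree_binary)
qed

text \<open>Any label of \<open>(xy)z\<close> can be matched by one of \<open>x(yz)\<close>, because trees of both shapes can point to
  all three leaves. So all rotations are possible modulo the ideal.\<close>

lemma ex_right_tree: "\<exists>q'. ptr (left_tree q) = ptr (right_tree q')"
proof -
  have "\<exists>c d. left_ptr (a, b) = right_ptr (c, d)" for a b
    by (cases a; cases b) (metis left_ptr_simps right_ptr_simps)+
  then obtain c d c' d' where "left_ptr (fst (fst q), fst (snd q)) = right_ptr (c, d)"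
    "left_ptr (snd (fst q), snd (snd q)) = right_ptr (c', d')" by blast
  then have "ptr (left_tree q) = ptr (right_tree ((c, c'), (d, d')))"
    using ptr_left_tree[of "fst (fst q)" "snd (fst q)" "fst (snd q)" "snd (snd q)"]
    by (simp add: ptr_right_tree)
  then show ?thesis by blast
qed

lemma ex_left_tree: "\<exists>q. ptr (left_tree q) = ptr (right_tree q')"
proof -
  have "\<exists>c d. left_ptr (c, d) = right_ptr (a, b)" for a b
    by (cases a; cases b) (metis left_ptr_simps right_ptr_simps)+
  then obtain c d c' d' where "left_ptr (c, d) = right_ptr (fst (fst q'), fst (snd q'))"
    "left_ptr (c', d') = right_ptr (snd (fst q'), snd (snd q'))" by blast
  then have "ptr (left_tree ((c, c'), (d, d'))) = ptr (right_tree q')"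
    using ptr_right_tree[of "fst (fst q')" "snd (fst q')" "fst (snd q')" "snd (snd q')"]
    by (simp add: ptr_left_tree)
  then show ?thesis by blast
qed

text \<open>Two labellings of \<open>x(yz)\<close> with the same pointers are compared through a labelling of \<open>(xy)z\<close>.\<close>

lemma tree_equiv_right_right:
  assumes "ptr (right_tree q) = ptr (right_tree q')"
  shows "tree_equiv k 3 (right_tree q) (right_tree q')"
proof -
  obtain p where "ptr (left_tree p) = ptr (right_tree q)" using ex_left_tree by blast
  then show ?thesis using assms tree_equiv_trans tree_equiv_sym tree_equiv_left_right by metis
qed

text \<open>
  The representatives of the pointers. A coordinate of the pointer runs up the comb until it turns
  left at the first \<open>Prec\<close>; later labels have no influence and are chosen to be \<open>Prec\<close>. The
  pointer 0, which arises by truncated subtraction behind that vertex, has the same effect as 1.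
\<close>

fun right_comb :: "nat \<Rightarrow> nat \<times> nat \<Rightarrow> quad_op ptree" where
  "right_comb 0 p = Leaf"
| "right_comb (Suc k) p =
    Node (if fst p \<le> 1 then Prec else Succ, if snd p \<le> 1 then Prec else Succ)
      [Leaf, right_comb k (fst p - 1, snd p - 1)]"

lemma right_comb_binary: "right_comb k p \<in> binary_trees (Suc k)"
  by (induction k p rule: right_comb.induct) (auto simp: binary_trees_iff)

lemma leaves_right_comb [simp]: "leaves (right_comb k p) = Suc k"
  using right_comb_binary[of k p] by (simp add: binary_trees_iff)

lemma ptr_right_comb:
  "fst p \<le> Suc k \<Longrightarrow> snd p \<le> Suc k \<Longrightarrow> ptr (right_comb k p) = (max 1 (fst p), max 1 (snd p))"
  by (induction k p rule: right_comb.induct) (auto simp: ptr_Node max_def)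

lemma right_comb_max: "right_comb k (max 1 i, max 1 j) = right_comb k (i, j)"
  by (cases k) (auto simp: max_def)

definition normalizes :: "'k::field itself \<Rightarrow> quad_op ptree \<Rightarrow> bool" where
  "normalizes k t \<longleftrightarrow> tree_equiv k (leaves t) t (right_comb (leaves t - 1) (ptr t))"

lemma normalizes_equiv:
  assumes "tree_equiv k n t u" "normalizes k u"
  shows "normalizes k t"
proof -
  have "leaves t = n" "leaves u = n" using assms(1) by (auto simp: tree_equiv_def binary_trees_iff)
  then show ?thesis using assms tree_equiv_ptr[OF assms(1)] tree_equiv_trans
    unfolding normalizes_def by metis
qed

text \<open>Adding a vertex below a normalized comb leaves a comb with possibly wrong labels behind the new
  vertex: where this has the label \<open>Prec\<close>, the later labels have to be changed to \<open>Prec\<close> as well.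
  This is done one vertex after the other, from the root upwards.\<close>

lemma normalizes_Node_Leaf_comb:
  assumes "fst p \<le> Suc k" "snd p \<le> Suc k"
  shows "normalizes K (Node c [Leaf, right_comb k p])"
  using assms
proof (induction k arbitrary: c p)
  case 0
  have "Node c [Leaf, Leaf] = right_comb 1 (ptr (Node c [Leaf, Leaf]))"
    by (cases c; cases "fst c"; cases "snd c") (simp_all add: ptr_Node)
  then show ?case using tree_equiv_refl[of "Node c [Leaf, Leaf]" 2 K]
    by (simp add: normalizes_def binary_trees_iff numeral_2_eq_2)
next
  case (Suc k)
  obtain d where d: "right_comb (Suc k) p = Node d [Leaf, right_comb k (fst p - 1, snd p - 1)]" by simp
  let ?X = "right_comb k (fst p - 1, snd p - 1)"
  \<comment> \<open>Where the lower vertex turns left, the label above it is irrelevant in arity 3.\<close>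
  define d' where "d' = (if fst c = Prec then Prec else fst d, if snd c = Prec then Prec else snd d)"
  have "ptr (right_tree (c, d)) = ptr (right_tree (c, d'))"
    by (cases c; cases d) (auto simp: ptr_right_tree d'_def right_ptr_simps
        intro!: arg_cong[where f = right_ptr])
  from tree_equiv_graft_three[OF tree_equiv_right_right[OF this, of K], of Leaf 1 Leaf 1 ?X "Suc k"]
  have e1: "tree_equiv K (k + 3) (Node c [Leaf, Node d [Leaf, ?X]]) (Node c [Leaf, Node d' [Leaf, ?X]])"
    by (simp add: right_tree_def binary_trees_iff right_comb_binary[unfolded binary_trees_iff] numeral_3_eq_3)
  let ?Y = "Node d' [Leaf, ?X]"
  let ?p = "ptr ?Y"
  have "normalizes K ?Y" using Suc by auto
  then have "tree_equiv K (k + 2) ?Y (right_comb (Suc k) ?p)"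
    by (simp add: normalizes_def)
  from tree_equiv_Node_right[OF this, of Leaf 1 c]
  have e2: "tree_equiv K (k + 3) (Node c [Leaf, ?Y]) (Node c [Leaf, right_comb (Suc k) ?p])"
    by (simp add: binary_trees_iff numeral_3_eq_3 del: right_comb.simps)
  let ?q = "ptr (Node c [Leaf, ?Y])"
  have X: "ptr ?X = (max 1 (fst p - 1), max 1 (snd p - 1))"
    using Suc.prems by (simp add: ptr_right_comb)
  have "(max 1 (fst ?q - 1), max 1 (snd ?q - 1)) = ?p"
    by (simp add: ptr_Node d'_def X)
  then have "right_comb (Suc k) ?p = right_comb (Suc k) (fst ?q - 1, snd ?q - 1)"
    using right_comb_max by metis
  moreover have "c = (if fst ?q \<le> 1 then Prec else Succ, if snd ?q \<le> 1 then Prec else Succ)"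
    by (cases c; cases "fst c"; cases "snd c") (simp_all add: ptr_Node X)
  ultimately have "Node c [Leaf, right_comb (Suc k) ?p] = right_comb (Suc (Suc k)) ?q"
    by (metis right_comb.simps(2))
  then have "normalizes K (Node c [Leaf, ?Y])"
    using e2 unfolding normalizes_def by (simp add: eval_nat_numeral)
  from normalizes_equiv[OF e1 this] show ?case unfolding d .
qed

text \<open>Rotation at the root shortens the comb on the left by one vertex.\<close>

lemma normalizes_Node_combs:
  assumes "fst q \<le> Suc m" "snd q \<le> Suc m"
  shows "normalizes K (Node c [right_comb k p, right_comb m q])"
proof (induction k arbitrary: c p)
  case 0
  show ?case using normalizes_Node_Leaf_comb[OF assms, of K c] by simp
next
  case (Suc k)
  obtain d where d: "right_comb (Suc k) p = Node d [Leaf, right_comb k (fst p - 1, snd p - 1)]" by simp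
  let ?X = "right_comb k (fst p - 1, snd p - 1)" and ?Y = "right_comb m q"
  obtain c' d' where cd: "ptr (left_tree (d, c)) = ptr (right_tree (c', d'))"
    using ex_right_tree by (metis surj_pair)
  from tree_equiv_graft_three[OF tree_equiv_left_right[OF cd, of K], of Leaf 1 ?X "Suc k" ?Y "Suc m"]
  have "tree_equiv K (1 + Suc k + Suc m)
      (graft (graft (graft (left_tree (d, c)) 2 ?Y) 1 ?X) 0 Leaf)
      (graft (graft (graft (right_tree (c', d')) 2 ?Y) 1 ?X) 0 Leaf)"
    using right_comb_binary by (simp add: binary_trees_iff)
  moreover have "1 + Suc k + Suc m = k + m + 3" by simp
  moreover have "graft (graft (graft (left_tree (d, c)) 2 ?Y) 1 ?X) 0 Leaf = Node c [Node d [Leaf, ?X], ?Y]"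
    "graft (graft (graft (right_tree (c', d')) 2 ?Y) 1 ?X) 0 Leaf = Node c' [Leaf, Node d' [?X, ?Y]]"
    by (simp_all add: left_tree_def right_tree_def)
  ultimately have e1: "tree_equiv K (k + m + 3) (Node c [Node d [Leaf, ?X], ?Y]) (Node c' [Leaf, Node d' [?X, ?Y]])"
    by (simp only:)
  let ?Z = "Node d' [?X, ?Y]"
  have "tree_equiv K (k + m + 2) ?Z (right_comb (k + m + 1) (ptr ?Z))"
    using Suc.IH by (simp add: normalizes_def)
  from tree_equiv_Node_right[OF this, of Leaf 1 c']
  have e2: "tree_equiv K (k + m + 3) (Node c' [Leaf, ?Z]) (Node c' [Leaf, right_comb (k + m + 1) (ptr ?Z)])"
    by (simp add: binary_trees_iff numeral_3_eq_3 del: right_comb.simps)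
  have "?Z \<in> binary_trees (k + m + 2)"
    using right_comb_binary by (simp add: binary_trees_iff)
  then have "fst (ptr ?Z) \<le> Suc (k + m + 1)" "snd (ptr ?Z) \<le> Suc (k + m + 1)"
    using ptr_range[of ?Z] by (auto simp: mem_Times_iff)
  from normalizes_Node_Leaf_comb[OF this, of K c'] show ?case
    unfolding d using normalizes_equiv e1 e2 by blast
qed

lemma normalizes: "binary t \<Longrightarrow> normalizes K t"
proof (induction rule: binary_induct)
  case Leaf
  then show ?case using tree_equiv_refl[of Leaf 1 K] by (simp add: normalizes_def binary_trees_iff)
next
  case (Node c l r)
  let ?l = "right_comb (leaves l - 1) (ptr l)" and ?r = "right_comb (leaves r - 1) (ptr r)"
  have b: "l \<in> binary_trees (leaves l)" "r \<in> binary_trees (leaves r)"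
    using Node.hyps by (simp_all add: binary_trees_iff)
  have "?l \<in> binary_trees (leaves l)"
    using right_comb_binary[of "leaves l - 1"] leaves_pos[OF Node.hyps(1)] by simp
  then have "tree_equiv K (leaves l + leaves r) (Node c [?l, r]) (Node c [?l, ?r])"
    using tree_equiv_Node_right Node.IH(2) unfolding normalizes_def by blast
  moreover have "tree_equiv K (leaves l + leaves r) (Node c [l, r]) (Node c [?l, r])"
    using tree_equiv_Node_left Node.IH(1) b(2) unfolding normalizes_def by blast
  moreover have "normalizes K (Node c [?l, ?r])"
    using ptr_range[OF b(2)] by (intro normalizes_Node_combs) (auto simp: mem_Times_iff)
  ultimately show ?case using normalizes_equiv by blast
qed

text \<open>
  Each tree may be replaced by the right comb with the same pointers modulo the ideal. After this
  the coefficients are sums over the trees with given pointers, hence zero if all pointer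
  weights vanish.
\<close>

theorem op_ideal_orth_quad:
  "x \<in> dual_ideal n \<longleftrightarrow>
    x \<in> free_operad n \<and> (\<forall>w. weight n (\<lambda>t. w (ptr t)) (x :: _ \<Rightarrow> 'k::field) = 0)"
proof (intro iffI conjI allI)
  assume "x \<in> dual_ideal n"
  then show "x \<in> free_operad n" "weight n (\<lambda>t. w (ptr t)) x = 0" for w
    by (simp_all add: op_ideal_free ptr_weight_vanishes op_ideal_def)
next
  assume *: "x \<in> free_operad n \<and> (\<forall>w. weight n (\<lambda>t. w (ptr t)) x = 0)"
  let ?c = "\<lambda>t. right_comb (n - 1) (ptr t)"
  have "delta t - delta (?c t) \<in> op_ideal (orth (quad :: 'k quad_relations)) n"
    if "t \<in> binary_trees n" for t
    using normalizes[of t "TYPE('k)"] that by (simp add: normalizes_def tree_equiv_def binary_trees_iff)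
  then have "(\<Sum>t\<in>binary_trees n. fscale (x t) (delta t - delta (?c t))) \<in> dual_ideal n"
    by (intro fun_vs.subspace_sum fun_vs.subspace_scale subspace_op_ideal)
  moreover have "(\<Sum>t\<in>binary_trees n. fscale (x t) (delta t - delta (?c t))) = x"
  proof
    fix u
    have "(\<Sum>t\<in>binary_trees n. x t * delta (?c t) u) = weight n (\<lambda>t. (\<lambda>p. delta (right_comb (n - 1) p) u) (ptr t)) x"
      by (simp add: weight_def mult.commute)
    also have "\<dots> = 0"
      by (rule conjunct2[OF *, THEN spec, of "\<lambda>p. delta (right_comb (n - 1) p) u"])
    finally have "(\<Sum>t\<in>binary_trees n. x t * delta (?c t) u) = 0" .
    moreover have "(\<Sum>t\<in>binary_trees n. fscale (x t) (delta t)) u = x u"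
      using sum_delta_expansion[of x "binary_trees n"] * by simp
    ultimately show "(\<Sum>t\<in>binary_trees n. fscale (x t) (delta t - delta (?c t))) u = x u"
      by (simp add: sum_apply right_diff_distrib sum_subtractf)
  qed
  ultimately show "x \<in> dual_ideal n" by simp
qed

section \<open>Coordinates on the quadratic dual\<close>

text \<open>
  Bases of spaces of functionals, and of tensor products of them, are recognized by evaluation at a
  dual family of points.
\<close>

lemma dual_family:
  fixes e :: "'i \<Rightarrow> 'a \<Rightarrow> 'k::field"
  assumes "finite J" and d: "\<And>i j. i \<in> J \<Longrightarrow> j \<in> J \<Longrightarrow> e i (d j) = of_bool (j = i)"
  shows "inj_on e J" and "fun_vs.independent (e ` J)"
    and "fun_vs.span (e ` J) = {\<Sum>j\<in>J. fscale (c j) (e j) | c. True}"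
    and "i \<in> J \<Longrightarrow> fun_vs.representation (e ` J) (\<Sum>j\<in>J. fscale (c j) (e j)) (e i) = c i"
proof -
  show inj: "inj_on e J"
  proof (rule inj_onI)
    fix i j assume ij: "i \<in> J" "j \<in> J" "e i = e j"
    then have "e i (d j) = 1" using d[of j j] by simp
    then show "i = j" using d[of i j] ij by (cases "i = j") auto
  qed
  have val: "(\<Sum>j\<in>J. fscale (c j) (e j)) (d i) = c i" if "i \<in> J" for c i
  proof -
    have "(\<Sum>j\<in>J. fscale (c j) (e j)) (d i) = (\<Sum>j\<in>J. if j = i then c i else 0)"
      unfolding sum_apply using d that by (intro sum.cong) auto
    then show ?thesis using that assms(1) by simp
  qed
  have reindex: "(\<Sum>v\<in>e ` J. fscale (f v) v) = (\<Sum>j\<in>J. fscale (f (e j)) (e j))" for f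
    by (simp add: sum.reindex[OF inj])
  show ind: "fun_vs.independent (e ` J)"
  proof (rule fun_vs.independent_if_scalars_zero)
    fix f v assume f: "(\<Sum>x\<in>e ` J. fscale (f x) x) = 0" and "v \<in> e ` J"
    then obtain i where i: "i \<in> J" "v = e i" by blast
    then show "f v = 0" using val[OF i(1), of "\<lambda>j. f (e j)"] f unfolding reindex by simp
  qed (simp add: assms(1))
  show span: "fun_vs.span (e ` J) = {\<Sum>j\<in>J. fscale (c j) (e j) | c. True}"
  proof (intro equalityI subsetI)
    fix x assume "x \<in> fun_vs.span (e ` J)"
    then show "x \<in> {\<Sum>j\<in>J. fscale (c j) (e j) | c. True}"
      using fun_vs.span_finite[of "e ` J"] assms(1) reindex by auto
  next
    fix x assume "x \<in> {\<Sum>j\<in>J. fscale (c j) (e j) | c. True}"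
    then show "x \<in> fun_vs.span (e ` J)"
      using fun_vs.span_sum[of J "\<lambda>j. fscale (_ j) (e j)" "e ` J"]
        fun_vs.span_scale[OF fun_vs.span_base, of "e _" "e ` J"] by blast
  qed
  show "fun_vs.representation (e ` J) (\<Sum>j\<in>J. fscale (c j) (e j)) (e i) = c i" if i: "i \<in> J"
  proof -
    let ?x = "\<Sum>j\<in>J. fscale (c j) (e j)" and ?r = "fun_vs.representation (e ` J)"
    have "?x \<in> fun_vs.span (e ` J)" unfolding span by blast
    from fun_vs.sum_representation_eq[OF ind this _ subset_refl]
    have "(\<Sum>v\<in>e ` J. fscale (?r ?x v) v) = ?x" using assms(1) by simp
    then have "(\<Sum>j\<in>J. fscale (?r ?x (e j)) (e j)) = ?x" unfolding reindex .
    then show ?thesis using val[OF i, of "\<lambda>j. ?r ?x (e j)"] val[OF i, of c] by simp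
  qed
qed

abbreviation square :: "nat \<Rightarrow> (nat \<times> nat) set" where
  "square l \<equiv> {1..l} \<times> {1..l}"

text \<open>The sum of the coefficients of the trees with pointers \<open>p\<close>, for any representative of the class;
  all representatives give the same value. The value 0 off the carrier is the convention for dual
  spaces.\<close>

definition coord :: "nat \<Rightarrow> nat \<times> nat \<Rightarrow> ('k::field) quad_class \<Rightarrow> 'k" where
  "coord l p A =
    (if A \<in> car (dual_operad l) then weight l (\<lambda>t. of_bool (ptr t = p)) (SOME x. x \<in> A) else 0)"

definition base_class :: "nat \<Rightarrow> nat \<times> nat \<Rightarrow> ('k::field) quad_class" where
  "base_class l p = cls (dual_ideal l) (delta (right_comb (l - 1) p))"

lemma coord_outside: "A \<notin> car (dual_operad l) \<Longrightarrow> coord l p A = 0"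
  by (simp add: coord_def)

lemma coord_cls:
  assumes "x \<in> free_operad l"
  shows "coord l p (cls (dual_ideal l) x) = weight l (\<lambda>t. of_bool (ptr t = p)) (x :: _ \<Rightarrow> 'k::field)"
proof -
  let ?A = "cls (dual_ideal l) x"
  have "(SOME y. y \<in> ?A) \<in> ?A" by (rule someI[of "\<lambda>y. y \<in> ?A" x]) (rule cls_self[OF subspace_op_ideal])
  then have "(SOME y. y \<in> ?A) - x \<in> dual_ideal l" by (simp add: cls_def)
  then have "weight l (\<lambda>t. of_bool (ptr t = p)) ((SOME y. y \<in> ?A) - x) = 0"
    using op_ideal_orth_quad[THEN iffD1, THEN conjunct2, THEN spec, of _ l "\<lambda>q. of_bool (q = p)"] by blast
  moreover have "?A \<in> car (dual_operad l)" using assms by (simp add: car_operad)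
  ultimately show ?thesis by (simp add: coord_def weight_diff)
qed

lemma coord_out_of_square:
  fixes A :: "('k::field) quad_class"
  assumes "p \<notin> square l"
  shows "coord l p A = 0"
proof -
  have "weight l (\<lambda>t. of_bool (ptr t = p)) x = 0" for x :: "_ \<Rightarrow> 'k"
    unfolding weight_def using ptr_range assms by (intro sum.neutral) fastforce
  then show ?thesis by (simp add: coord_def)
qed

text \<open>Sums over pointers are the most convenient way to use coordinates: they reduce to sums over
  the trees of a representative.\<close>

lemma weight_coord:
  assumes "x \<in> free_operad l"
  shows "(\<Sum>p\<in>square l. coord l p (cls (dual_ideal l) x) * w p) =
    weight l (\<lambda>t. w (ptr t)) (x :: _ \<Rightarrow> 'k::field)"
proof -
  have "(\<Sum>p\<in>square l. coord l p (cls (dual_ideal l) x) * w p) =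
      (\<Sum>t\<in>binary_trees l. \<Sum>p\<in>square l. if p = ptr t then x t * w p else 0)"
    unfolding coord_cls[OF assms] weight_def sum_distrib_right
    by (subst sum.swap) (intro sum.cong refl, auto)
  also have "\<dots> = (\<Sum>t\<in>binary_trees l. w (ptr t) * x t)"
    by (intro sum.cong refl) (use ptr_range in \<open>simp add: mult.commute\<close>)
  finally show ?thesis by (simp add: weight_def)
qed

lemma cls_eqI:
  assumes "x \<in> free_operad l" "y \<in> free_operad l"
    and "\<And>p. p \<in> square l \<Longrightarrow> coord l p (cls (dual_ideal l) x) =
      (coord l p (cls (dual_ideal l) y) :: 'k::field)"
  shows "cls (dual_ideal l) x = cls (dual_ideal l) y"
proof -
  have "weight l (\<lambda>t. w (ptr t)) (x - y) = 0" for w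
    unfolding weight_diff weight_coord[OF assms(1), symmetric] weight_coord[OF assms(2), symmetric]
    by (simp add: assms(3))
  then show ?thesis
    unfolding cls_eq_iff[OF subspace_op_ideal] op_ideal_orth_quad
    using assms(1,2) supported_on_diff by blast
qed

lemma right_comb_pred: "l \<ge> 1 \<Longrightarrow> right_comb (l - 1) p \<in> binary_trees l"
  using right_comb_binary[of "l - 1" p] by simp

lemma ptr_right_comb_pred:
  assumes "p \<in> square l"
  shows "ptr (right_comb (l - 1) p) = p"
  using assms by (cases p) (subst ptr_right_comb, auto simp: max_def)

lemma coord_base_class:
  "l \<ge> 1 \<Longrightarrow> p \<in> square l \<Longrightarrow> coord l q (base_class l p) = of_bool (p = q)"
  unfolding base_class_def
  by (simp add: coord_cls delta_supported_on right_comb_pred[simplified] weight_delta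
      ptr_right_comb_pred[simplified])

text \<open>In coordinates, partial composition is the linear extension of the composition of pointers.
  The arbitrary weights \<open>w\<close> allow the lemma to be applied inside of larger sums over labels.\<close>

lemma coord_op_comp:
  assumes "A \<in> car (dual_operad m)" "B \<in> car (dual_operad n)" "i < m"
  shows "(\<Sum>p\<in>square (m + n - 1). coord (m + n - 1) p (op_comp (orth quad) m i n A B) * w p) =
    (\<Sum>a\<in>square m. \<Sum>b\<in>square n. coord m a A * coord n b B * w (quad_comp i n a b) :: 'k::field)"
proof -
  obtain x y where x: "x \<in> free_operad m" and y: "y \<in> free_operad n"
    and AB: "A = cls (dual_ideal m) x" "B = cls (dual_ideal n) y"
    using assms(1,2) unfolding car_operad by blast
  have "(\<Sum>p\<in>square (m + n - 1). coord (m + n - 1) p (op_comp (orth quad) m i n A B) * w p) =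
      (\<Sum>t\<in>binary_trees m. \<Sum>s\<in>binary_trees n. x t * y s * w (ptr (graft t i s)))"
    unfolding AB op_comp_cls[OF x y assms(3)] weight_coord[OF free_comp_in_free_operad[OF x y assms(3)]]
    by (rule weight_free_comp[OF x y assms(3)])
  also have "\<dots> = (\<Sum>t\<in>binary_trees m. (\<Sum>s\<in>binary_trees n. w (quad_comp i n (ptr t) (ptr s)) * y s) * x t)"
    unfolding sum_distrib_right
    by (intro sum.cong refl) (simp add: ptr_graft assms(3) mult.commute mult.left_commute)
  also have "\<dots> = weight m (\<lambda>t. (\<lambda>a. weight n (\<lambda>s. w (quad_comp i n a (ptr s))) y) (ptr t)) x"
    by (simp add: weight_def)
  also have "\<dots> = (\<Sum>a\<in>square m. coord m a A * weight n (\<lambda>s. w (quad_comp i n a (ptr s))) y)"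
    unfolding AB by (rule weight_coord[OF x, symmetric])
  also have "\<dots> = (\<Sum>a\<in>square m. coord m a A * (\<Sum>b\<in>square n. coord n b B * w (quad_comp i n a b)))"
    unfolding AB by (simp only: weight_coord[OF y, of "\<lambda>b. w (quad_comp i n _ b)"])
  finally show ?thesis by (simp add: sum_distrib_left mult.assoc)
qed

lemma coord_linear: "linear_map (dual_operad l) scalars (coord l p)"
  unfolding linear_map_def
proof (intro conjI ballI allI)
  fix A B :: "('k::field) quad_class" and c :: 'k
  assume "A \<in> car (dual_operad l)"
  then obtain x where x: "x \<in> free_operad l" "A = cls (dual_ideal l) x"
    unfolding car_operad by blast
  show "coord l p A \<in> car scalars" by (simp add: scalars_def)
  show "coord l p (vscale (dual_operad l) c A) = vscale scalars c (coord l p A)"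
    unfolding x(2) vscale_operad
    by (simp add: coord_cls x(1) supported_on_scale weight_scale scalars_def)
  assume "B \<in> car (dual_operad l)"
  then obtain y where y: "y \<in> free_operad l" "B = cls (dual_ideal l) y"
    unfolding car_operad by blast
  show "coord l p (vadd (dual_operad l) A B) = vadd scalars (coord l p A) (coord l p B)"
    unfolding x(2) y(2) vadd_operad
    by (simp add: coord_cls x(1) y(1) supported_on_add weight_add scalars_def)
qed

lemma coord_in_dual: "coord l p \<in> dual (dual_operad l)"
  by (simp add: dual_def coord_linear supported_on_def coord_outside)

lemma linear_map_cls_sum:
  fixes \<phi> :: "('g::finite, 'k::field) op_class \<Rightarrow> 'k"
  assumes "linear_map (operad \<Lambda> l) scalars \<phi>" "finite S" "\<And>a. a \<in> S \<Longrightarrow> x a \<in> free_operad l"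
  shows "\<phi> (cls (op_ideal \<Lambda> l) (\<Sum>a\<in>S. fscale (c a) (x a))) = (\<Sum>a\<in>S. c a * \<phi> (cls (op_ideal \<Lambda> l) (x a)))"
  using assms(2,3)
proof (induction S)
  case empty
  have z: "(0 :: 'g ptree \<Rightarrow> 'k) \<in> free_operad l" by (simp add: supported_on_def)
  \<comment> \<open>The value at the zero class is 0 by homogeneity.\<close>
  have "\<phi> (cls (op_ideal \<Lambda> l) (fscale 0 0)) = 0 * \<phi> (cls (op_ideal \<Lambda> l) 0)"
    using assms(1) z unfolding linear_map_def vscale_operad[symmetric] car_operad
    by (auto simp: scalars_def)
  moreover have "fscale 0 0 = (0 :: 'g ptree \<Rightarrow> 'k)" by (simp add: fun_eq_iff)
  ultimately show ?case by (simp only: sum.empty mult_zero_left)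
next
  case (insert a S)
  have f: "fscale (c a) (x a) \<in> free_operad l" "(\<Sum>a\<in>S. fscale (c a) (x a)) \<in> free_operad l"
    using insert.prems by (auto intro!: supported_on_scale supported_on_sum)
  have add: "\<phi> (cls (op_ideal \<Lambda> l) (u + v)) = \<phi> (cls (op_ideal \<Lambda> l) u) + \<phi> (cls (op_ideal \<Lambda> l) v)"
    and scale: "\<phi> (cls (op_ideal \<Lambda> l) (fscale d u)) = d * \<phi> (cls (op_ideal \<Lambda> l) u)"
    if "u \<in> free_operad l" "v \<in> free_operad l" for u v d
    using assms(1) that unfolding linear_map_def car_operad
    by (auto simp: scalars_def vadd_operad[symmetric] vscale_operad[symmetric])
  have IH: "\<phi> (cls (op_ideal \<Lambda> l) (\<Sum>a\<in>S. fscale (c a) (x a))) =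
      (\<Sum>a\<in>S. c a * \<phi> (cls (op_ideal \<Lambda> l) (x a)))"
    by (rule insert.IH) (rule insert.prems, simp)
  have xa: "x a \<in> free_operad l" by (rule insert.prems) simp
  have "\<phi> (cls (op_ideal \<Lambda> l) (fscale (c a) (x a) + (\<Sum>a\<in>S. fscale (c a) (x a)))) =
      c a * \<phi> (cls (op_ideal \<Lambda> l) (x a)) + (\<Sum>a\<in>S. c a * \<phi> (cls (op_ideal \<Lambda> l) (x a)))"
    by (simp only: add[OF f] scale[OF xa xa] IH)
  then show ?case unfolding sum.insert[OF insert.hyps] .
qed

lemma cls_expansion:
  assumes "l \<ge> 1" "A \<in> car (operad (orth (quad :: ('k::field) quad_relations)) l)"
  shows "A = cls (dual_ideal l) (\<Sum>p\<in>square l. fscale (coord l p A) (delta (right_comb (l - 1) p)))"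
proof -
  obtain x where x: "x \<in> free_operad l" "A = cls (dual_ideal l) x"
    using assms(2) unfolding car_operad by blast
  have f: "(\<Sum>p\<in>square l. fscale (coord l p A) (delta (right_comb (l - 1) p))) \<in> free_operad l"
    by (intro supported_on_sum supported_on_scale delta_supported_on right_comb_pred assms)
  have "(\<Sum>p\<in>square l. coord l p A * weight l (\<lambda>t. of_bool (ptr t = q)) (delta (right_comb (l - 1) p))) =
     (\<Sum>p\<in>square l. if p = q then coord l q A else 0)" for q
    by (intro sum.cong refl)
      (simp only: weight_delta[OF right_comb_pred[OF assms(1)]] ptr_right_comb_pred, simp)
  then have "coord l q (cls (dual_ideal l) (\<Sum>p\<in>square l. fscale (coord l p A) (delta (right_comb (l - 1) p)))) =
     coord l q A" if "q \<in> square l" for q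
    unfolding coord_cls[OF f] weight_sum weight_scale using that by simp
  then show ?thesis unfolding x(2) using f x by (intro cls_eqI) auto
qed

lemma dual_expansion:
  assumes "l \<ge> 1" "\<phi> \<in> dual (operad (orth (quad :: ('k::field) quad_relations)) l)"
    "A \<in> car (dual_operad l)"
  shows "\<phi> A = (\<Sum>p\<in>square l. coord l p A * \<phi> (base_class l p))"
proof -
  have "linear_map (dual_operad l) scalars \<phi>" using assms(2) by (simp add: dual_def)
  then have "\<phi> (cls (dual_ideal l) (\<Sum>p\<in>square l. fscale (coord l p A) (delta (right_comb (l - 1) p)))) =
      (\<Sum>p\<in>square l. coord l p A * \<phi> (base_class l p))"
    unfolding base_class_def
    by (rule linear_map_cls_sum) (auto intro!: delta_supported_on right_comb_pred assms(1) simp del: One_nat_def)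
  then show ?thesis unfolding cls_expansion[OF assms(1,3), symmetric] .
qed

lemma subspace_dual:
  "fun_vs.subspace (dual (operad (\<Lambda> :: ('g::finite, 'k::field) relations) l))"
proof (rule fun_vs.subspaceI)
  have v: "vadd (operad \<Lambda> l) A B \<in> car (operad \<Lambda> l)" "vscale (operad \<Lambda> l) c A \<in> car (operad \<Lambda> l)"
    if "A \<in> car (operad \<Lambda> l)" "B \<in> car (operad \<Lambda> l)" for A B c
    using that by (auto simp: car_operad vadd_operad vscale_operad intro!: supported_on_add supported_on_scale)
  show "0 \<in> dual (operad \<Lambda> l)" by (simp add: dual_def linear_map_def scalars_def supported_on_def)
  fix x y :: "('g, 'k) op_class \<Rightarrow> 'k" and c
  assume x: "x \<in> dual (operad \<Lambda> l)"
  show "fscale c x \<in> dual (operad \<Lambda> l)" using x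
    by (auto simp: dual_def linear_map_def scalars_def supported_on_def algebra_simps)
  assume y: "y \<in> dual (operad \<Lambda> l)"
  show "x + y \<in> dual (operad \<Lambda> l)" using x y
    by (auto simp: dual_def linear_map_def scalars_def supported_on_def algebra_simps)
qed

theorem is_basis_coord:
  assumes "l \<ge> 1"
  shows "is_basis (dual (operad (orth (quad :: ('k::field) quad_relations)) l)) (square l) (coord l)"
proof -
  note df = dual_family[of "square l" "coord l :: _ \<Rightarrow> 'k quad_class \<Rightarrow> 'k" "base_class l"]
  have d: "coord l i (base_class l j) = (of_bool (j = i) :: 'k)" if "i \<in> square l" "j \<in> square l" for i j
    using assms that(2) by (rule coord_base_class)
  have "\<phi> = (\<Sum>p\<in>square l. fscale (\<phi> (base_class l p)) (coord l p))"
    if "\<phi> \<in> dual (operad (orth (quad :: 'k quad_relations)) l)" for \<phi>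
  proof
    fix A
    show "\<phi> A = (\<Sum>p\<in>square l. fscale (\<phi> (base_class l p)) (coord l p)) A"
    proof (cases "A \<in> car (operad (orth (quad :: 'k quad_relations)) l)")
      case True
      then show ?thesis using dual_expansion[OF assms that] by (simp add: sum_apply mult.commute)
    next
      case False
      then show ?thesis using that by (simp add: sum_apply coord_outside dual_def supported_on_def)
    qed
  qed
  note ex = this
  have "(\<Sum>p\<in>square l. fscale (c p) (coord l p)) \<in>
      fun_vs.span (coord l ` square l :: ('k quad_class \<Rightarrow> 'k) set)" for c
    by (intro fun_vs.span_sum fun_vs.span_scale) (rule fun_vs.span_base, rule imageI)
  then have "dual (operad (orth (quad :: 'k quad_relations)) l) \<subseteq> fun_vs.span (coord l ` square l)"
    by (intro subsetI) (subst ex)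
  moreover have "fun_vs.span (coord l ` square l) \<subseteq> dual (operad (orth (quad :: 'k quad_relations)) l)"
    by (intro fun_vs.span_minimal subspace_dual) (auto simp: coord_in_dual)
  ultimately show ?thesis unfolding is_basis_def using df(1)[OF _ d] df(2)[OF _ d]
    by (simp del: One_nat_def add: subset_antisym)
qed

text \<open>The classes of the right combs form a basis indexed by pairs of pointers; \<open>h\<close> numbers the
  pairs.\<close>

theorem has_dim_quad_dual:
  assumes "n \<ge> 1"
  shows "has_dim (operad (orth (quad :: ('k::field) quad_relations)) n) (n\<^sup>2)"
proof -
  let ?I = "op_ideal (orth (quad :: 'k quad_relations)) n"
  obtain h where h: "bij_betw h {..<n\<^sup>2} (square n)"
    using finite_same_card_bij[of "{..<n\<^sup>2}" "square n"] by (auto simp: power2_eq_square)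
  define y where "y x = (\<Sum>k<n\<^sup>2. fscale (x k) (delta (right_comb (n - 1) (h k))))" for x :: "nat \<Rightarrow> 'k"
  have yf: "y x \<in> free_operad n" for x
    unfolding y_def by (intro supported_on_sum supported_on_scale delta_supported_on right_comb_pred assms)
  have co: "coord n (h j) (cls ?I (y x)) = x j" if "j < n\<^sup>2" for x j
  proof -
    have hk: "h k \<in> square n" if "k < n\<^sup>2" for k
      using h that by (auto simp: bij_betw_def)
    have "coord n (h j) (cls ?I (y x)) =
        (\<Sum>k<n\<^sup>2. x k * weight n (\<lambda>t. of_bool (ptr t = h j)) (delta (right_comb (n - 1) (h k))))"
      unfolding coord_cls[OF yf] by (simp add: y_def weight_sum weight_scale)
    also have "\<dots> = (\<Sum>k<n\<^sup>2. if k = j then x j else 0)"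
    proof (intro sum.cong refl)
      fix k assume k: "k \<in> {..<n\<^sup>2}"
      then have "h k = h j \<longleftrightarrow> k = j" using h that by (auto simp: bij_betw_def inj_on_def)
      then show "x k * weight n (\<lambda>t. of_bool (ptr t = h j)) (delta (right_comb (n - 1) (h k))) =
          (if k = j then x j else 0)"
        using k weight_delta[OF right_comb_pred[OF assms], of "\<lambda>t. of_bool (ptr t = h j)" "h k"]
          ptr_right_comb_pred[OF hk, of k] by auto
    qed
    finally show ?thesis using that by simp
  qed
  show ?thesis unfolding has_dim_def
  proof (intro exI[of _ "\<lambda>x. cls ?I (y x)"] conjI)
    have "y (x + x') = y x + y x'" "y (fscale c x) = fscale c (y x)" for x x' c
      by (simp_all add: y_def fun_eq_iff sum_apply algebra_simps sum.distrib sum_distrib_left)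
    then show "linear_map (fun_space (supported_on {..<n\<^sup>2})) (dual_operad n) (\<lambda>x. cls ?I (y x))"
      using yf by (auto simp: linear_map_def fun_space_def car_operad vadd_operad vscale_operad)
    show "bij_betw (\<lambda>x. cls ?I (y x)) (supported_on {..<n\<^sup>2}) (car (dual_operad n))"
    proof (rule bij_betw_imageI)
      show "inj_on (\<lambda>x. cls ?I (y x)) (supported_on {..<n\<^sup>2})"
      proof (rule inj_onI, rule ext)
        fix x x' j assume "x \<in> supported_on {..<n\<^sup>2}" "x' \<in> supported_on {..<n\<^sup>2}" "cls ?I (y x) = cls ?I (y x')"
        then show "x j = x' j" using co[of j x] co[of j x'] by (cases "j < n\<^sup>2") (auto simp: supported_on_def)
      qed
      show "(\<lambda>x. cls ?I (y x)) ` supported_on {..<n\<^sup>2} = car (dual_operad n)"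
      proof (intro equalityI subsetI)
        fix A assume "A \<in> (\<lambda>x. cls ?I (y x)) ` supported_on {..<n\<^sup>2}"
        then show "A \<in> car (dual_operad n)" using yf by (auto simp: car_operad)
      next
        fix A :: "'k quad_class" assume "A \<in> car (dual_operad n)"
        then obtain z where z: "z \<in> free_operad n" "A = cls ?I z" unfolding car_operad by blast
        define x where "x j = (if j < n\<^sup>2 then coord n (h j) A else 0)" for j
        have "cls ?I (y x) = A" unfolding z(2)
        proof (rule cls_eqI[OF yf z(1)])
          fix p assume "p \<in> square n"
          then obtain j where j: "j < n\<^sup>2" "p = h j" using h by (auto simp: bij_betw_def)
          show "coord n p (cls ?I (y x)) = coord n p (cls ?I z)"
            using co[OF j(1), of x] j by (simp add: x_def z(2))
        qed
        moreover have "x \<in> supported_on {..<n\<^sup>2}" by (simp add: x_def supported_on_def)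
        ultimately show "A \<in> (\<lambda>x. cls ?I (y x)) ` supported_on {..<n\<^sup>2}" by blast
      qed
    qed
  qed
qed

section \<open>Coordinates on the bar complex\<close>

lemma ptree_list_induct [case_names Leaf Node Nil Cons]:
  assumes "P Leaf" and N: "\<And>a ts. Q ts \<Longrightarrow> P (Node a ts)"
    and "Q []" and C: "\<And>t ts. P t \<Longrightarrow> Q ts \<Longrightarrow> Q (t # ts)"
  shows "P t" and "Q ts"
proof -
  show P: "P t" for t
  proof (induction t)
    case (Node a ts)
    have "Q us" if "set us \<subseteq> set ts" for us
      using that by (induction us) (auto intro: assms(3) C Node.IH)
    then show ?case by (blast intro: N)
  qed (rule assms(1))
  show "Q ts" by (induction ts) (auto intro: assms(3) C P)
qed

text \<open>If \<open>c\<close> is a function on trees labelled by pairs of pointers, \<open>expand D c\<close> is the value at \<open>D\<close> of its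
  multilinear extension to trees labelled by classes: each label is expanded in its coordinates.
  The extension is defined vertex by vertex, passing to the lists of subtrees through
  functions of the remaining labels.\<close>

fun expand :: "('k::field) quad_class ptree \<Rightarrow> ((nat \<times> nat) ptree \<Rightarrow> 'k) \<Rightarrow> 'k"
  and expand_list :: "('k::field) quad_class ptree list \<Rightarrow> ((nat \<times> nat) ptree list \<Rightarrow> 'k) \<Rightarrow> 'k" where
  "expand Leaf c = c Leaf"
| "expand (Node A ts) c =
    (\<Sum>p\<in>square (length ts). coord (length ts) p A * expand_list ts (\<lambda>us. c (Node p us)))"
| "expand_list [] c = c []"
| "expand_list (t # ts) c = expand t (\<lambda>u. expand_list ts (\<lambda>us. c (u # us)))"

lemma expand_sum:
  "expand D (\<lambda>T. \<Sum>i\<in>I. f i T) = (\<Sum>i\<in>I. expand D (f i))"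
  and expand_list_sum: "expand_list Ds (\<lambda>Ts. \<Sum>i\<in>I. g i Ts) = (\<Sum>i\<in>I. expand_list Ds (g i))"
  for D :: "('k::field) quad_class ptree" and Ds :: "'k quad_class ptree list"
proof (induction D and Ds arbitrary: f and g rule: ptree_list_induct)
  case (Node A ts f)
  then show ?case by (simp add: sum_distrib_left sum.swap[of _ I])
qed simp_all

lemma expand_scale:
  "expand D (\<lambda>T. a * c T) = a * expand D c"
  and expand_list_scale: "expand_list Ds (\<lambda>Ts. a * cs Ts) = a * expand_list Ds cs"
  for D :: "('k::field) quad_class ptree" and Ds :: "'k quad_class ptree list"
proof (induction D and Ds arbitrary: c and cs rule: ptree_list_induct)
  case (Node A ts c)
  then show ?case by (simp add: sum_distrib_left algebra_simps)
qed simp_all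

lemma expand_zero [simp]: "expand D (\<lambda>_. 0) = 0" "expand_list Ds (\<lambda>_. 0) = 0"
  using expand_scale[of D 0 "\<lambda>_. 0"] expand_list_scale[of Ds 0 "\<lambda>_. 0"] by simp_all

abbreviation wf_tree :: "'a ptree \<Rightarrow> bool" where
  "wf_tree \<equiv> labelled_in (\<lambda>_. UNIV)"

abbreviation pair_labelled :: "(nat \<times> nat) ptree \<Rightarrow> bool" where
  "pair_labelled \<equiv> labelled_in square"

text \<open>Only the trees of the shape of \<open>D\<close> with labels in range matter. The labelling condition is
  available only if all arities are at least 2, as \<open>labelled_in\<close> requires this.\<close>

lemma expand_cong:
  "(\<And>T. shape T = shape D \<Longrightarrow> (wf_tree D \<Longrightarrow> pair_labelled T) \<Longrightarrow> c T = c' T) \<Longrightarrow>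
    expand D c = expand D c'"
  and expand_list_cong:
  "(\<And>Ts. map shape Ts = map shape Ds \<Longrightarrow> (\<forall>D\<in>set Ds. wf_tree D \<Longrightarrow> \<forall>T\<in>set Ts. pair_labelled T) \<Longrightarrow>
      cs Ts = cs' Ts) \<Longrightarrow>
    expand_list Ds cs = expand_list Ds cs'"
  for D :: "('k::field) quad_class ptree" and Ds :: "'k quad_class ptree list"
proof (induction D and Ds arbitrary: c c' and cs cs' rule: ptree_list_induct)
  case (Node A ts c c')
  show ?case unfolding expand.simps
  proof (intro sum.cong refl arg_cong2[where f = "(*)"] Node.IH)
    fix p us assume p: "p \<in> square (length ts)" and us: "map shape us = map shape ts"
      and l: "(\<forall>D\<in>set ts. wf_tree D \<Longrightarrow> \<forall>T\<in>set us. pair_labelled T)"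
    have "length us = length ts" using us by (metis length_map)
    with p us l show "c (Node p us) = c' (Node p us)"
      by (intro Node.prems) auto
  qed
next
  case (Cons t ts cs cs')
  show ?case unfolding expand_list.simps
  proof (intro Cons.IH)
    fix u us assume "shape u = shape t" "map shape us = map shape ts"
      "wf_tree t \<Longrightarrow> pair_labelled u" "\<forall>D\<in>set ts. wf_tree D \<Longrightarrow> \<forall>T\<in>set us. pair_labelled T"
    then show "cs (u # us) = cs' (u # us)" by (intro Cons.prems) auto
  qed
qed simp_all

lemma expand_list_length_cong:
  "(\<And>Ts. length Ts = length Ds \<Longrightarrow> cs Ts = cs' Ts) \<Longrightarrow> expand_list Ds cs = expand_list Ds cs'"
  by (intro expand_list_cong) (metis length_map)

lemma expand_list_append:
  "expand_list (xs @ ys) c = expand_list xs (\<lambda>us. expand_list ys (\<lambda>vs. c (us @ vs)))"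
  by (induction xs arbitrary: c) simp_all

lemma tree_tensor_shape: "shape F \<noteq> shape D \<Longrightarrow> tree_tensor F D = 0"
  and tree_tensor_list_shape: "map shape Fs \<noteq> map shape Ds \<Longrightarrow> tree_tensor_list Fs Ds = 0"
  for F :: "('x \<Rightarrow> 'k::field) ptree" and Fs :: "('x \<Rightarrow> 'k::field) ptree list"
    and D :: "'x ptree" and Ds :: "'x ptree list"
  by (induction F D and Fs Ds rule: tree_tensor_tree_tensor_list.induct) auto

lemma shape_map_arity [simp]: "shape (map_arity h T) = shape T"
  by (induction T) auto

lemma leaves_map_arity [simp]: "leaves (map_arity h T) = leaves T"
  using leaves_shape[of "map_arity h T"] by (simp del: leaves_shape) simp

lemma deg_map_arity [simp]: "deg (map_arity h T) = deg T"
  using deg_shape[of "map_arity h T"] by (simp del: deg_shape) simp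

text \<open>The induced basis elements are the extensions of the indicator functions of trees.\<close>

lemma expand_induced_basis:
  "expand D (\<lambda>T'. of_bool (T' = T)) = induced_basis coord T D"
  and "expand_list Ds (\<lambda>Ts'. of_bool (Ts' = Ts)) = tree_tensor_list (map (map_arity coord) Ts) Ds"
  for D :: "('k::field) quad_class ptree" and Ds :: "'k quad_class ptree list"
proof (induction D and Ds arbitrary: T and Ts rule: ptree_list_induct)
  case Leaf
  show ?case by (cases T) (simp_all add: induced_basis_def)
next
  case (Node A ts T)
  show ?case
  proof (cases T)
    case Leaf
    then show ?thesis by (simp add: induced_basis_def)
  next
    case T: (Node p us)
    have "expand (Node A ts) (\<lambda>T'. of_bool (T' = T)) =
        (\<Sum>q\<in>square (length ts). if q = p then coord (length ts) p A * expand_list ts (\<lambda>vs. of_bool (vs = us)) else 0)"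
      unfolding expand.simps T by (intro sum.cong refl) auto
    also have "\<dots> = (if p \<in> square (length ts) then coord (length ts) p A * expand_list ts (\<lambda>vs. of_bool (vs = us)) else 0)"
      by simp
    also have "\<dots> = coord (length ts) p A * expand_list ts (\<lambda>vs. of_bool (vs = us))"
      using coord_out_of_square[of p "length ts" A] by simp
    also have "\<dots> = coord (length ts) p A * tree_tensor_list (map (map_arity coord) us) ts"
      using Node.IH by simp
    also have "\<dots> = coord (length us) p A * tree_tensor_list (map (map_arity coord) us) ts"
    proof (cases "length us = length ts")
      case False
      then have "map shape us \<noteq> map shape ts" by (metis length_map)
      then show ?thesis by (subst (1 2) tree_tensor_list_shape) (simp_all add: comp_def)
    qed simp
    finally show ?thesis by (simp add: induced_basis_def T)
  qed
next
  case Nil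
  show ?case by (cases Ts) simp_all
next
  case (Cons t ts Ts)
  show ?case
  proof (cases Ts)
    case (Cons u us)
    have "expand_list (t # ts) (\<lambda>Ts'. of_bool (Ts' = Ts)) =
        expand t (\<lambda>u'. expand_list ts (\<lambda>us'. of_bool (u' = u) * of_bool (us' = us)))"
      by (simp add: Cons of_bool_conj)
    also have "\<dots> = expand t (\<lambda>u'. of_bool (u' = u) * expand_list ts (\<lambda>us'. of_bool (us' = us)))"
      by (simp only: expand_list_scale)
    also have "\<dots> = expand t (\<lambda>u'. expand_list ts (\<lambda>us'. of_bool (us' = us)) * of_bool (u' = u))"
      by (simp only: mult.commute)
    also have "\<dots> = expand_list ts (\<lambda>us'. of_bool (us' = us)) * expand t (\<lambda>u'. of_bool (u' = u))"
      by (rule expand_scale)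
    finally show ?thesis using Cons.IH by (simp add: Cons induced_basis_def)
  qed simp
qed

abbreviation base_tree :: "(nat \<times> nat) ptree \<Rightarrow> ('k::field) quad_class ptree" where
  "base_tree \<equiv> map_arity base_class"

text \<open>A multilinear extension is recovered from its values at the base classes.\<close>

lemma expand_base_tree:
  "pair_labelled T \<Longrightarrow> expand (base_tree T) c = c T"
  and "(\<forall>T\<in>set Ts. pair_labelled T) \<Longrightarrow> expand_list (map base_tree Ts) cs = cs Ts"
  for c :: "_ \<Rightarrow> 'k::field" and cs :: "_ \<Rightarrow> 'k"
proof (induction T and Ts arbitrary: c and cs rule: ptree_list_induct)
  case (Node p ts c)
  let ?l = "length ts"
  have "expand (base_tree (Node p ts)) c =
      (\<Sum>q\<in>square ?l. of_bool (p = q) * expand_list (map base_tree ts) (\<lambda>us. c (Node q us)))"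
    using Node.prems by (simp add: coord_base_class)
  also have "\<dots> = (\<Sum>q\<in>square ?l. if q = p then c (Node p ts) else 0)"
    using Node.IH Node.prems by (intro sum.cong refl) auto
  also have "\<dots> = c (Node p ts)" using Node.prems by simp
  finally show ?case .
qed simp_all

lemma induced_basis_base_tree:
  "pair_labelled T' \<Longrightarrow> induced_basis coord T (base_tree T') = of_bool (T' = T)"
  unfolding expand_induced_basis[symmetric] by (rule expand_base_tree)

definition contract_pairs :: "(nat \<times> nat) ptree \<Rightarrow> nat list \<Rightarrow> (nat \<times> nat) ptree" where
  "contract_pairs = contract (\<lambda>m i n. quad_comp i n)"

abbreviation classes :: "'k::field itself \<Rightarrow> nat \<Rightarrow> 'k quad_class set" where
  "classes k l \<equiv> car (dual_operad l)"

text \<open>Composition along an edge is evaluated by \<open>coord_op_comp\<close>; as expansion proceeds vertex by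
  vertex, the rest of the tree only contributes to the weights there. This turns the
  differential of the bar complex into a differential on coefficients.\<close>

lemma expand_contract:
  fixes D :: "('k::field) quad_class ptree"
  assumes "e \<in> internal_edges D" "labelled_in (classes TYPE('k)) D"
  shows "expand (contract (op_comp (orth quad)) D e) c = expand D (\<lambda>T. c (contract_pairs T e))"
  using assms
proof (induction arbitrary: c rule: edge_induct)
  case (root A xs B us ys c)
  let ?m = "length xs + length ys + 1" and ?n = "length us" and ?i = "length xs"
  have A: "A \<in> classes TYPE('k) ?m" and B: "B \<in> classes TYPE('k) ?n"
    using root by simp_all
  let ?w = "\<lambda>r. expand_list xs (\<lambda>ps. expand_list us (\<lambda>qs. expand_list ys (\<lambda>rs. c (Node r (ps @ qs @ rs)))))"
  have "length (xs @ us @ ys) = ?m + ?n - 1" by simp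
  then have "expand (contract (op_comp (orth quad)) (Node A (xs @ Node B us # ys)) [length xs]) c =
      (\<Sum>r\<in>square (?m + ?n - 1). coord (?m + ?n - 1) r (op_comp (orth quad) ?m ?i ?n A B) * ?w r)"
    unfolding contract_root expand.simps by (simp only: expand_list_append)
  also have "\<dots> = (\<Sum>p\<in>square ?m. \<Sum>q\<in>square ?n. coord ?m p A * coord ?n q B * ?w (quad_comp ?i ?n p q))"
    by (rule coord_op_comp[OF A B]) simp
  also have "\<dots> = (\<Sum>p\<in>square ?m. coord ?m p A * expand_list xs (\<lambda>ps. \<Sum>q\<in>square ?n. coord ?n q B *
      expand_list us (\<lambda>qs. expand_list ys (\<lambda>rs. c (Node (quad_comp ?i ?n p q) (ps @ qs @ rs))))))"
    by (simp add: expand_list_sum expand_list_scale sum_distrib_left mult.assoc)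
  also have "\<dots> = (\<Sum>p\<in>square ?m. coord ?m p A * expand_list xs (\<lambda>ps. \<Sum>q\<in>square ?n. coord ?n q B *
      expand_list us (\<lambda>qs. expand_list ys (\<lambda>rs. c (contract_pairs (Node p (ps @ Node q qs # rs)) [?i])))))"
  proof (intro sum.cong refl arg_cong2[where f = "(*)"] expand_list_length_cong)
    fix p q and ps qs rs :: "(nat \<times> nat) ptree list"
    assume "length ps = length xs" "length qs = length us" "length rs = length ys"
    then show "c (Node (quad_comp ?i ?n p q) (ps @ qs @ rs)) =
        c (contract_pairs (Node p (ps @ Node q qs # rs)) [?i])"
      using contract_root[of "\<lambda>m i n. quad_comp i n" p ps q qs rs] by (simp add: contract_pairs_def)
  qed
  also have "\<dots> = expand (Node A (xs @ Node B us # ys)) (\<lambda>T. c (contract_pairs T [length xs]))"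
    by (simp add: expand_list_append)
  finally show ?case .
next
  case (deeper A xs t ys q c)
  let ?m = "length xs + length ys + 1"
  have len: "length (xs @ u # ys) = ?m" for u :: "'k quad_class ptree" by simp
  have "expand (contract (op_comp (orth quad)) (Node A (xs @ t # ys)) (length xs # q)) c =
      (\<Sum>p\<in>square ?m. coord ?m p A * expand_list xs (\<lambda>ps. expand t (\<lambda>u.
        expand_list ys (\<lambda>rs. c (Node p (ps @ contract_pairs u q # rs))))))"
    unfolding contract_deeper[OF deeper.hyps(2)] expand.simps len expand_list_append expand_list.simps
    using deeper.IH deeper.prems by simp
  also have "\<dots> = (\<Sum>p\<in>square ?m. coord ?m p A * expand_list xs (\<lambda>ps. expand t (\<lambda>u.
        expand_list ys (\<lambda>rs. c (contract_pairs (Node p (ps @ u # rs)) (length xs # q))))))"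
  proof (intro sum.cong refl arg_cong2[where f = "(*)"] expand_list_length_cong expand_cong)
    fix p u and ps rs :: "(nat \<times> nat) ptree list"
    assume "length ps = length xs"
    then show "c (Node p (ps @ contract_pairs u q # rs)) =
        c (contract_pairs (Node p (ps @ u # rs)) (length xs # q))"
      using contract_deeper[OF deeper.hyps(2), of "\<lambda>m i n. quad_comp i n" p ps u rs]
      by (simp add: contract_pairs_def)
  qed
  also have "\<dots> = expand (Node A (xs @ t # ys)) (\<lambda>T. c (contract_pairs T (length xs # q)))"
    by (simp add: expand_list_append)
  finally show ?case .
qed

lemma expand_outside:
  fixes D :: "('k::field) quad_class ptree"
    and Ds :: "'k quad_class ptree list"
  shows "wf_tree D \<Longrightarrow> \<not> labelled_in (classes TYPE('k)) D \<Longrightarrow> expand D c = 0"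
  and "\<forall>D\<in>set Ds. wf_tree D \<Longrightarrow> \<exists>D\<in>set Ds. \<not> labelled_in (classes TYPE('k)) D \<Longrightarrow> expand_list Ds cs = 0"
proof (induction D and Ds arbitrary: c and cs rule: ptree_list_induct)
  case (Node A ts c)
  show ?case
  proof (cases "A \<in> classes TYPE('k) (length ts)")
    case True
    then show ?thesis using Node by auto
  qed (simp add: coord_outside)
next
  case (Cons t ts cs)
  show ?case
  proof (cases "labelled_in (classes TYPE('k)) t")
    case True
    then show ?thesis using Cons by simp
  next
    case False
    then show ?thesis using Cons by simp
  qed
qed simp_all

text \<open>A tensor product of functionals is multilinear, hence determined by its values at the base
  classes. This shows that the induced basis elements span the bar complex.\<close>

lemma tree_tensor_expand:
  fixes F :: "(('k::field) quad_class \<Rightarrow> 'k) ptree"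
    and Fs :: "('k quad_class \<Rightarrow> 'k) ptree list"
    and D :: "'k quad_class ptree" and Ds :: "'k quad_class ptree list"
  shows "labelled_in (\<lambda>l. dual (dual_operad l)) F \<Longrightarrow>
    tree_tensor F D = expand D (\<lambda>T. tree_tensor F (base_tree T))"
  and "\<forall>F\<in>set Fs. labelled_in (\<lambda>l. dual (dual_operad l)) F \<Longrightarrow>
    tree_tensor_list Fs Ds = expand_list Ds (\<lambda>Ts. tree_tensor_list Fs (map base_tree Ts))"
proof (induction D and Ds arbitrary: F and Fs rule: ptree_list_induct)
  case Leaf
  show ?case by simp
next
  case (Node A ts F)
  show ?case
  proof (cases F)
    case Leaf
    then show ?thesis by simp
  next
    case F: (Node \<phi> Fs)
    show ?thesis
    proof (cases "length Fs = length ts")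
      case False
      then have "tree_tensor_list Fs us = 0" if "length us = length ts" for us
        using tree_tensor_list_shape[of Fs us] that by (metis length_map)
      then have "tree_tensor_list Fs ts = 0"
        "expand_list ts (\<lambda>us. \<phi> (base_class (length us) p) * tree_tensor_list Fs (map base_tree us)) =
          expand_list ts (\<lambda>_. 0)" for p
        by (simp, intro expand_list_length_cong) simp
      then show ?thesis by (simp add: F)
    next
      case True
      have phi: "\<phi> \<in> dual (dual_operad (length ts))" "length ts \<ge> 1"
        using Node.prems True by (auto simp: F)
      have "\<phi> A = (\<Sum>p\<in>square (length ts). coord (length ts) p A * \<phi> (base_class (length ts) p))"
      proof (cases "A \<in> classes TYPE('k) (length ts)")
        case True
        then show ?thesis using dual_expansion phi by blast
      next
        case False
        then show ?thesis using phi(1) by (simp add: coord_outside dual_def supported_on_def)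
      qed
      then have "tree_tensor F (Node A ts) =
          (\<Sum>p\<in>square (length ts). coord (length ts) p A * (\<phi> (base_class (length ts) p) *
            expand_list ts (\<lambda>Ts. tree_tensor_list Fs (map base_tree Ts))))"
        using Node.IH[of Fs] Node.prems by (simp add: F sum_distrib_right mult.assoc)
      also have "\<dots> = (\<Sum>p\<in>square (length ts). coord (length ts) p A *
            expand_list ts (\<lambda>Ts. \<phi> (base_class (length ts) p) * tree_tensor_list Fs (map base_tree Ts)))"
        by (simp only: expand_list_scale)
      also have "\<dots> = (\<Sum>p\<in>square (length ts). coord (length ts) p A *
            expand_list ts (\<lambda>Ts. \<phi> (base_class (length Ts) p) * tree_tensor_list Fs (map base_tree Ts)))"
        by (intro sum.cong refl arg_cong2[where f = "(*)"] expand_list_length_cong) simp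
      finally show ?thesis by (simp add: F)
    qed
  qed
next
  case Nil
  show ?case by simp
next
  case (Cons t ts Fs)
  show ?case
  proof (cases Fs)
    case (Cons F Gs)
    have "expand_list (t # ts) (\<lambda>Ts. tree_tensor_list Fs (map base_tree Ts)) =
        expand t (\<lambda>u. tree_tensor F (base_tree u) * expand_list ts (\<lambda>us. tree_tensor_list Gs (map base_tree us)))"
      by (simp add: Cons expand_list_scale)
    also have "\<dots> = expand t (\<lambda>u. expand_list ts (\<lambda>us. tree_tensor_list Gs (map base_tree us)) * tree_tensor F (base_tree u))"
      by (simp only: mult.commute)
    also have "\<dots> = expand_list ts (\<lambda>us. tree_tensor_list Gs (map base_tree us)) * expand t (\<lambda>u. tree_tensor F (base_tree u))"
      by (rule expand_scale)
    finally show ?thesis using Cons.IH(1)[of F] Cons.IH(2)[of Gs] Cons.prems by (simp add: Cons)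
  qed simp
qed

definition bar_trees :: "nat \<Rightarrow> int \<Rightarrow> (nat \<times> nat) ptree set" where
  "bar_trees n d = {T \<in> pair_trees n. deg T = d}"

text \<open>All elements of the bar complex have this form, by \<open>bar_space_eq\<close>, and \<open>c\<close> is unique on the trees
  of the degree in question, by \<open>bar_element_base_tree\<close>.\<close>

definition bar_element ::
  "nat \<Rightarrow> int \<Rightarrow> ((nat \<times> nat) ptree \<Rightarrow> 'k::field) \<Rightarrow> 'k quad_class ptree \<Rightarrow> 'k" where
  "bar_element n d c = (\<Sum>T\<in>bar_trees n d. fscale (c T) (induced_basis coord T))"

lemma finite_bar_trees [simp]: "finite (bar_trees n d)"
  by (simp add: bar_trees_def)

lemma wf_mono: "labelled_in L T \<Longrightarrow> wf_tree T"
  by (rule labelled_in_mono) auto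

lemma pair_trees_iff: "T \<in> pair_trees n \<longleftrightarrow> pair_labelled T \<and> leaves T = n"
  by (auto simp: pair_trees_def ltrees_def)

lemma bar_treesD:
  "T \<in> bar_trees n d \<Longrightarrow> pair_labelled T \<and> wf_tree T \<and> leaves T = n \<and> deg T = d"
  by (auto simp: bar_trees_def pair_trees_iff intro: wf_mono)

lemma same_shape:
  assumes "shape T = shape D"
  shows "wf_tree T \<longleftrightarrow> wf_tree D" "leaves T = leaves D" "deg T = deg D"
  using labelled_in_shape[of T] labelled_in_shape[of D] leaves_shape[of T] leaves_shape[of D]
    deg_shape[of T] deg_shape[of D] unfolding assms by simp_all

lemma bar_element_expand:
  "bar_element n d c D = expand D (\<lambda>T. if T \<in> bar_trees n d then c T else 0)"
proof -
  have "bar_element n d c D = expand D (\<lambda>T'. \<Sum>T\<in>bar_trees n d. c T * of_bool (T' = T))"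
    unfolding bar_element_def expand_sum expand_scale expand_induced_basis
    by (simp add: sum_apply)
  also have "(\<lambda>T'. \<Sum>T\<in>bar_trees n d. c T * of_bool (T' = T)) = (\<lambda>T. if T \<in> bar_trees n d then c T else 0)"
  proof
    fix T'
    have "(\<Sum>T\<in>bar_trees n d. c T * of_bool (T' = T)) = (\<Sum>T\<in>bar_trees n d. if T = T' then c T' else 0)"
      by (intro sum.cong refl) auto
    then show "(\<Sum>T\<in>bar_trees n d. c T * of_bool (T' = T)) = (if T' \<in> bar_trees n d then c T' else 0)"
      by simp
  qed
  finally show ?thesis .
qed

lemma bar_element_eq:
  assumes "wf_tree D" "leaves D = n" "deg D = d"
  shows "bar_element n d c D = expand D c"
  unfolding bar_element_expand
proof (rule expand_cong)
  fix T assume "shape T = shape D" "wf_tree D \<Longrightarrow> pair_labelled T"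
  then have "T \<in> bar_trees n d"
    using assms same_shape(2,3)[of T D] by (simp add: bar_trees_def pair_trees_iff)
  then show "(if T \<in> bar_trees n d then c T else 0) = c T" by simp
qed

lemma bar_element_outside:
  fixes D :: "('k::field) quad_class ptree"
  assumes "\<not> (D \<in> ltrees (classes TYPE('k)) n \<and> deg D = d)"
  shows "bar_element n d c D = 0"
proof (cases "wf_tree D \<and> leaves D = n \<and> deg D = d")
  case True
  then have "\<not> labelled_in (classes TYPE('k)) D" using assms by (simp add: ltrees_def)
  then show ?thesis using True by (simp add: bar_element_eq expand_outside(1))
next
  case False
  have "T \<notin> bar_trees n d" if "shape T = shape D" for T :: "(nat \<times> nat) ptree"
  proof
    assume "T \<in> bar_trees n d"
    from bar_treesD[OF this] show False using False same_shape[OF that] by simp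
  qed
  then have "bar_element n d c D = expand D (\<lambda>_. 0)"
    unfolding bar_element_expand by (intro expand_cong) simp
  then show ?thesis by simp
qed

lemma bar_element_base_tree:
  assumes "T \<in> bar_trees n d"
  shows "bar_element n d c (base_tree T) = c T"
proof -
  have "wf_tree (base_tree T :: (quad_op, 'a) op_class ptree)"
    using bar_treesD[OF assms] same_shape(1)[OF shape_map_arity, of base_class T] by simp
  then show ?thesis using assms
    by (simp add: bar_element_eq bar_trees_def pair_trees_iff expand_base_tree)
qed

lemma bar_element_cong: "(\<And>T. T \<in> bar_trees n d \<Longrightarrow> c T = c' T) \<Longrightarrow> bar_element n d c = bar_element n d c'"
  by (simp add: bar_element_def)

lemma bar_element_add: "bar_element n d c + bar_element n d c' = bar_element n d (\<lambda>T. c T + c' T)"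
  by (simp add: bar_element_def fun_eq_iff sum_apply algebra_simps sum.distrib)

lemma bar_element_scale: "fscale a (bar_element n d c) = bar_element n d (\<lambda>T. a * c T)"
  by (simp add: bar_element_def fun_eq_iff sum_apply sum_distrib_left mult.assoc)

lemma dual_points:
  "T \<in> pair_trees n \<Longrightarrow> T' \<in> pair_trees n \<Longrightarrow>
    induced_basis coord T (base_tree T') = of_bool (T' = T)"
  by (simp add: induced_basis_base_tree pair_trees_iff)

text \<open>The space is spanned by all tensor products of functionals, and these are combinations of
  induced basis elements by \<open>tree_tensor_expand\<close>.\<close>

lemma bar_space_eq:
  "bar_space (orth (quad :: ('k::field) quad_relations)) n d = range (bar_element n d)"
proof (intro equalityI)
  have "tree_tensor F \<in> range (bar_element n d)"
    if "F \<in> ltrees (\<lambda>l. dual (operad (orth (quad :: 'k quad_relations)) l)) n" "deg F = d" for F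
  proof -
    have F: "labelled_in (\<lambda>l. dual (dual_operad l)) F" "leaves F = n"
      using that(1) by (auto simp: ltrees_def)
    have "tree_tensor F D = bar_element n d (\<lambda>T. tree_tensor F (base_tree T)) D" for D
      unfolding bar_element_expand tree_tensor_expand(1)[OF F(1), of D]
    proof (rule expand_cong)
      fix T assume T: "shape T = shape D" "wf_tree D \<Longrightarrow> pair_labelled T"
      show "tree_tensor F (base_tree T) = (if T \<in> bar_trees n d then tree_tensor F (base_tree T) else 0)"
      proof (cases "shape F = shape T")
        case True
        then have "wf_tree D" "leaves T = n" "deg T = d"
          using F that(2) wf_mono[OF F(1)] same_shape[OF T(1)] same_shape[OF True] by simp_all
        then show ?thesis using T(2) by (simp add: bar_trees_def pair_trees_iff)
      next
        case False
        then show ?thesis using tree_tensor_shape[of F "base_tree T"] by simp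
      qed
    qed
    then show ?thesis by blast
  qed
  moreover have "fun_vs.subspace (range (bar_element n d :: _ \<Rightarrow> 'k quad_class ptree \<Rightarrow> 'k))"
  proof (rule fun_vs.subspaceI)
    have "bar_element n d (\<lambda>_. 0) = (0 :: 'k quad_class ptree \<Rightarrow> 'k)"
      by (simp add: bar_element_def fun_eq_iff sum_apply)
    then show "(0 :: 'k quad_class ptree \<Rightarrow> 'k) \<in> range (bar_element n d)" by (metis rangeI)
  qed (auto simp: bar_element_add bar_element_scale)
  ultimately show "bar_space (orth (quad :: 'k quad_relations)) n d \<subseteq> range (bar_element n d)"
    unfolding bar_space_def by (intro fun_vs.span_minimal) auto
next
  have "induced_basis coord T \<in> bar_space (orth (quad :: 'k quad_relations)) n d"
    if "T \<in> bar_trees n d" for T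
  proof -
    have "labelled_in (\<lambda>l. dual (operad (orth (quad :: 'k quad_relations)) l)) (map_arity coord T)"
      if "pair_labelled T" for T
      using that by (induction T) (auto simp: coord_in_dual)
    then have "map_arity coord T \<in> {F \<in> ltrees (\<lambda>l. dual (operad (orth (quad :: 'k quad_relations)) l)) n. deg F = d}"
      using that by (simp add: bar_trees_def pair_trees_iff ltrees_def)
    then show ?thesis unfolding bar_space_def induced_basis_def by (intro fun_vs.span_base imageI)
  qed
  then show "range (bar_element n d) \<subseteq> bar_space (orth (quad :: 'k quad_relations)) n d"
    unfolding bar_element_def bar_space_def by (auto intro!: fun_vs.span_sum fun_vs.span_scale)
qed

theorem is_basis_induced_basis:
  "is_basis (bar_space (orth (quad :: ('k::field) quad_relations)) n d)
    {T \<in> pair_trees n. deg T = d} (induced_basis coord)"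
proof -
  have d: "induced_basis coord T (base_tree T') = (of_bool (T' = T) :: 'k)"
    if "T \<in> bar_trees n d" "T' \<in> bar_trees n d" for T T'
    using dual_points[of T n T'] that by (simp add: bar_trees_def)
  note df = dual_family[where e = "induced_basis coord :: _ \<Rightarrow> 'k quad_class ptree \<Rightarrow> 'k" and d = base_tree,
      OF finite_bar_trees d]
  have "fun_vs.span (induced_basis coord ` bar_trees n d :: ('k quad_class ptree \<Rightarrow> 'k) set) =
      {(\<Sum>T\<in>bar_trees n d. fscale (c T) (induced_basis coord T)) | c. True}"
    by (rule df(3))
  then have "fun_vs.span (induced_basis coord ` bar_trees n d) =
      bar_space (orth (quad :: 'k quad_relations)) n d"
    unfolding bar_space_eq bar_element_def by auto
  then show ?thesis unfolding is_basis_def bar_trees_def[symmetric]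
    using df(1,2) by blast
qed

lemma representation_bar_element:
  assumes "T \<in> pair_trees n"
  shows "fun_vs.representation (induced_basis coord ` pair_trees n) (bar_element n d c) (induced_basis coord T) =
    (if deg T = d then c T else (0 :: 'k::field))"
proof -
  have "bar_element n d c = (\<Sum>T\<in>pair_trees n. fscale (if deg T = d then c T else 0) (induced_basis coord T))"
    unfolding bar_element_def bar_trees_def by (rule sum.mono_neutral_cong_left) (auto simp: fun_eq_iff)
  then show ?thesis
    using dual_family(4)[where e = "induced_basis coord :: _ \<Rightarrow> 'k quad_class ptree \<Rightarrow> 'k" and d = base_tree,
        OF finite_pair_trees dual_points assms, where c = "\<lambda>T. if deg T = d then c T else 0"]
    by (simp only:)
qed

subsection \<open>The differential in coordinates\<close>

text \<open>The transpose of contraction with signs: the coefficient at \<open>T\<close> collects those at the contractions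
  of \<open>T\<close>.\<close>

definition pair_diff ::
  "(unit ptree \<Rightarrow> unit ptree \<Rightarrow> int) \<Rightarrow> ((nat \<times> nat) ptree \<Rightarrow> 'k::field) \<Rightarrow> (nat \<times> nat) ptree \<Rightarrow> 'k" where
  "pair_diff \<epsilon> c T = (\<Sum>e\<in>internal_edges T.
    of_int (\<epsilon> (contract_shape (shape T) e) (shape T)) * c (contract_pairs T e))"

text \<open>Both sides are multilinear in the labels of a tree, and by \<open>expand_contract\<close> the values agree for
  each edge.\<close>

theorem bar_diff_bar_element:
  "bar_diff \<epsilon> (orth quad) n d (bar_element n d c) =
    (bar_element n (d + 1) (pair_diff \<epsilon> c) :: ('k::field) quad_class ptree \<Rightarrow> 'k)"
proof
  fix D :: "'k quad_class ptree"
  show "bar_diff \<epsilon> (orth quad) n d (bar_element n d c) D = bar_element n (d + 1) (pair_diff \<epsilon> c) D"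
  proof (cases "D \<in> ltrees (classes TYPE('k)) n \<and> deg D = d + 1")
    case False
    then show ?thesis using bar_element_outside[OF False] by (auto simp: bar_diff_def)
  next
    case True
    then have D: "labelled_in (classes TYPE('k)) D" "leaves D = n" "deg D = d + 1" "wf_tree D"
      by (auto simp: ltrees_def intro: wf_mono)
    have "bar_element n d c (contract (op_comp (orth quad)) D e) =
        expand D (\<lambda>T. c (contract_pairs T e))" if e: "e \<in> internal_edges D" for e
    proof -
      have "wf_tree (contract (op_comp (orth quad)) D e)"
        using labelled_in_contract[OF e D(4)] by simp
      then have "bar_element n d c (contract (op_comp (orth quad)) D e) =
          expand (contract (op_comp (orth quad)) D e) c"
        using e D by (intro bar_element_eq) (simp_all add: deg_contract)
      then show ?thesis using expand_contract[OF e D(1)] by simp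
    qed
    then have "bar_diff \<epsilon> (orth quad) n d (bar_element n d c) D =
        (\<Sum>e\<in>internal_edges D. of_int (\<epsilon> (contract_shape (shape D) e) (shape D)) *
          expand D (\<lambda>T. c (contract_pairs T e)))"
      using True by (simp add: bar_diff_def shape_contract)
    also have "\<dots> = expand D (\<lambda>T. \<Sum>e\<in>internal_edges D.
        of_int (\<epsilon> (contract_shape (shape D) e) (shape D)) * c (contract_pairs T e))"
      by (simp only: expand_sum expand_scale)
    also have "\<dots> = expand D (pair_diff \<epsilon> c)"
    proof (rule expand_cong)
      fix T :: "(nat \<times> nat) ptree" assume T: "shape T = shape D"
      then have "internal_edges T = internal_edges D" by (metis internal_edges_shape)
      then show "(\<Sum>e\<in>internal_edges D. of_int (\<epsilon> (contract_shape (shape D) e) (shape D)) * c (contract_pairs T e)) =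
          pair_diff \<epsilon> c T"
        by (simp add: pair_diff_def T)
    qed
    also have "\<dots> = bar_element n (d + 1) (pair_diff \<epsilon> c) D"
      using D by (simp add: bar_element_eq)
    finally show ?thesis .
  qed
qed

section \<open>The retraction of the quadri-operad\<close>

definition standard_at :: "nat \<times> nat \<Rightarrow> quad_op ptree \<Rightarrow> bool" where
  "standard_at p t \<longleftrightarrow> standard (\<lambda>g. side (fst g)) (fst p) t \<and> standard (\<lambda>g. side (snd g)) (snd p) t"

text \<open>This is the component of the retraction in degree 1 that belongs to the copy with index \<open>p\<close>.
  All natural numbers are allowed in \<open>p\<close>, because the recursion for partial compositions leads to
  numbers that are not leaves.\<close>

definition standard_weight :: "nat \<Rightarrow> nat \<times> nat \<Rightarrow> (quad_op ptree \<Rightarrow> 'k::field) \<Rightarrow> 'k" where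
  "standard_weight n p = weight n (\<lambda>t. of_bool (standard_at p t))"

lemma standard_left_tree:
  "standard s k (left_tree q) \<longleftrightarrow>
    s (fst q) = (if k = 2 then 2 else 1) \<and> s (snd q) = (if k = 3 then 2 else 1)"
proof -
  consider "k = 0 \<or> k = 1" | "k = 2" | "k = 3" | "k > 3" by linarith
  then show ?thesis by cases (cases q; auto simp: left_tree_def)+
qed

lemma standard_right_tree:
  "standard s k (right_tree q) \<longleftrightarrow>
    s (fst q) = (if k = 2 \<or> k = 3 then 2 else 1) \<and> s (snd q) = (if k = 3 then 2 else 1)"
proof -
  consider "k = 0 \<or> k = 1" | "k = 2" | "k = 3" | "k > 3" by linarith
  then show ?thesis by cases (cases q; auto simp: right_tree_def)+
qed

text \<open>Each of the two shapes with three leaves has exactly one standard labelling for \<open>p\<close>, called \<open>ql\<close>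
  and \<open>qr\<close> here, and these have the same pointers. So each relation contains either both or none of
  them.\<close>

lemma standard_weight_relator:
  assumes "(u, v) \<in> (quad :: ('k::field) quad_relations)"
  shows "standard_weight 3 p (relator u v) = 0"
proof -
  define ql where "ql = (((if fst p = 2 then Succ else Prec), (if snd p = 2 then Succ else Prec)),
    ((if fst p = 3 then Succ else Prec), (if snd p = 3 then Succ else Prec)))"
  define qr where "qr = (((if fst p \<in> {2, 3} then Succ else Prec), (if snd p \<in> {2, 3} then Succ else Prec)),
    ((if fst p = 3 then Succ else Prec), (if snd p = 3 then Succ else Prec)))"
  have side2: "side c = 2 \<longleftrightarrow> c = Succ" "side c = Suc 0 \<longleftrightarrow> c = Prec" for c by (cases c; simp)+
  have l: "standard_at p (left_tree q) \<longleftrightarrow> q = ql" for q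
    by (auto simp: standard_at_def standard_left_tree ql_def side2 prod_eq_iff)
  have r: "standard_at p (right_tree q) \<longleftrightarrow> q = qr" for q
    by (auto simp: standard_at_def standard_right_tree qr_def side2 prod_eq_iff)
  have "fst p \<notin> {2, 3} \<or> fst p = 2 \<or> fst p = 3" "snd p \<notin> {2, 3} \<or> snd p = 2 \<or> snd p = 3" by auto
  then have eq: "ptr (left_tree ql) = ptr (right_tree qr)"
    unfolding ql_def qr_def ptr_left_tree ptr_right_tree
    by (elim disjE) (simp_all add: left_ptr_simps right_ptr_simps)
  have "quad \<subseteq> {x :: (_ \<Rightarrow> 'k) \<times> (_ \<Rightarrow> 'k). fst x ql = snd x qr}"
    unfolding quad_eq
  proof (rule pair_vs.span_minimal)
    show "quad_relation ` ({1..3} \<times> {1..3}) \<subseteq> {x :: (_ \<Rightarrow> 'k) \<times> (_ \<Rightarrow> 'k). fst x ql = snd x qr}"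
      by (auto simp: quad_relation_def eq)
    show "pair_vs.subspace {x :: (_ \<Rightarrow> 'k) \<times> (_ \<Rightarrow> 'k). fst x ql = snd x qr}"
      by (rule pair_vs.subspaceI) (auto simp: pair_scale_def)
  qed
  then have "u ql = v qr" using assms by auto
  then show ?thesis unfolding standard_weight_def weight_relator l r by simp
qed

text \<open>The leaf of the lower tree below the leaf \<open>k\<close> after grafting a tree with \<open>n\<close> leaves on the
  leaf with index \<open>i\<close>.\<close>

definition outer_pointer :: "nat \<Rightarrow> nat \<Rightarrow> nat \<Rightarrow> nat" where
  "outer_pointer i n k = (if k \<le> i then k else if k \<le> i + n then Suc i else k + 1 - n)"

lemma standard_at_graft:
  assumes "t \<in> binary_trees m" "u \<in> binary_trees n" "i < m"
  shows "standard_at p (graft t i u) \<longleftrightarrow>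
    standard_at (outer_pointer i n (fst p), outer_pointer i n (snd p)) t \<and>
    standard_at (fst p - i, snd p - i) u"
  using assms standard_graft[of t u i]
  by (auto simp: standard_at_def outer_pointer_def binary_trees_iff)

text \<open>By \<open>standard_at_graft\<close> the standard weights are multiplicative, which lets them vanish on the
  ideal as soon as they vanish on the relations.\<close>

lemma standard_weight_free_comp:
  fixes x y :: "quad_op ptree \<Rightarrow> 'k::field"
  assumes "x \<in> free_operad m" "y \<in> free_operad n" "i < m"
  shows "standard_weight (m + n - 1) p (free_comp i x y) =
    standard_weight m (outer_pointer i n (fst p), outer_pointer i n (snd p)) x *
    standard_weight n (fst p - i, snd p - i) y"
  unfolding standard_weight_def weight_free_comp[OF assms]
  unfolding weight_def sum_product
  by (intro sum.cong refl) (simp add: standard_at_graft assms(3) of_bool_conj)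

lemma standard_weight_ideal:
  "in_ideal quad n (x :: quad_op ptree \<Rightarrow> 'k::field) \<Longrightarrow> standard_weight n p x = 0"
proof (induction arbitrary: p rule: in_ideal.induct)
  case (comp_left m x y n i)
  then show ?case
    using standard_weight_free_comp[OF in_ideal_free[OF comp_left.hyps(1)] comp_left.hyps(2,3)] by simp
next
  case (comp_right x m n y i)
  then show ?case
    using standard_weight_free_comp[OF comp_right.hyps(1) in_ideal_free[OF comp_right.hyps(2)] comp_right.hyps(3)]
    by simp
qed (simp_all add: standard_weight_relator standard_weight_def weight_add weight_scale
    standard_weight_relator[unfolded standard_weight_def])

lemma standard_weight_cls:
  assumes "cls (quad_ideal n) x = cls (quad_ideal n) (y :: quad_op ptree \<Rightarrow> 'k::field)"
  shows "standard_weight n p x = standard_weight n p y"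
proof -
  have "x - y \<in> quad_ideal n" using assms unfolding cls_eq_iff[OF subspace_op_ideal] .
  then have "standard_weight n p (x - y) = 0"
    by (intro standard_weight_ideal) (simp add: op_ideal_def)
  then show ?thesis by (simp add: standard_weight_def weight_diff)
qed

section \<open>Sums over labellings of a binary tree\<close>

definition labellings :: "unit ptree \<Rightarrow> quad_op ptree set" where
  "labellings S = {t. binary t \<and> shape t = S}"

lemma binary_shape [simp]: "binary (shape t) \<longleftrightarrow> binary t"
proof -
  have "binary (shape t) \<longleftrightarrow> labelled_in (\<lambda>l. {a. () \<in> (if l = 2 then UNIV else {})}) t"
    by (simp add: shape_def labelled_in_map)
  also have "(\<lambda>l::nat. {a. () \<in> (if l = 2 then UNIV else {})}) = (\<lambda>l. if l = 2 then UNIV else {})"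
    by (auto simp: fun_eq_iff)
  finally show ?thesis .
qed

lemma labellings_binary_trees: "S \<in> binary_trees n \<Longrightarrow> labellings S \<subseteq> binary_trees n"
  by (auto simp: labellings_def binary_trees_iff)

lemma finite_labellings [simp]: "finite (labellings S)"
  by (rule finite_subset[of _ "binary_trees (leaves S)"])
    (auto simp: labellings_def binary_trees_iff)

lemma sum_labellings_Node:
  "(\<Sum>t\<in>labellings (Node () [l, r]). f t) =
    (\<Sum>c\<in>UNIV. \<Sum>x\<in>labellings l. \<Sum>y\<in>labellings r. f (Node c [x, y]))"
proof -
  have "labellings (Node () [l, r]) = (\<lambda>(c, x, y). Node c [x, y]) ` (UNIV \<times> labellings l \<times> labellings r)"
    (is "_ = ?h ` ?A")
  proof (intro equalityI subsetI)
    fix t assume "t \<in> labellings (Node () [l, r])"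
    then obtain c ts where t: "t = Node c ts" "binary (Node c ts)" "map shape ts = [l, r]"
      by (cases t) (auto simp: labellings_def simp del: labelled_in.simps)
    then obtain x y where "ts = [x, y]" "binary x" "binary y" unfolding binary_Node by blast
    then show "t \<in> ?h ` ?A" using t by (auto simp: labellings_def intro!: image_eqI[of _ _ "(c, x, y)"])
  qed (auto simp: labellings_def)
  moreover have "inj_on ?h ?A" by (auto simp: inj_on_def)
  ultimately have "(\<Sum>t\<in>labellings (Node () [l, r]). f t) = (\<Sum>z\<in>?A. f (?h z))"
    by (simp add: sum.reindex)
  then show ?thesis by (simp add: sum.cartesian_product case_prod_beta)
qed

abbreviation graft_three :: "'g ptree \<Rightarrow> 'g ptree \<Rightarrow> 'g ptree \<Rightarrow> 'g ptree \<Rightarrow> 'g ptree" where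
  "graft_three x y z t \<equiv> graft (graft (graft t 2 z) 1 y) 0 x"

lemma graft_three_left_tree: "graft_three x y z (left_tree (d, c)) = Node c [Node d [x, y], z]"
  by (simp add: left_tree_def)

lemma graft_three_right_tree: "graft_three x y z (right_tree (c, d)) = Node c [x, Node d [y, z]]"
  by (simp add: right_tree_def)

lemma sum_UNIV_pairs: "(\<Sum>q\<in>UNIV. f q) = (\<Sum>a\<in>UNIV. \<Sum>b\<in>UNIV. f (a, b))"
  for f :: "'a::finite \<times> 'b::finite \<Rightarrow> 'c::comm_monoid_add"
  unfolding UNIV_Times_UNIV[symmetric] by (simp add: sum.cartesian_product)

lemma sum_labellings_left:
  "(\<Sum>t\<in>labellings (Node () [Node () [A, B], C]). f t) =
    (\<Sum>x\<in>labellings A. \<Sum>y\<in>labellings B. \<Sum>z\<in>labellings C. \<Sum>q\<in>UNIV. f (graft_three x y z (left_tree q)))"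
proof -
  have "(\<Sum>t\<in>labellings (Node () [Node () [A, B], C]). f t) =
      (\<Sum>c\<in>UNIV. \<Sum>d\<in>UNIV. \<Sum>x\<in>labellings A. \<Sum>y\<in>labellings B. \<Sum>z\<in>labellings C. f (Node c [Node d [x, y], z]))"
    by (simp add: sum_labellings_Node)
  also have "\<dots> = (\<Sum>d\<in>UNIV. \<Sum>c\<in>UNIV. \<Sum>x\<in>labellings A. \<Sum>y\<in>labellings B. \<Sum>z\<in>labellings C. f (Node c [Node d [x, y], z]))"
    by (rule sum.swap)
  also have "\<dots> = (\<Sum>q\<in>UNIV. \<Sum>x\<in>labellings A. \<Sum>y\<in>labellings B. \<Sum>z\<in>labellings C. f (graft_three x y z (left_tree q)))"
    by (simp only: sum_UNIV_pairs[of "\<lambda>q. \<Sum>x\<in>labellings A. \<Sum>y\<in>labellings B. \<Sum>z\<in>labellings C. f (graft_three x y z (left_tree q))"] graft_three_left_tree)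
  finally show ?thesis
    by (simp only: sum.swap[of _ "labellings A" UNIV] sum.swap[of _ "labellings B" UNIV] sum.swap[of _ "labellings C" UNIV])
qed

lemma sum_labellings_right:
  "(\<Sum>t\<in>labellings (Node () [A, Node () [B, C]]). f t) =
    (\<Sum>x\<in>labellings A. \<Sum>y\<in>labellings B. \<Sum>z\<in>labellings C. \<Sum>q\<in>UNIV. f (graft_three x y z (right_tree q)))"
proof -
  have "(\<Sum>t\<in>labellings (Node () [A, Node () [B, C]]). f t) =
      (\<Sum>c\<in>UNIV. \<Sum>x\<in>labellings A. \<Sum>d\<in>UNIV. \<Sum>y\<in>labellings B. \<Sum>z\<in>labellings C. f (Node c [x, Node d [y, z]]))"
    by (simp add: sum_labellings_Node)
  also have "\<dots> = (\<Sum>c\<in>UNIV. \<Sum>d\<in>UNIV. \<Sum>x\<in>labellings A. \<Sum>y\<in>labellings B. \<Sum>z\<in>labellings C. f (Node c [x, Node d [y, z]]))"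
    by (simp only: sum.swap[of _ "labellings A" UNIV])
  also have "\<dots> = (\<Sum>q\<in>UNIV. \<Sum>x\<in>labellings A. \<Sum>y\<in>labellings B. \<Sum>z\<in>labellings C. f (graft_three x y z (right_tree q)))"
    by (simp only: sum_UNIV_pairs[of "\<lambda>q. \<Sum>x\<in>labellings A. \<Sum>y\<in>labellings B. \<Sum>z\<in>labellings C. f (graft_three x y z (right_tree q))"] graft_three_right_tree)
  finally show ?thesis
    by (simp only: sum.swap[of _ "labellings A" UNIV] sum.swap[of _ "labellings B" UNIV] sum.swap[of _ "labellings C" UNIV])
qed

text \<open>With \<open>w\<close> the indicator function of a pointer, this is the value of the embedding at a vertex of the
  associahedron. Arbitrary weights make the comparison of shapes stable under grafting.\<close>

definition labelling_sum :: "unit ptree \<Rightarrow> (nat \<times> nat \<Rightarrow> 'k::field) \<Rightarrow> quad_op ptree \<Rightarrow> 'k" where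
  "labelling_sum S w = (\<Sum>t\<in>labellings S. fscale (w (ptr t)) (delta t))"

lemma labelling_sum_apply: "labelling_sum S w t = (if t \<in> labellings S then w (ptr t) else 0)"
proof -
  have "labelling_sum S w t = (\<Sum>u\<in>labellings S. if u = t then w (ptr t) else 0)"
    unfolding labelling_sum_def sum_apply by (intro sum.cong refl) (auto simp: delta_def)
  then show ?thesis by simp
qed

lemma labelling_sum_free: "S \<in> binary_trees n \<Longrightarrow> labelling_sum S w \<in> free_operad n"
  using labellings_binary_trees by (fastforce simp: supported_on_def labelling_sum_apply)

lemma free_comp_delta_left:
  fixes f :: "'i \<Rightarrow> 'k::field"
  assumes "\<And>q. q \<in> A \<Longrightarrow> T q \<in> binary_trees m" "s \<in> (binary_trees n :: 'g::finite ptree set)"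
  shows "free_comp i (\<Sum>q\<in>A. fscale (f q) (delta (T q))) (delta s) =
    (\<Sum>q\<in>A. fscale (f q) (delta (graft (T q) i s)))"
proof -
  have "free_comp i (\<Sum>q\<in>A. fscale (f q) (delta (T q))) (delta s) =
      (\<Sum>q\<in>A. free_comp i (fscale (f q) (delta (T q))) (delta s))"
    using assms by (intro free_comp_sum_left[of _ _ m _ n] supported_on_scale delta_supported_on)
  also have "\<dots> = (\<Sum>q\<in>A. fscale (f q) (delta (graft (T q) i s)))"
    by (intro sum.cong refl, subst free_comp_scale_left[of _ m _ n])
      (use assms in \<open>auto simp: delta_supported_on free_comp_delta\<close>)
  finally show ?thesis .
qed

lemma free_comp_delta_right:
  fixes f :: "'i \<Rightarrow> 'k::field"
  assumes "\<And>q. q \<in> A \<Longrightarrow> T q \<in> binary_trees n" "t \<in> (binary_trees m :: 'g::finite ptree set)"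
  shows "free_comp i (delta t) (\<Sum>q\<in>A. fscale (f q) (delta (T q))) =
    (\<Sum>q\<in>A. fscale (f q) (delta (graft t i (T q))))"
proof -
  have "free_comp i (delta t) (\<Sum>q\<in>A. fscale (f q) (delta (T q))) =
      (\<Sum>q\<in>A. free_comp i (delta t) (fscale (f q) (delta (T q))))"
    using assms by (intro free_comp_sum_right[of _ m _ _ n] supported_on_scale delta_supported_on)
  also have "\<dots> = (\<Sum>q\<in>A. fscale (f q) (delta (graft t i (T q))))"
    by (intro sum.cong refl, subst free_comp_scale_right[of _ m _ n])
      (use assms in \<open>auto simp: delta_supported_on free_comp_delta\<close>)
  finally show ?thesis .
qed

text \<open>Modulo the ideal, the two vertices \<open>S\<close> and \<open>S'\<close> of the associahedron have the same image in all
  copies at once: take indicator functions for \<open>w\<close>. The first argument fixes the ground field.\<close>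

definition shape_equiv :: "'k::field itself \<Rightarrow> nat \<Rightarrow> unit ptree \<Rightarrow> unit ptree \<Rightarrow> bool" where
  "shape_equiv k n S S' \<longleftrightarrow> S \<in> binary_trees n \<and> S' \<in> binary_trees n \<and>
    (\<forall>w. (labelling_sum S w - labelling_sum S' w :: _ \<Rightarrow> 'k) \<in> quad_ideal n)"

lemma shape_equiv_refl: "S \<in> binary_trees n \<Longrightarrow> shape_equiv k n S S"
  using fun_vs.subspace_0[OF subspace_op_ideal] by (simp add: shape_equiv_def)

lemma shape_equiv_trans: "shape_equiv k n S T \<Longrightarrow> shape_equiv k n T U \<Longrightarrow> shape_equiv k n S U"
  unfolding shape_equiv_def
proof (intro conjI allI)
  fix w :: "nat \<times> nat \<Rightarrow> 'a"
  assume "S \<in> binary_trees n \<and> T \<in> binary_trees n \<and> (\<forall>w. (labelling_sum S w - labelling_sum T w :: _ \<Rightarrow> 'a) \<in> quad_ideal n)"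
    "T \<in> binary_trees n \<and> U \<in> binary_trees n \<and> (\<forall>w. (labelling_sum T w - labelling_sum U w :: _ \<Rightarrow> 'a) \<in> quad_ideal n)"
  then show "labelling_sum S w - labelling_sum U w \<in> quad_ideal n"
    using fun_vs.subspace_add[OF subspace_op_ideal, of "labelling_sum S w - labelling_sum T w" quad n
        "labelling_sum T w - labelling_sum U w"] by simp
qed auto

text \<open>A common step of the next two lemmas: the labellings of \<open>T\<close> arise by grafting the
  labellings of \<open>S\<close> on fixed trees \<open>u j\<close>. The weight of the grafted tree is a weight of the pointers
  of the labelling of \<open>S\<close>, as \<open>u j\<close> is fixed.\<close>

lemma shape_equiv_graft:
  assumes "shape_equiv (k :: 'k::field itself) n S S'" "i < m" "\<And>j. j \<in> J \<Longrightarrow> u j \<in> binary_trees m"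
    and T: "T \<in> binary_trees (m + n - 1)" "T' \<in> binary_trees (m + n - 1)"
    and "\<And>f :: _ \<Rightarrow> quad_op ptree \<Rightarrow> 'k. sum f (labellings T) = (\<Sum>j\<in>J. \<Sum>x\<in>labellings S. f (graft (u j) i x))"
    and "\<And>f :: _ \<Rightarrow> quad_op ptree \<Rightarrow> 'k. sum f (labellings T') = (\<Sum>j\<in>J. \<Sum>x\<in>labellings S'. f (graft (u j) i x))"
  shows "shape_equiv k (m + n - 1) T T'"
proof -
  have S: "S \<in> binary_trees n" "S' \<in> binary_trees n" using assms(1) by (auto simp: shape_equiv_def)
  have "labelling_sum T w - labelling_sum T' w \<in> quad_ideal (m + n - 1)" for w :: "nat \<times> nat \<Rightarrow> 'k"
  proof -
    define W where "W j p = w (quad_comp i n (ptr (u j)) p)" for j p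
    let ?g = "\<lambda>j. free_comp i (delta (u j))"
    have sum: "labelling_sum R w = (\<Sum>j\<in>J. ?g j (labelling_sum U (W j)))"
      if U: "U \<in> binary_trees n"
        and R: "\<And>f :: _ \<Rightarrow> quad_op ptree \<Rightarrow> 'k. sum f (labellings R) = (\<Sum>j\<in>J. \<Sum>x\<in>labellings U. f (graft (u j) i x))"
      for R U
      unfolding labelling_sum_def[of R] R
    proof (rule sum.cong[OF refl])
      fix j assume j: "j \<in> J"
      have "ptr (graft (u j) i x) = quad_comp i n (ptr (u j)) (ptr x)" if "x \<in> labellings U" for x
        using ptr_graft[OF assms(3)[OF j] _ assms(2)] that labellings_binary_trees[OF U] by blast
      then have "(\<Sum>x\<in>labellings U. fscale (w (ptr (graft (u j) i x))) (delta (graft (u j) i x))) =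
          (\<Sum>x\<in>labellings U. fscale (W j (ptr x)) (delta (graft (u j) i x)))"
        by (intro sum.cong refl) (simp add: W_def)
      also have "\<dots> = ?g j (labelling_sum U (W j))"
        unfolding labelling_sum_def
        by (rule free_comp_delta_right[of _ _ n _ m, symmetric]) (use labellings_binary_trees[OF U] assms(3)[OF j] in auto)
      finally show "(\<Sum>x\<in>labellings U. fscale (w (ptr (graft (u j) i x))) (delta (graft (u j) i x))) =
          ?g j (labelling_sum U (W j))" .
    qed
    have "?g j (labelling_sum S (W j)) - ?g j (labelling_sum S' (W j)) \<in> quad_ideal (m + n - 1)"
      if j: "j \<in> J" for j
    proof -
      have "?g j (labelling_sum S (W j) - labelling_sum S' (W j)) \<in> quad_ideal (m + n - 1)"
        using assms(1) by (intro op_ideal_comp_right delta_supported_on assms(2) assms(3)[OF j]) (auto simp: shape_equiv_def)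
      moreover have "?g j (labelling_sum S (W j) - labelling_sum S' (W j)) =
          ?g j (labelling_sum S (W j)) - ?g j (labelling_sum S' (W j))"
        by (rule free_comp_diff_right[OF delta_supported_on[OF assms(3)[OF j]] labelling_sum_free[OF S(1)] labelling_sum_free[OF S(2)]])
      ultimately show ?thesis by simp
    qed
    then have "(\<Sum>j\<in>J. ?g j (labelling_sum S (W j)) - ?g j (labelling_sum S' (W j))) \<in> quad_ideal (m + n - 1)"
      by (intro fun_vs.subspace_sum[OF subspace_op_ideal])
    then show ?thesis unfolding sum[OF S(1) assms(6)] sum[OF S(2) assms(7)] by (simp only: sum_subtractf)
  qed
  then show ?thesis using T by (auto simp: shape_equiv_def)
qed

lemma shape_equiv_Node_left:
  assumes "shape_equiv (k :: 'k::field itself) m l l'" "r \<in> binary_trees n"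
  shows "shape_equiv k (m + n) (Node () [l, r]) (Node () [l', r])"
proof -
  have sum: "sum f (labellings (Node () [a, r])) =
      (\<Sum>j\<in>UNIV \<times> labellings r. \<Sum>x\<in>labellings a. f (graft (Node (fst j) [Leaf, snd j]) 0 x))"
    for a and f :: "_ \<Rightarrow> quad_op ptree \<Rightarrow> 'k"
    by (simp add: sum_labellings_Node sum.cartesian_product' sum.swap[of _ "labellings r" "labellings a"])
  have "shape_equiv k (Suc n + m - 1) (Node () [l, r]) (Node () [l', r])"
    by (rule shape_equiv_graft[OF assms(1), of 0 "Suc n" _ _ _ _, OF _ _ _ _ sum sum])
      (use assms labellings_binary_trees[OF assms(2)] in \<open>auto simp: shape_equiv_def binary_trees_iff\<close>)
  then show ?thesis by (simp add: add.commute)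
qed

lemma shape_equiv_Node_right:
  assumes "shape_equiv (k :: 'k::field itself) n r r'" "l \<in> binary_trees m"
  shows "shape_equiv k (m + n) (Node () [l, r]) (Node () [l, r'])"
proof -
  have leaves: "leaves x = m" if "x \<in> labellings l" for x
    using that labellings_binary_trees[OF assms(2)] by (auto simp: binary_trees_iff)
  have sum: "sum f (labellings (Node () [l, a])) =
      (\<Sum>j\<in>UNIV \<times> labellings l. \<Sum>x\<in>labellings a. f (graft (Node (fst j) [snd j, Leaf]) m x))"
    for a and f :: "_ \<Rightarrow> quad_op ptree \<Rightarrow> 'k"
    by (simp add: sum_labellings_Node sum.cartesian_product' leaves cong: sum.cong)
  have "shape_equiv k (Suc m + n - 1) (Node () [l, r]) (Node () [l, r'])"
    by (rule shape_equiv_graft[OF assms(1), of m "Suc m" _ _ _ _, OF _ _ _ _ sum sum])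
      (use assms labellings_binary_trees[OF assms(2)] in \<open>auto simp: shape_equiv_def binary_trees_iff\<close>)
  then show ?thesis by simp
qed

text \<open>
  For fixed labellings \<open>x\<close>, \<open>y\<close>, \<open>z\<close> of the three subtrees, the remaining sum over the labels of the
  two lowest vertices is a relator with three leaves on which \<open>x\<close>, \<open>y\<close>, \<open>z\<close> are grafted. Its
  weights are those of the grafted trees, which depend only on the pointers in arity 3; so it
  is a relation of \<open>quad\<close> by \<open>quad_relation_weighted\<close>.
\<close>

lemma shape_equiv_rotate:
  assumes "A \<in> binary_trees a" "B \<in> binary_trees b" "C \<in> binary_trees c"
  shows "shape_equiv (k :: 'k::field itself) (a + b + c) (Node () [Node () [A, B], C]) (Node () [A, Node () [B, C]])"
proof -
  have pos: "a \<ge> 1" "b \<ge> 1" "c \<ge> 1" using assms leaves_pos by (auto simp: binary_trees_iff)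
  have "labelling_sum (Node () [Node () [A, B], C]) w - labelling_sum (Node () [A, Node () [B, C]]) w
      \<in> quad_ideal (a + b + c)" for w :: "nat \<times> nat \<Rightarrow> 'k"
  proof -
    let ?s = "\<lambda>T x y z. \<Sum>q\<in>UNIV. fscale (w (ptr (graft_three x y z (T q)))) (delta (graft_three x y z (T q)))"
    have *: "?s left_tree x y z - ?s right_tree x y z \<in> quad_ideal (a + b + c)"
      if xyz: "x \<in> binary_trees a" "y \<in> binary_trees b" "z \<in> binary_trees c" for x y z
    proof -
      \<comment> \<open>The weight acquired by a tree with pointers \<open>p\<close> when \<open>x\<close>, \<open>y\<close>, \<open>z\<close> are grafted on it.\<close>
      define W where "W p = w (quad_comp 0 a (quad_comp 1 b (quad_comp 2 c p (ptr z)) (ptr y)) (ptr x))" for p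
      have W: "W (ptr t) = w (ptr (graft_three x y z t))" if t: "t \<in> binary_trees 3" for t
      proof -
        have g1: "graft t 2 z \<in> binary_trees (3 + c - 1)" using binary_trees_graft[OF t xyz(3)] by simp
        have g2: "graft (graft t 2 z) 1 y \<in> binary_trees (3 + c - 1 + b - 1)"
          using binary_trees_graft[OF g1 xyz(2)] pos by simp
        show ?thesis
          using ptr_graft[OF t xyz(3), of 2] ptr_graft[OF g1 xyz(2), of 1] ptr_graft[OF g2 xyz(1), of 0] pos
          by (simp add: W_def)
      qed
      let ?R = "relator (\<lambda>q. W (ptr (left_tree q))) (\<lambda>q. W (ptr (right_tree q)))"
      let ?h = "\<lambda>X. free_comp 0 (free_comp 1 (free_comp 2 X (delta z)) (delta y)) (delta x)"
      have "?R \<in> quad_ideal 3"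
        unfolding op_ideal_def mem_Collect_eq by (rule in_ideal.rel[OF quad_relation_weighted])
      then have "free_comp 2 ?R (delta z) \<in> quad_ideal (3 + c - 1)"
        by (rule op_ideal_comp_left) (simp_all add: delta_supported_on xyz)
      then have "free_comp 1 (free_comp 2 ?R (delta z)) (delta y) \<in> quad_ideal (3 + c - 1 + b - 1)"
        by (rule op_ideal_comp_left) (use pos in \<open>simp_all add: delta_supported_on xyz\<close>)
      then have "?h ?R \<in> quad_ideal (3 + c - 1 + b - 1 + a - 1)"
        by (rule op_ideal_comp_left) (use pos in \<open>simp_all add: delta_supported_on xyz\<close>)
      then have h: "?h ?R \<in> quad_ideal (a + b + c)" using pos by (simp add: algebra_simps)
      have step: "?h (\<Sum>q\<in>UNIV. fscale (W (ptr (T q))) (delta (T q))) = ?s T x y z"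
        if T: "\<And>q. T q \<in> binary_trees 3" for T :: "quad_op \<times> quad_op \<Rightarrow> quad_op ptree"
      proof -
        have g1: "graft (T q) 2 z \<in> binary_trees (3 + c - 1)" for q using binary_trees_graft[OF T xyz(3)] by simp
        have g2: "graft (graft (T q) 2 z) 1 y \<in> binary_trees (3 + c - 1 + b - 1)" for q
          using binary_trees_graft[OF g1 xyz(2)] pos by simp
        have "?h (\<Sum>q\<in>UNIV. fscale (W (ptr (T q))) (delta (T q))) =
            (\<Sum>q\<in>UNIV. fscale (W (ptr (T q))) (delta (graft_three x y z (T q))))"
          by (simp only: free_comp_delta_left[OF T xyz(3)] free_comp_delta_left[OF g1 xyz(2)] free_comp_delta_left[OF g2 xyz(1)])
        then show ?thesis by (simp only: W[OF T])
      qed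
      have f: "(\<Sum>q\<in>UNIV. fscale (W (ptr (T q))) (delta (T q))) \<in> free_operad 3"
        if T: "\<And>q. T q \<in> binary_trees 3" for T :: "quad_op \<times> quad_op \<Rightarrow> quad_op ptree"
        by (intro supported_on_sum supported_on_scale delta_supported_on T)
      have f2: "free_comp 2 X (delta z) \<in> free_operad (3 + c - 1)" if "X \<in> free_operad 3" for X :: "_ \<Rightarrow> 'k"
        using free_comp_in_free_operad[OF that delta_supported_on[OF xyz(3)]] by simp
      have f3: "free_comp 1 X (delta y) \<in> free_operad (3 + c - 1 + b - 1)" if "X \<in> free_operad (3 + c - 1)" for X :: "_ \<Rightarrow> 'k"
        using free_comp_in_free_operad[OF that delta_supported_on[OF xyz(2)]] pos by simp
      have hd: "?h (X - Y) = ?h X - ?h Y" if X: "X \<in> free_operad 3" and Y: "Y \<in> free_operad 3" for X Y :: "_ \<Rightarrow> 'k"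
        by (simp only: free_comp_diff_left[OF X Y delta_supported_on[OF xyz(3)]]
            free_comp_diff_left[OF f2[OF X] f2[OF Y] delta_supported_on[OF xyz(2)]]
            free_comp_diff_left[OF f3[OF f2[OF X]] f3[OF f2[OF Y]] delta_supported_on[OF xyz(1)]])
      have "?h ?R = ?s left_tree x y z - ?s right_tree x y z"
        unfolding relator_def hd[OF f[OF left_tree_binary] f[OF right_tree_binary]]
          step[OF left_tree_binary] step[OF right_tree_binary] ..
      with h show ?thesis by simp
    qed
    have "(\<Sum>x\<in>labellings A. \<Sum>y\<in>labellings B. \<Sum>z\<in>labellings C. ?s left_tree x y z - ?s right_tree x y z)
        \<in> quad_ideal (a + b + c)"
      using labellings_binary_trees[OF assms(1)] labellings_binary_trees[OF assms(2)] labellings_binary_trees[OF assms(3)]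
      by (intro fun_vs.subspace_sum[OF subspace_op_ideal] *) auto
    then show ?thesis
      unfolding labelling_sum_def sum_labellings_left sum_labellings_right by (simp only: sum_subtractf)
  qed
  then show ?thesis using assms by (auto simp: shape_equiv_def binary_trees_iff)
qed

fun comb_shape :: "nat \<Rightarrow> unit ptree" where
  "comb_shape 0 = Leaf"
| "comb_shape (Suc k) = Node () [Leaf, comb_shape k]"

lemma comb_shape_binary: "comb_shape k \<in> binary_trees (Suc k)"
  by (induction k) (auto simp: binary_trees_iff)

lemma shape_equiv_Node_combs:
  "shape_equiv K (k + m + 2) (Node () [comb_shape k, comb_shape m]) (comb_shape (k + m + 1))"
proof (induction k)
  case 0
  show ?case using shape_equiv_refl[OF comb_shape_binary, of K "Suc m"] by simp
next
  case (Suc k)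
  have "shape_equiv K (1 + Suc k + Suc m) (Node () [Node () [Leaf, comb_shape k], comb_shape m])
      (Node () [Leaf, Node () [comb_shape k, comb_shape m]])"
    by (intro shape_equiv_rotate comb_shape_binary) (simp add: binary_trees_iff)
  moreover have "shape_equiv K (1 + (k + m + 2)) (Node () [Leaf, Node () [comb_shape k, comb_shape m]])
      (Node () [Leaf, comb_shape (k + m + 1)])"
    by (intro shape_equiv_Node_right Suc.IH) (simp add: binary_trees_iff)
  moreover have "1 + Suc k + Suc m = Suc k + m + 2" "1 + (k + m + 2) = Suc k + m + 2"
    "comb_shape (Suc k + m + 1) = Node () [Leaf, comb_shape (k + m + 1)]"
    "comb_shape (Suc k) = Node () [Leaf, comb_shape k]"
    by simp_all
  ultimately show ?case using shape_equiv_trans by (simp only:) blast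
qed

text \<open>As for \<open>normalizes\<close>, rotations lead from each binary shape to the right comb.\<close>

theorem shape_equiv_comb: "binary S \<Longrightarrow> shape_equiv K (leaves S) S (comb_shape (leaves S - 1))"
proof (induction rule: binary_induct)
  case Leaf
  show ?case using shape_equiv_refl[OF comb_shape_binary, of K 0] by simp
next
  case (Node c l r)
  have pos: "leaves l \<ge> 1" "leaves r \<ge> 1" using Node.hyps leaves_pos by auto
  have "shape_equiv K (leaves l + leaves r) (Node () [l, r]) (Node () [comb_shape (leaves l - 1), r])"
    using Node.hyps by (intro shape_equiv_Node_left Node.IH) (simp add: binary_trees_iff)
  moreover have "shape_equiv K (leaves l + leaves r) (Node () [comb_shape (leaves l - 1), r])
      (Node () [comb_shape (leaves l - 1), comb_shape (leaves r - 1)])"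
    using Node.IH(1) by (intro shape_equiv_Node_right Node.IH) (simp add: shape_equiv_def)
  moreover have "shape_equiv K (leaves l + leaves r) (Node () [comb_shape (leaves l - 1), comb_shape (leaves r - 1)])
      (comb_shape (leaves l + leaves r - 1))"
  proof -
    have "leaves l - 1 + (leaves r - 1) + 2 = leaves l + leaves r"
      "leaves l - 1 + (leaves r - 1) + 1 = leaves l + leaves r - 1" using pos by simp_all
    then show ?thesis using shape_equiv_Node_combs[of K "leaves l - 1" "leaves r - 1"] by (simp only:)
  qed
  ultimately have "shape_equiv K (leaves l + leaves r) (Node () [l, r]) (comb_shape (leaves l + leaves r - 1))"
    using shape_equiv_trans by blast
  then show ?case by simp
qed

section \<open>Binary trees and the term of degree zero\<close>

lemma pointer_map: "pointer s (map_ptree f t) = pointer (\<lambda>a. s (f a)) t"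
proof (induction t)
  case (Node a ts)
  then have "map (pointer s) (map (map_ptree f) ts) = map (pointer (\<lambda>a. s (f a))) ts" by simp
  then show ?case unfolding ptree.map pointer.simps by (simp only: take_map map_map comp_def leaves_map)
qed simp

lemma incoming_edge_map [simp]: "incoming_edge k (map (map_ptree f) ts) = incoming_edge k ts"
  by (rule incoming_edge_cong) simp

lemma standard_map: "standard s k (map_ptree f t) \<longleftrightarrow> standard (\<lambda>a. s (f a)) k t"
  and standard_list_map: "standard_list s k (map (map_ptree f) ts) \<longleftrightarrow> standard_list (\<lambda>a. s (f a)) k ts"
  by (induction t and ts arbitrary: k and k rule: ptree_list_induct) (simp_all add: comp_def)

definition side_pair :: "quad_op \<Rightarrow> nat \<times> nat" where
  "side_pair g = (side (fst g), side (snd g))"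

definition side_tree :: "quad_op ptree \<Rightarrow> (nat \<times> nat) ptree" where
  "side_tree = map_ptree side_pair"

definition pointers :: "(nat \<times> nat) ptree \<Rightarrow> nat \<times> nat" where
  "pointers T = (pointer fst T, pointer snd T)"

lemma shape_side_tree [simp]: "shape (side_tree t) = shape t"
  by (simp add: side_tree_def)

lemma pointers_side_tree [simp]: "pointers (side_tree t) = ptr t"
  by (simp add: pointers_def side_tree_def pointer_map ptr_def side_pair_def)

lemma side_pair_bij: "bij_betw side_pair UNIV (square 2)"
proof (rule bij_betw_byWitness[where f' = "\<lambda>p. (if fst p = 1 then Prec else Succ, if snd p = 1 then Prec else Succ)"])
  show "side_pair ` UNIV \<subseteq> square 2"
  proof (rule image_subsetI)
    fix g show "side_pair g \<in> square 2" using side_range[of "fst g"] side_range[of "snd g"]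
      by (auto simp: side_pair_def)
  qed
  have "(if fst (side_pair g) = 1 then Prec else Succ, if snd (side_pair g) = 1 then Prec else Succ) = g" for g
    by (cases g; cases "fst g"; cases "snd g") (auto simp: side_pair_def)
  then show "\<forall>g\<in>UNIV. (if fst (side_pair g) = 1 then Prec else Succ, if snd (side_pair g) = 1 then Prec else Succ) = g"
    by blast
  show "\<forall>p\<in>square 2. side_pair (if fst p = 1 then Prec else Succ, if snd p = 1 then Prec else Succ) = p"
    by (auto simp: side_pair_def)
qed auto

text \<open>In degree 0 the labels in \<open>{1..2}\<^sup>2\<close> are the generators, so the induced basis is the basis of
  labelled binary trees of the free operad.\<close>

lemma side_tree_bij: "bij_betw side_tree (binary_trees n) (bar_trees n 0)"
proof (rule bij_betw_imageI)
  show "inj_on side_tree (binary_trees n)"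
    using side_pair_bij unfolding side_tree_def bij_betw_def
    by (meson inj_on_subset ptree.inj_map subset_UNIV)
  show "side_tree ` binary_trees n = bar_trees n 0"
  proof (intro equalityI subsetI)
    fix T assume "T \<in> side_tree ` binary_trees n"
    then obtain t where t: "T = side_tree t" "binary t" "leaves t = n" by (auto simp: binary_trees_iff)
    have "pair_labelled (side_tree t)" unfolding side_tree_def labelled_in_map
      using t(2) by (rule labelled_in_mono) (use side_pair_bij in \<open>auto simp: bij_betw_def\<close>)
    moreover have "deg (side_tree t) = 0"
      using deg_0_iff[of t] t(2) wf_mono[of _ t] unfolding side_tree_def by (simp add: wf_mono)
    ultimately show "T \<in> bar_trees n 0" using t by (simp add: bar_trees_def pair_trees_iff side_tree_def)
  next
    fix T assume "T \<in> bar_trees n 0"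
    then have T: "pair_labelled T" "leaves T = n" "binary T"
      using bar_treesD deg_0_iff[of T] by blast+
    from T(3,1) have "T \<in> side_tree ` Collect binary"
    proof (induction rule: binary_induct)
      case Leaf
      show ?case by (auto simp: side_tree_def intro!: image_eqI[of _ _ Leaf])
    next
      case (Node p l r)
      then obtain x y where "binary x" "binary y" "l = side_tree x" "r = side_tree y" by auto
      moreover have "p \<in> range side_pair"
        using side_pair_bij Node.prems by (simp add: bij_betw_def numeral_2_eq_2)
      then obtain g where "p = side_pair g" by blast
      ultimately show ?case by (auto simp: side_tree_def intro!: image_eqI[of _ _ "Node g [x, y]"])
    qed
    then show "T \<in> side_tree ` binary_trees n" using T(2) by (auto simp: binary_trees_iff side_tree_def)
  qed
qed

lemma op_generator_base_class: "op_generator (orth quad) g = base_class 2 (side_pair g)"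
proof -
  have "right_comb (2 - 1) (side_pair g) = Node g [Leaf, Leaf]"
    by (cases g; cases "fst g"; cases "snd g") (simp_all add: side_pair_def eval_nat_numeral)
  then show ?thesis by (simp only: op_generator_def base_class_def)
qed

lemma generator_tree_eq: "binary t \<Longrightarrow> map_ptree (op_generator (orth quad)) t = base_tree (side_tree t)"
  by (induction rule: binary_induct)
    (simp_all add: side_tree_def op_generator_base_class numeral_2_eq_2)

lemma bar_element_generators:
  "(\<lambda>t. bar_element n 0 c (map_ptree (op_generator (orth quad)) t)) =
    (\<lambda>t. if t \<in> binary_trees n then c (side_tree t) else (0 :: 'k::field))"
proof
  fix t :: "quad_op ptree"
  let ?D = "map_ptree (op_generator (orth quad)) t :: 'k quad_class ptree"
  show "bar_element n 0 c ?D = (if t \<in> binary_trees n then c (side_tree t) else 0)"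
  proof (cases "t \<in> binary_trees n")
    case True
    then have "?D = base_tree (side_tree t)" by (simp add: generator_tree_eq binary_trees_iff)
    moreover have "side_tree t \<in> bar_trees n 0" using side_tree_bij True by (auto simp: bij_betw_def)
    ultimately show ?thesis using True by (simp add: bar_element_base_tree)
  next
    case False
    have "\<not> (?D \<in> ltrees (classes TYPE('k)) n \<and> deg ?D = 0)"
    proof
      assume D: "?D \<in> ltrees (classes TYPE('k)) n \<and> deg ?D = 0"
      then have "wf_tree ?D" by (auto simp: ltrees_def intro: wf_mono)
      then have "binary ?D" using D deg_0_iff[of ?D] by simp
      then have "binary t" by (metis binary_shape shape_map)
      then show False using D False by (simp add: binary_trees_iff ltrees_def)
    qed
    from bar_element_outside[OF this] show ?thesis using False by simp
  qed
qed

section \<open>The embedding of the labelled copies\<close>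

text \<open>The basis element of the labelled copies in whose image the tree \<open>T\<close> occurs.\<close>

definition cell :: "(nat \<times> nat) ptree \<Rightarrow> qa_cell" where
  "cell T = (pointers T, pair_labelling (fst (pointers T)) (snd (pointers T)) (shape T))"

definition standard_pair :: "(nat \<times> nat) ptree \<Rightarrow> bool" where
  "standard_pair T \<longleftrightarrow> standard fst (fst (pointers T)) T \<and> standard snd (snd (pointers T)) T"

lemma pair_labelled_pointed:
  assumes "pair_labelled T"
  shows "pointed fst T" "pointed snd T"
  using assms by (rule labelled_in_mono, auto)+

lemma pointers_range: "T \<in> pair_trees n \<Longrightarrow> pointers T \<in> square n"
  using pointer_range[OF pair_labelled_pointed(1)] pointer_range[OF pair_labelled_pointed(2)]
  by (auto simp: pointers_def pair_trees_iff)

lemma shape_in_trees: "T \<in> pair_trees n \<Longrightarrow> shape T \<in> trees n"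
  by (auto simp: trees_def ltrees_def pair_trees_iff labelled_in_shape intro: wf_mono)

lemma treesD: "S \<in> trees n \<Longrightarrow> wf_tree S \<and> leaves S = n"
  by (auto simp: trees_def ltrees_def)

lemma qa_basis_iff: "((i, j), X) \<in> qa_basis n \<longleftrightarrow> (i, j) \<in> square n \<and> X \<in> pair_labelling i j ` trees n"
  by (simp add: qa_basis_def)

lemma deg_cell [simp]: "deg (snd (cell T)) = deg T"
  by (simp add: cell_def)

lemma cell_in_qa_basis: "T \<in> pair_trees n \<Longrightarrow> cell T \<in> qa_basis n"
  using pointers_range[of T n] shape_in_trees[of T n]
  by (cases "pointers T") (auto simp: cell_def qa_basis_iff)

lemma standard_tree_cell:
  assumes "S \<in> trees n" "(i, j) \<in> square n"
  shows "standard_tree i j S \<in> pair_trees n" "pointers (standard_tree i j S) = (i, j)"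
    "standard_pair (standard_tree i j S)" "cell (standard_tree i j S) = ((i, j), pair_labelling i j S)"
proof -
  let ?T = "standard_tree i j S"
  have wf: "wf_tree ?T" using treesD[OF assms(1)] labelled_in_shape[of ?T] by simp
  have l: "leaves ?T = n" using treesD[OF assms(1)] by simp
  have st: "standard fst i ?T" "standard snd j ?T" using standard_standard_tree by blast+
  show p: "pointers ?T = (i, j)"
    using standard_pointer[OF st(1)] standard_pointer[OF st(2)] assms(2) l by (simp add: pointers_def)
  have "pair_labelled T" if "pointed fst T" "pointed snd T" for T
    using that by (induction T) (auto simp: mem_Times_iff)
  then show "?T \<in> pair_trees n"
    using standard_pointed[OF wf] st l by (auto simp: pair_trees_iff)
  show "standard_pair ?T" using st p by (simp add: standard_pair_def)
  show "cell ?T = ((i, j), pair_labelling i j S)" by (simp add: cell_def p)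
qed

lemma qa_basis_standard:
  assumes "x \<in> qa_basis n"
  obtains T where "T \<in> pair_trees n" "standard_pair T" "cell T = x"
proof -
  obtain i j X where x: "x = ((i, j), X)" by (metis surj_pair)
  then obtain S where "S \<in> trees n" "(i, j) \<in> square n" "X = pair_labelling i j S"
    using assms by (auto simp: qa_basis_iff)
  with standard_tree_cell[of S n i j] that x show ?thesis by blast
qed

text \<open>The standard trees are a section of \<open>cell\<close>: together with \<open>qa_basis_standard\<close>, each cell contains
  exactly one.\<close>

lemma standard_pair_unique:
  assumes "standard_pair T" "standard_pair T'" "cell T = cell T'"
  shows "T = T'"
proof -
  have p: "pointers T = pointers T'" using assms(3) by (simp add: cell_def)
  have "shape (snd (cell T)) = shape T" for T by (simp add: cell_def)
  then have "shape T = shape T'" using assms(3) by metis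
  then show ?thesis using standard_tree_unique[of "fst (pointers T)" T "snd (pointers T)"]
      standard_tree_unique[of "fst (pointers T)" T' "snd (pointers T)"] assms(1,2) p
    unfolding standard_pair_def by metis
qed

lemma contract_pairs_properties:
  assumes "T \<in> pair_trees n" "e \<in> internal_edges T"
  shows "contract_pairs T e \<in> pair_trees n" "deg (contract_pairs T e) = deg T - 1"
    "shape (contract_pairs T e) = contract_shape (shape T) e"
    "pointers (contract_pairs T e) = pointers T"
    "standard_pair T \<Longrightarrow> standard_pair (contract_pairs T e)"
proof -
  have T: "pair_labelled T" "leaves T = n" using assms(1) by (auto simp: pair_trees_iff)
  have "quad_comp i l a b \<in> square (m + l - 1)" if "i < m" "a \<in> square m" "b \<in> square l" for m i l a b
    using dias_comp_range[of i m "fst a" "fst b" l] dias_comp_range[of i m "snd a" "snd b" l] that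
    by (auto simp: quad_comp_def)
  then have "pair_labelled (contract_pairs T e)"
    unfolding contract_pairs_def by (intro labelled_in_contract assms(2) T(1)) blast
  then show "contract_pairs T e \<in> pair_trees n"
    using T(2) assms(2) by (simp add: pair_trees_iff contract_pairs_def)
  show "deg (contract_pairs T e) = deg T - 1" "shape (contract_pairs T e) = contract_shape (shape T) e"
    using assms(2) by (simp_all add: contract_pairs_def deg_contract shape_contract)
  show p: "pointers (contract_pairs T e) = pointers T"
    unfolding pointers_def contract_pairs_def
    using pointer_contract[OF assms(2) pair_labelled_pointed(1)[OF T(1)], of "\<lambda>m i n. quad_comp i n"]
      pointer_contract[OF assms(2) pair_labelled_pointed(2)[OF T(1)], of "\<lambda>m i n. quad_comp i n"]
    by (simp add: quad_comp_def)
  assume "standard_pair T"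
  then show "standard_pair (contract_pairs T e)"
    unfolding standard_pair_def p unfolding contract_pairs_def
    using standard_contract[OF assms(2), of fst _ "\<lambda>m i n. quad_comp i n"]
      standard_contract[OF assms(2), of snd _ "\<lambda>m i n. quad_comp i n"]
    by (simp add: quad_comp_def)
qed

lemma sum_copy:
  assumes "(i, j) \<in> square n"
  shows "(\<Sum>X | ((i, j), X) \<in> qa_basis n \<and> deg X = d. h X) =
    (\<Sum>S | S \<in> trees n \<and> deg S = d. h (pair_labelling i j S))"
proof -
  have "{X. ((i, j), X) \<in> qa_basis n \<and> deg X = d} = pair_labelling i j ` {S. S \<in> trees n \<and> deg S = d}"
    using assms by (auto simp: qa_basis_iff)
  moreover have "inj_on (pair_labelling i j) {S. S \<in> trees n \<and> deg S = d}"
    by (rule inj_onI) (metis shape_pair_labelling shape_unit)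
  ultimately show ?thesis by (simp add: sum.reindex)
qed

text \<open>The coefficient of each tree is the coefficient of its cell. So a cell is mapped to the sum of all
  labelled trees which belong to it, that is, all ways of replacing the labels \<open>*\<close> by numbers.\<close>

definition embed :: "nat \<Rightarrow> int \<Rightarrow> (qa_cell \<Rightarrow> 'k::field) \<Rightarrow> 'k quad_class ptree \<Rightarrow> 'k" where
  "embed n d F = bar_element n d (\<lambda>T. F (cell T))"

text \<open>Any binary shape could replace the right comb, by \<open>shape_equiv_comb\<close>.\<close>

definition embed_aug :: "nat \<Rightarrow> (nat \<times> nat \<Rightarrow> 'k::field) \<Rightarrow> 'k quad_class" where
  "embed_aug n H = cls (quad_ideal n) (labelling_sum (comb_shape (n - 1)) H)"

text \<open>
  One differential is a sum over the edges of \<open>T\<close>, the other one a sum over all shapes. They agree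
  as contraction is injective on edges, preserves the pointers of \<open>T\<close>, and reaches all shapes with
  non-zero incidence number.
\<close>

lemma pair_diff_cell:
  assumes "incidence \<epsilon>" "T \<in> bar_trees n (d + 1)"
  shows "pair_diff \<epsilon> (\<lambda>T. F (cell T)) T = qa_diff \<epsilon> n d F (cell T)"
proof -
  obtain i j where p: "pointers T = (i, j)" by (metis surj_pair)
  have T: "T \<in> pair_trees n" "deg T = d + 1" using assms(2) by (auto simp: bar_trees_def)
  have sq: "(i, j) \<in> square n" using pointers_range[OF T(1)] p by simp
  have S: "shape T \<in> trees n" using shape_in_trees[OF T(1)] .
  let ?h = "\<lambda>S. of_int (\<epsilon> S (shape T)) * F ((i, j), pair_labelling i j S)"
  have inj: "inj_on (contract_shape (shape T)) (internal_edges T)"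
    using contract_shape_inj[of "\<lambda>_. UNIV" "shape T"] treesD[OF S]
    by (intro inj_onI) (simp add: contract_shape_def)
  have "pair_diff \<epsilon> (\<lambda>T. F (cell T)) T = (\<Sum>e\<in>internal_edges T. ?h (contract_shape (shape T) e))"
    unfolding pair_diff_def
    by (intro sum.cong refl)
      (simp add: cell_def contract_pairs_properties[OF T(1)] p)
  also have "\<dots> = (\<Sum>S\<in>contract_shape (shape T) ` internal_edges T. ?h S)"
    by (simp add: sum.reindex[OF inj])
  also have "\<dots> = (\<Sum>S | S \<in> trees n \<and> deg S = d. ?h S)"
  proof (rule sum.mono_neutral_left)
    show "contract_shape (shape T) ` internal_edges T \<subseteq> {S. S \<in> trees n \<and> deg S = d}"
    proof (intro image_subsetI CollectI conjI)
      fix e assume e: "e \<in> internal_edges T"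
      note c = contract_pairs_properties[OF T(1) e]
      show "contract_shape (shape T) e \<in> trees n" using shape_in_trees[OF c(1)] c(3) by simp
      show "deg (contract_shape (shape T) e) = d"
        using c(2) T(2) deg_shape[of "contract_pairs T e"] unfolding c(3) by simp
    qed
    show "\<forall>S\<in>{S. S \<in> trees n \<and> deg S = d} - contract_shape (shape T) ` internal_edges T. ?h S = 0"
    proof
      fix U assume U: "U \<in> {S. S \<in> trees n \<and> deg S = d} - contract_shape (shape T) ` internal_edges T"
      then have "\<not> (\<exists>e\<in>internal_edges (shape T). U = contract_shape (shape T) e)" by auto
      moreover have "if \<exists>e\<in>internal_edges (shape T). U = contract_shape (shape T) e
          then \<epsilon> U (shape T) \<in> {1, -1} else \<epsilon> U (shape T) = 0"
        using assms(1) U S unfolding incidence_def by blast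
      ultimately have "\<epsilon> U (shape T) = 0" by simp
      then show "?h U = 0" by simp
    qed
  qed simp
  also have "\<dots> = qa_diff \<epsilon> n d F (cell T)"
    using cell_in_qa_basis[OF T(1)] T(2) sum_copy[OF sq, where d = d and h = "\<lambda>X. of_int (\<epsilon> (shape X) (shape T)) * F ((i, j), X)"]
    by (simp add: qa_diff_def cell_def p)
  finally show ?thesis .
qed

lemma labelling_sum_cong:
  "S \<in> binary_trees n \<Longrightarrow> (\<And>p. p \<in> square n \<Longrightarrow> w p = w' p) \<Longrightarrow> labelling_sum S w = labelling_sum S w'"
  using labellings_binary_trees[of S n] ptr_range
  unfolding labelling_sum_def by (intro sum.cong refl arg_cong2[where f = fscale]) blast+

lemma comb_shape_pred: "n \<ge> 1 \<Longrightarrow> comb_shape (n - 1) \<in> binary_trees n"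
  using comb_shape_binary[of "n - 1"] by simp

lemma trees_deg_0: "{S. S \<in> trees n \<and> deg S = 0} = binary_trees n"
proof -
  have "wf_tree S \<and> deg S = 0 \<longleftrightarrow> binary S" for S :: "unit ptree"
    using deg_0_iff[of S] wf_mono[of _ S] by blast
  then show ?thesis by (auto simp: trees_def ltrees_def binary_trees_iff)
qed

text \<open>An element of degree 0 is sent to a sum of labelling sums of various binary shapes, and each of
  them may be replaced by that of the right comb.\<close>

lemma embed_aug_augmentation:
  assumes "n \<ge> 1"
  shows "embed_aug n (\<lambda>ij. \<Sum>X | (ij, X) \<in> qa_basis n \<and> deg X = 0. F (ij, X)) =
    cls (quad_ideal n) (\<lambda>t. embed n 0 F (map_ptree (op_generator (orth quad)) t) :: 'k::field)"
proof -
  define w where "w S p = F (p, pair_labelling (fst p) (snd p) S)" for S :: "unit ptree" and p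
  let ?B = "binary_trees n :: unit ptree set"
  have "labelling_sum (comb_shape (n - 1)) (\<lambda>ij. \<Sum>X | (ij, X) \<in> qa_basis n \<and> deg X = 0. F (ij, X)) =
      labelling_sum (comb_shape (n - 1)) (\<lambda>p. \<Sum>S\<in>?B. w S p)"
  proof (rule labelling_sum_cong[OF comb_shape_pred[OF assms]])
    fix p assume "p \<in> square n"
    then show "(\<Sum>X | (p, X) \<in> qa_basis n \<and> deg X = 0. F (p, X)) = (\<Sum>S\<in>?B. w S p)"
      using sum_copy[of "fst p" "snd p" n, where d = 0 and h = "\<lambda>X. F (p, X)"] by (simp add: w_def trees_deg_0)
  qed
  also have "\<dots> = (\<Sum>S\<in>?B. labelling_sum (comb_shape (n - 1)) (w S))"
    by (rule ext) (simp add: sum_apply labelling_sum_apply)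
  finally have 1: "labelling_sum (comb_shape (n - 1)) (\<lambda>ij. \<Sum>X | (ij, X) \<in> qa_basis n \<and> deg X = 0. F (ij, X)) =
      (\<Sum>S\<in>?B. labelling_sum (comb_shape (n - 1)) (w S))" .
  have 2: "(\<lambda>t. embed n 0 F (map_ptree (op_generator (orth quad)) t)) = (\<Sum>S\<in>?B. labelling_sum S (w S))"
    unfolding embed_def bar_element_generators
  proof
    fix t :: "quad_op ptree"
    have "(\<Sum>S\<in>?B. labelling_sum S (w S)) t = (\<Sum>S\<in>?B. if S = shape t then (if binary t then w (shape t) (ptr t) else 0) else 0)"
      unfolding sum_apply by (intro sum.cong refl) (auto simp: labelling_sum_apply labellings_def)
    also have "\<dots> = (if t \<in> binary_trees n then F (cell (side_tree t)) else 0)"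
      by (auto simp: binary_trees_iff binary_shape cell_def w_def)
    finally show "(if t \<in> binary_trees n then F (cell (side_tree t)) else 0) = (\<Sum>S\<in>?B. labelling_sum S (w S)) t" ..
  qed
  have "(\<Sum>S\<in>?B. labelling_sum S (w S) - labelling_sum (comb_shape (n - 1)) (w S)) \<in> quad_ideal n"
  proof (rule fun_vs.subspace_sum[OF subspace_op_ideal])
    fix S assume "S \<in> ?B"
    then show "labelling_sum S (w S) - labelling_sum (comb_shape (n - 1)) (w S) \<in> quad_ideal n"
      using shape_equiv_comb[of S "TYPE('k)"] by (simp add: shape_equiv_def binary_trees_iff)
  qed
  then show ?thesis unfolding embed_aug_def 1 2
    by (subst eq_commute) (simp only: cls_eq_iff[OF subspace_op_ideal] sum_subtractf)
qed

lemma labelling_sum_add: "labelling_sum S w + labelling_sum S w' = labelling_sum S (w + w')"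
  by (rule ext) (simp add: labelling_sum_apply)

lemma labelling_sum_scale: "fscale c (labelling_sum S w) = labelling_sum S (fscale c w)"
  by (rule ext) (simp add: labelling_sum_apply)

lemma chain_map_embed:
  assumes "incidence \<epsilon>" "n \<ge> 1"
  shows "chain_map (QA \<epsilon> n) (dual_bar_complex \<epsilon> (quad :: ('k::field) quad_relations) n) (embed n) (embed_aug n)"
  unfolding chain_map_def
proof (intro conjI allI impI ballI)
  fix d :: int
  show "linear_map (spc (QA \<epsilon> n) d) (spc (dual_bar_complex \<epsilon> (quad :: 'k quad_relations) n) d) (embed n d)"
    by (simp add: linear_map_def QA_def dual_bar_complex_def fun_space_def bar_space_eq embed_def
        bar_element_add bar_element_scale)
next
  have "labelling_sum (comb_shape (n - 1)) w \<in> free_operad n" for w :: "_ \<Rightarrow> 'k"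
    by (rule labelling_sum_free[OF comb_shape_pred[OF assms(2)]])
  then show "linear_map (aspc (QA \<epsilon> n)) (aspc (dual_bar_complex \<epsilon> (quad :: 'k quad_relations) n)) (embed_aug n)"
    by (auto simp: linear_map_def QA_def dual_bar_complex_def fun_space_def embed_aug_def car_operad
        vadd_operad vscale_operad labelling_sum_add labelling_sum_scale)
next
  fix d :: int and F :: "qa_cell \<Rightarrow> 'k"
  have "bar_element n (d + 1) (pair_diff \<epsilon> (\<lambda>T. F (cell T))) = bar_element n (d + 1) (\<lambda>T. qa_diff \<epsilon> n d F (cell T))"
    using pair_diff_cell[OF assms(1)] by (intro bar_element_cong) blast
  then show "embed n (d + 1) (df (QA \<epsilon> n) d F) = df (dual_bar_complex \<epsilon> quad n) d (embed n d F)"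
    by (simp add: QA_def dual_bar_complex_def embed_def bar_diff_bar_element)
next
  fix F :: "qa_cell \<Rightarrow> 'k"
  show "embed_aug n (aug (QA \<epsilon> n) F) = aug (dual_bar_complex \<epsilon> quad n) (embed n 0 F)"
    using embed_aug_augmentation[OF assms(2), of F] by (simp add: QA_def dual_bar_complex_def)
qed

subsection \<open>The complement\<close>

text \<open>The values at the base trees are the coefficients, so those at the standard trees are required
  to vanish.\<close>

definition complement :: "nat \<Rightarrow> int \<Rightarrow> (('k::field) quad_class ptree \<Rightarrow> 'k) set" where
  "complement n d = {x \<in> range (bar_element n d). \<forall>T\<in>bar_trees n d. standard_pair T \<longrightarrow> x (base_tree T) = 0}"

lemma bar_element_in_complement:
  "bar_element n d c \<in> complement n d \<longleftrightarrow> (\<forall>T\<in>bar_trees n d. standard_pair T \<longrightarrow> c T = 0)"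
  by (auto simp: complement_def bar_element_base_tree)

definition aug_complement :: "nat \<Rightarrow> ('k::field) quad_class set" where
  "aug_complement n = {cls (quad_ideal n) x | x. x \<in> free_operad n \<and> (\<forall>p\<in>square n. standard_weight n p x = 0)}"

text \<open>Each cell contains a standard tree, so the coefficients of an image at the standard trees
  determine the element.\<close>

lemma embed_determined:
  assumes "F \<in> supported_on {x \<in> qa_basis n. deg (snd x) = d}" "F' \<in> supported_on {x \<in> qa_basis n. deg (snd x) = d}"
    and "\<And>T. T \<in> bar_trees n d \<Longrightarrow> standard_pair T \<Longrightarrow> F (cell T) = F' (cell T)"
  shows "F = F'"
proof
  fix x
  show "F x = F' x"
  proof (cases "x \<in> qa_basis n \<and> deg (snd x) = d")
    case True
    then obtain T where T: "T \<in> pair_trees n" "standard_pair T" "cell T = x" using qa_basis_standard by blast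
    then have "T \<in> bar_trees n d" using True deg_cell[of T] by (simp add: bar_trees_def)
    then show ?thesis using assms(3) T by blast
  next
    case False
    then have "x \<notin> {x \<in> qa_basis n. deg (snd x) = d}" by simp
    then have "F x = 0" "F' x = 0" using assms(1,2) unfolding supported_on_def by blast+
    then show ?thesis by simp
  qed
qed

text \<open>The standard weights are a left inverse of the embedding in degree 1, as the right comb has
  exactly one standard labelling for each pair of leaves.\<close>

lemma standard_weight_comb:
  assumes "n \<ge> 1" "p \<in> square n"
  shows "standard_weight n p (labelling_sum (comb_shape (n - 1)) H) = (H p :: 'k::field)"
proof -
  let ?c = "comb_shape (n - 1)"
  have c: "?c \<in> trees n" "deg ?c = 0" using comb_shape_pred[OF assms(1)] trees_deg_0[of n] by blast+
  let ?T = "standard_tree (fst p) (snd p) ?c"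
  have T: "?T \<in> pair_trees n" "pointers ?T = p" "standard_pair ?T" "deg ?T = 0"
    using standard_tree_cell[OF c(1), of "fst p" "snd p"] assms(2) c(2) deg_shape[of ?T] by auto
  then obtain t0 where t0: "t0 \<in> binary_trees n" "side_tree t0 = ?T"
    using side_tree_bij[of n] unfolding bij_betw_def bar_trees_def by (metis (mono_tags, lifting) image_iff mem_Collect_eq)
  have st: "standard_at p t \<longleftrightarrow> standard fst (fst p) (side_tree t) \<and> standard snd (snd p) (side_tree t)" for t
    by (simp add: standard_at_def side_tree_def standard_map side_pair_def)
  have key: "standard_at p t \<and> shape t = ?c \<longleftrightarrow> t = t0" if t: "t \<in> binary_trees n" for t
  proof
    assume "standard_at p t \<and> shape t = ?c"
    then have "side_tree t = ?T"
      using standard_tree_unique[of "fst p" "side_tree t" "snd p"] st by simp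
    then show "t = t0" using side_tree_bij[of n] t t0 unfolding bij_betw_def inj_on_def by metis
  next
    assume "t = t0"
    moreover have "shape t0 = ?c" using shape_side_tree[of t0] t0(2) by simp
    ultimately show "standard_at p t \<and> shape t = ?c"
      using st[of t0] t0(2) T(2,3) by (simp add: standard_pair_def)
  qed
  have "ptr t0 = p" using pointers_side_tree[of t0] t0(2) T(2) by simp
  then have "standard_weight n p (labelling_sum ?c H) = (\<Sum>t\<in>binary_trees n. if t = t0 then H p else 0)"
    unfolding standard_weight_def weight_def
    using key by (intro sum.cong refl) (auto simp: labelling_sum_apply labellings_def binary_trees_iff)
  then show ?thesis using t0(1) by simp
qed

text \<open>Given an element, its coefficients at the standard trees are those of a unique element of the
  image; the difference has coefficients zero there.\<close>

lemma direct_sum_embed: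
  "direct_sum (fun_space (bar_space (orth (quad :: ('k::field) quad_relations)) n d))
    (embed n d ` supported_on {x \<in> qa_basis n. deg (snd x) = d}) (complement n d)"
  unfolding direct_sum_def
proof (intro conjI ballI)
  let ?V = "fun_space (bar_space (orth (quad :: 'k quad_relations)) n d)"
  let ?S = "supported_on {x \<in> qa_basis n. deg (snd x) = d} :: (qa_cell \<Rightarrow> 'k) set"
  have embed_ops: "embed n d F + embed n d F' = embed n d (F + F')" "fscale a (embed n d F) = embed n d (fscale a F)"
    for F F' :: "qa_cell \<Rightarrow> 'k" and a by (simp_all add: embed_def bar_element_add bar_element_scale)
  show "vsubspace ?V (embed n d ` ?S)"
    unfolding vsubspace_def
  proof (intro conjI ballI allI)
    show "embed n d ` ?S \<subseteq> car ?V" by (auto simp: fun_space_def bar_space_eq embed_def)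
    have "(0 :: qa_cell \<Rightarrow> 'k) \<in> ?S" by (simp add: supported_on_def)
    then show "embed n d ` ?S \<noteq> {}" by blast
  qed (auto simp: fun_space_def embed_ops intro!: imageI supported_on_add supported_on_scale)
  show "vsubspace ?V (complement n d)"
    unfolding vsubspace_def
  proof (intro conjI ballI allI)
    have "bar_element n d (\<lambda>_. 0) \<in> (complement n d :: ('k quad_class ptree \<Rightarrow> 'k) set)"
      by (simp add: bar_element_in_complement)
    then show "(complement n d :: ('k quad_class ptree \<Rightarrow> 'k) set) \<noteq> {}" by blast
  qed (auto simp: fun_space_def bar_space_eq complement_def bar_element_add bar_element_scale)
  fix x assume "x \<in> car ?V"
  then obtain c where x: "x = bar_element n d c" by (auto simp: fun_space_def bar_space_eq)
  \<comment> \<open>The coefficient at a cell is that at its standard tree.\<close>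
  define F where "F z = (if z \<in> qa_basis n \<and> deg (snd z) = d
    then c (SOME T. T \<in> pair_trees n \<and> standard_pair T \<and> cell T = z) else 0)" for z
  have F: "F (cell T) = c T" if "T \<in> bar_trees n d" "standard_pair T" for T
  proof -
    have T: "T \<in> pair_trees n" "deg T = d" using that by (auto simp: bar_trees_def)
    have "(SOME T'. T' \<in> pair_trees n \<and> standard_pair T' \<and> cell T' = cell T) = T"
      using T(1) that(2) standard_pair_unique by (intro some_equality) auto
    then show ?thesis using cell_in_qa_basis[OF T(1)] T(2) by (simp add: F_def)
  qed
  have FS: "F \<in> ?S" by (auto simp: supported_on_def F_def)
  let ?r = "bar_element n d (\<lambda>T. c T - F (cell T))"
  have sum: "x = embed n d F + ?r" by (simp add: x embed_def bar_element_add)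
  have r: "?r \<in> complement n d" using F by (simp add: bar_element_in_complement)
  show "\<exists>!p. p \<in> embed n d ` ?S \<times> complement n d \<and> x = vadd ?V (fst p) (snd p)"
  proof (rule ex1I[of _ "(embed n d F, ?r)"])
    show "(embed n d F, ?r) \<in> embed n d ` ?S \<times> complement n d \<and>
        x = vadd ?V (fst (embed n d F, ?r)) (snd (embed n d F, ?r))"
      using FS r sum by (auto simp: fun_space_def)
    fix p assume p: "p \<in> embed n d ` ?S \<times> complement n d \<and> x = vadd ?V (fst p) (snd p)"
    then obtain F' where F': "F' \<in> ?S" "fst p = embed n d F'" and c: "snd p \<in> complement n d"
      by (auto simp: mem_Times_iff)
    have eq: "x = embed n d F' + snd p" using p F' by (simp add: fun_space_def)
    have "F' = F"
    proof (rule embed_determined[OF F'(1) FS])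
      fix T assume T: "T \<in> bar_trees n d" "standard_pair T"
      have "x (base_tree T) = embed n d F' (base_tree T) + snd p (base_tree T)" by (simp add: eq)
      then show "F' (cell T) = F (cell T)"
        using F[OF T] c T by (simp add: x embed_def bar_element_base_tree complement_def)
    qed
    moreover from this eq sum have "snd p = ?r" by simp
    ultimately show "p = (embed n d F, ?r)" using F' by (simp add: prod_eq_iff)
  qed
qed

lemma standard_weight_add: "standard_weight n p (x + y) = standard_weight n p x + standard_weight n p y"
  by (simp add: standard_weight_def weight_add)

lemma standard_weight_diff: "standard_weight n p (x - y) = standard_weight n p x - standard_weight n p y"
  by (simp add: standard_weight_def weight_diff)

lemma standard_weight_scale: "standard_weight n p (fscale c x) = c * standard_weight n p x"
  by (simp add: standard_weight_def weight_scale)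

text \<open>The same argument as in degrees \<open>\<le> 0\<close>, with the standard weights in place of the coefficients at
  the standard trees.\<close>

lemma direct_sum_embed_aug:
  assumes "n \<ge> 1"
  shows "direct_sum (operad (quad :: ('k::field) quad_relations) n)
    (embed_aug n ` supported_on (square n)) (aug_complement n)"
  unfolding direct_sum_def
proof (intro conjI ballI)
  let ?V = "operad (quad :: 'k quad_relations) n" and ?cls = "cls (op_ideal (quad :: 'k quad_relations) n)"
  let ?L = "labelling_sum (comb_shape (n - 1)) :: _ \<Rightarrow> _ \<Rightarrow> 'k"
  have L: "?L H \<in> free_operad n" for H by (rule labelling_sum_free[OF comb_shape_pred[OF assms]])
  show "vsubspace ?V (embed_aug n ` supported_on (square n))"
    unfolding vsubspace_def
  proof (intro conjI ballI allI)
    show "embed_aug n ` supported_on (square n) \<subseteq> car ?V" using L by (auto simp: embed_aug_def car_operad)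
    have "(0 :: nat \<times> nat \<Rightarrow> 'k) \<in> supported_on (square n)" by (simp add: supported_on_def)
    then show "embed_aug n ` (supported_on (square n) :: (_ \<Rightarrow> 'k) set) \<noteq> {}" by blast
  qed (auto simp: embed_aug_def vadd_operad vscale_operad labelling_sum_add labelling_sum_scale
      intro!: imageI supported_on_add supported_on_scale)
  show "vsubspace ?V (aug_complement n)"
    unfolding vsubspace_def
  proof (intro conjI ballI allI)
    show "aug_complement n \<subseteq> car ?V" by (auto simp: aug_complement_def car_operad)
    have "?cls 0 \<in> aug_complement n"
      unfolding aug_complement_def by (auto simp: standard_weight_def supported_on_def intro!: exI[of _ 0])
    then show "aug_complement n \<noteq> ({} :: 'k quad_class set)" by blast
  next
    fix A B :: "'k quad_class"
    assume "A \<in> aug_complement n" "B \<in> aug_complement n"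
    then obtain x y where "A = ?cls x" "x \<in> free_operad n" "\<forall>p\<in>square n. standard_weight n p x = 0"
      "B = ?cls y" "y \<in> free_operad n" "\<forall>p\<in>square n. standard_weight n p y = 0"
      unfolding aug_complement_def by blast
    then show "vadd ?V A B \<in> aug_complement n"
      unfolding aug_complement_def
      by (auto simp: vadd_operad standard_weight_add supported_on_add intro!: exI[of _ "x + y"])
  next
    fix A :: "'k quad_class" and a
    assume "A \<in> aug_complement n"
    then obtain x where "A = ?cls x" "x \<in> free_operad n" "\<forall>p\<in>square n. standard_weight n p x = 0"
      unfolding aug_complement_def by blast
    then show "vscale ?V a A \<in> aug_complement n"
      unfolding aug_complement_def
      by (auto simp: vscale_operad standard_weight_scale supported_on_scale intro!: exI[of _ "fscale a x"])
  qed
  fix A assume "A \<in> car ?V"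
  then obtain x where x: "x \<in> free_operad n" "A = ?cls x" by (auto simp: car_operad)
  define H where "H p = (if p \<in> square n then standard_weight n p x else 0)" for p
  have HS: "H \<in> supported_on (square n)" by (auto simp: supported_on_def H_def)
  let ?y = "x - ?L H"
  have yf: "?y \<in> free_operad n" using x(1) L by (rule supported_on_diff)
  have y0: "standard_weight n p ?y = 0" if "p \<in> square n" for p
    using standard_weight_comb[OF assms that, of H] that by (simp add: standard_weight_diff H_def)
  have sum: "A = vadd ?V (embed_aug n H) (?cls ?y)" by (simp add: embed_aug_def vadd_operad x(2))
  have r: "?cls ?y \<in> aug_complement n" using yf y0 unfolding aug_complement_def by blast
  show "\<exists>!p. p \<in> embed_aug n ` supported_on (square n) \<times> aug_complement n \<and> A = vadd ?V (fst p) (snd p)"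
  proof (rule ex1I[of _ "(embed_aug n H, ?cls ?y)"])
    show "(embed_aug n H, ?cls ?y) \<in> embed_aug n ` supported_on (square n) \<times> aug_complement n \<and>
        A = vadd ?V (fst (embed_aug n H, ?cls ?y)) (snd (embed_aug n H, ?cls ?y))"
      using HS r sum by simp
    fix p assume p: "p \<in> embed_aug n ` supported_on (square n) \<times> aug_complement n \<and> A = vadd ?V (fst p) (snd p)"
    then obtain H' z where H': "H' \<in> supported_on (square n)" "fst p = embed_aug n H'"
      and z: "snd p = ?cls z" "z \<in> free_operad n" "\<forall>q\<in>square n. standard_weight n q z = 0"
      unfolding aug_complement_def by (auto simp: mem_Times_iff)
    have eq: "?cls x = ?cls (?L H' + z)" using p H' z by (simp add: x(2) embed_aug_def vadd_operad)
    have "H' q = H q" for q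
    proof (cases "q \<in> square n")
      case True
      have "standard_weight n q x = standard_weight n q (?L H' + z)" by (rule standard_weight_cls[OF eq])
      moreover have "standard_weight n q z = 0" using True z(3) by blast
      ultimately show ?thesis using True standard_weight_comb[OF assms True, of H']
        by (simp add: standard_weight_add H_def)
    next
      case False
      then have "H' q = 0" "H q = 0" using H'(1) HS unfolding supported_on_def by blast+
      then show ?thesis by simp
    qed
    then have HH: "H' = H" by (rule ext)
    have "z - ?y = - (x - (?L H' + z))" by (simp add: HH)
    also have "\<dots> \<in> quad_ideal n"
      using eq unfolding cls_eq_iff[OF subspace_op_ideal] by (rule fun_vs.subspace_neg[OF subspace_op_ideal])
    finally have "?cls z = ?cls ?y" unfolding cls_eq_iff[OF subspace_op_ideal] .
    then show "p = (embed_aug n H, ?cls ?y)" using H' z HH by (simp add: prod_eq_iff)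
  qed
qed

text \<open>The complements form a subcomplex: contractions of standard trees are standard, and in degree 0
  the standard weights are sums of coefficients at standard trees.\<close>

lemma embeds:
  assumes "n \<ge> 1"
  shows "embeds_as_direct_summand (QA \<epsilon> n) (dual_bar_complex \<epsilon> (quad :: ('k::field) quad_relations) n)
    (embed n) (embed_aug n)"
  unfolding embeds_as_direct_summand_def
proof (intro conjI allI impI exI[of _ "complement n"] exI[of _ "aug_complement n"])
  fix d :: int
  show "inj_on (embed n d :: _ \<Rightarrow> 'k quad_class ptree \<Rightarrow> 'k) (car (spc (QA \<epsilon> n) d))"
  proof (rule inj_onI)
    fix F F' :: "qa_cell \<Rightarrow> 'k"
    assume "F \<in> car (spc (QA \<epsilon> n) d)" "F' \<in> car (spc (QA \<epsilon> n) d)" and eq: "embed n d F = embed n d F'"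
    moreover have "F (cell T) = F' (cell T)" if "T \<in> bar_trees n d" for T
      using eq bar_element_base_tree[OF that, of "\<lambda>T. F (cell T)"] bar_element_base_tree[OF that, of "\<lambda>T. F' (cell T)"]
      by (simp add: embed_def)
    ultimately show "F = F'" by (intro embed_determined) (auto simp: QA_def fun_space_def)
  qed
  show "direct_sum (spc (dual_bar_complex \<epsilon> (quad :: 'k quad_relations) n) d)
      (embed n d ` car (spc (QA \<epsilon> n) d)) (complement n d)"
    using direct_sum_embed[of n d] by (simp add: QA_def dual_bar_complex_def fun_space_def)
  show "df (dual_bar_complex \<epsilon> (quad :: 'k quad_relations) n) d ` complement n d \<subseteq> complement n (d + 1)"
  proof (rule image_subsetI)
    fix x :: "'k quad_class ptree \<Rightarrow> 'k" assume "x \<in> complement n d"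
    then obtain c where x: "x = bar_element n d c" by (auto simp: complement_def)
    with \<open>x \<in> complement n d\<close> have c: "\<forall>T\<in>bar_trees n d. standard_pair T \<longrightarrow> c T = 0"
      by (simp add: bar_element_in_complement)
    have "pair_diff \<epsilon> c T = 0" if T: "T \<in> bar_trees n (d + 1)" "standard_pair T" for T
      unfolding pair_diff_def
    proof (rule sum.neutral, rule ballI)
      fix e assume e: "e \<in> internal_edges T"
      have "T \<in> pair_trees n" "deg T = d + 1" using T(1) by (auto simp: bar_trees_def)
      then have "c (contract_pairs T e) = 0"
        using contract_pairs_properties[OF _ e] T(2) c by (simp add: bar_trees_def)
      then show "of_int (\<epsilon> (contract_shape (shape T) e) (shape T)) * c (contract_pairs T e) = 0" by simp
    qed
    then show "df (dual_bar_complex \<epsilon> quad n) d x \<in> complement n (d + 1)"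
      by (simp add: dual_bar_complex_def x bar_diff_bar_element bar_element_in_complement)
  qed
next
  show "inj_on (embed_aug n :: _ \<Rightarrow> 'k quad_class) (car (aspc (QA \<epsilon> n)))"
  proof (rule inj_onI, rule ext)
    fix H H' :: "nat \<times> nat \<Rightarrow> 'k" and p
    assume H: "H \<in> car (aspc (QA \<epsilon> n))" "H' \<in> car (aspc (QA \<epsilon> n))" and eq: "embed_aug n H = embed_aug n H'"
    show "H p = H' p"
    proof (cases "p \<in> square n")
      case True
      then show ?thesis
        using standard_weight_cls[OF eq[unfolded embed_aug_def], of p] standard_weight_comb[OF assms True, of H]
          standard_weight_comb[OF assms True, of H'] by simp
    next
      case False
      have "H \<in> supported_on (square n)" "H' \<in> supported_on (square n)"
        using H by (simp_all add: QA_def fun_space_def)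
      then have "H p = 0" "H' p = 0" using False unfolding supported_on_def by blast+
      then show ?thesis by simp
    qed
  qed
  show "direct_sum (aspc (dual_bar_complex \<epsilon> (quad :: 'k quad_relations) n))
      (embed_aug n ` car (aspc (QA \<epsilon> n))) (aug_complement n)"
    using direct_sum_embed_aug[OF assms] by (simp add: QA_def dual_bar_complex_def fun_space_def)
  show "aug (dual_bar_complex \<epsilon> (quad :: 'k quad_relations) n) ` complement n 0 \<subseteq> aug_complement n"
  proof (rule image_subsetI)
    fix x :: "'k quad_class ptree \<Rightarrow> 'k" assume "x \<in> complement n 0"
    then obtain c where x: "x = bar_element n 0 c" by (auto simp: complement_def)
    with \<open>x \<in> complement n 0\<close> have c: "\<forall>T\<in>bar_trees n 0. standard_pair T \<longrightarrow> c T = 0"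
      by (simp add: bar_element_in_complement)
    let ?y = "\<lambda>t. if t \<in> binary_trees n then c (side_tree t) else 0"
    have "of_bool (standard_at p t) * ?y t = 0" if p: "p \<in> square n" and t: "t \<in> binary_trees n" for p t
    proof (cases "standard_at p t")
      case True
      then have st: "standard fst (fst p) (side_tree t)" "standard snd (snd p) (side_tree t)"
        by (simp_all add: standard_at_def side_tree_def standard_map side_pair_def)
      have T: "side_tree t \<in> bar_trees n 0" using side_tree_bij t by (auto simp: bij_betw_def)
      have "pointers (side_tree t) = p"
        using standard_pointer[OF st(1)] standard_pointer[OF st(2)] p bar_treesD[OF T]
        by (auto simp: pointers_def mem_Times_iff prod_eq_iff)
      then have "standard_pair (side_tree t)" using st by (simp add: standard_pair_def)
      then show ?thesis using c T by simp
    qed simp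
    then have "standard_weight n p ?y = 0" if "p \<in> square n" for p
      unfolding standard_weight_def weight_def using that by (intro sum.neutral) blast
    moreover have "?y \<in> free_operad n" by (simp add: supported_on_def)
    moreover have "aug (dual_bar_complex \<epsilon> quad n) x = cls (quad_ideal n) ?y"
      by (simp add: dual_bar_complex_def x bar_element_generators)
    ultimately show "aug (dual_bar_complex \<epsilon> quad n) x \<in> aug_complement n"
      unfolding aug_complement_def by blast
  qed
qed

lemma image_coeff_embed:
  assumes "T \<in> pair_trees n"
  shows "image_coeff coord n (embed n) x T = (of_bool (x = cell T) :: 'k::field)"
  using representation_bar_element[OF assms, of "deg (snd x)" "\<lambda>T. delta x (cell T) :: 'k"]
  by (auto simp: image_coeff_def embed_def delta_def)

theorem proposition4p5:
  fixes Q :: "(dend_op \<times> dend_op, 'k::{alg_closed_field, field_char_0}) relations"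
  assumes "Q = black_square dend dend"
  shows "(\<forall>\<epsilon>. incidence \<epsilon> \<longrightarrow>
      (\<exists>b. (\<forall>l\<ge>2. is_basis (dual (operad (orth Q) l)) ({1..l} \<times> {1..l}) (b l)) \<and>
           (\<forall>n\<ge>2. \<forall>d\<le>0.
              is_basis (bar_space (orth Q) n d) {T \<in> pair_trees n. deg T = d} (induced_basis b)) \<and>
           (\<forall>n\<ge>2. \<exists>f g.
              chain_map (QA \<epsilon> n) (dual_bar_complex \<epsilon> Q n) f g \<and>
              embeds_as_direct_summand (QA \<epsilon> n) (dual_bar_complex \<epsilon> Q n) f g \<and>
              (\<forall>T\<in>pair_trees n. \<exists>x\<in>qa_basis n. image_coeff b n f x T = 1 \<and>
                 (\<forall>y\<in>qa_basis n. y \<noteq> x \<longrightarrow> image_coeff b n f y T = 0)))))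
    \<and> (\<forall>n\<ge>1. has_dim (operad (orth Q) n) (n\<^sup>2))"
  unfolding assms
proof (intro conjI allI impI exI[of _ coord])
  fix \<epsilon> and n :: nat
  assume \<epsilon>: "incidence \<epsilon>" and n: "2 \<le> n"
  have "\<exists>x\<in>qa_basis n. image_coeff coord n (embed n :: _ \<Rightarrow> _ \<Rightarrow> 'k quad_class ptree \<Rightarrow> 'k) x T = 1 \<and>
      (\<forall>y\<in>qa_basis n. y \<noteq> x \<longrightarrow> image_coeff coord n (embed n :: _ \<Rightarrow> _ \<Rightarrow> 'k quad_class ptree \<Rightarrow> 'k) y T = 0)"
    if "T \<in> pair_trees n" for T
    using that cell_in_qa_basis[OF that] by (intro bexI[of _ "cell T"]) (simp_all add: image_coeff_embed)
  then show "\<exists>f g.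
      chain_map (QA \<epsilon> n) (dual_bar_complex \<epsilon> (quad :: 'k quad_relations) n) f g \<and>
      embeds_as_direct_summand (QA \<epsilon> n) (dual_bar_complex \<epsilon> (quad :: 'k quad_relations) n) f g \<and>
      (\<forall>T\<in>pair_trees n. \<exists>x\<in>qa_basis n. image_coeff coord n f x T = 1 \<and>
        (\<forall>y\<in>qa_basis n. y \<noteq> x \<longrightarrow> image_coeff coord n f y T = 0))"
    using chain_map_embed[OF \<epsilon>, of n] embeds[of n \<epsilon>] n by (intro exI[of _ "embed n"] exI[of _ "embed_aug n"]) simp
qed (simp_all add: is_basis_coord[simplified] is_basis_induced_basis has_dim_quad_dual[simplified])

end
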